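(* Let $k$ be a commutative ring and let $A$ be a Hopf category in $\mathcal M_k^{\mathrm f}(X)$, i.e. a Hopf $\mathcal M_k^{\mathrm f}$-category with underlying class $X$. The antipode maps $S_{x,y}:A_{x,y}\to A_{y,x}$ are bijective, for all $x,y\in X$.
   Context: $\mathcal M_k^{\mathrm f}$ is the category of finitely generated projective $k$-modules; $\otimes=\otimes_k$. A Hopf $\mathcal M_k^{\mathrm f}$-category $A$ with underlying class $X$ consists of $k$-coalgebras $A_{x,y}$ ($x,y\in X$), finitely generated and projective as $k$-modules, with comultiplication $\Delta_{x,y}(h)=h_{(1)}\otimes h_{(2)}$ and counit $\varepsilon_{x,y}$, coalgebra morphisms $A_{x,y}\otimes A_{y,z}\to A_{x,z}$, $h\otimes l\mapsto hl$, and $k\to A_{x,x}$, $1\mapsto1_x$, which are associative and unital, and $k$-linear maps (the antipode) $S_{x,y}:A_{x,y}\to A_{y,x}$ with $h_{(1)}S_{x,y}(h_{(2)})=\varepsilon_{x,y}(h)1_x$ and $S_{x,y}(h_{(1)})h_{(2)}=\varepsilon_{x,y}(h)1_y$ for all $x,y\in X$ and $h\in A_{x,y}$. *)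

theory Defs
  imports "HOL-Algebra.Module"
begin

section \<open>Linear maps and finitely generated projective modules\<close>

definition linear_maps ::
  "('c, 'r) ring_scheme \<Rightarrow> ('c, 'a, 'm) module_scheme \<Rightarrow> ('c, 'b, 'n) module_scheme \<Rightarrow> ('a \<Rightarrow> 'b) set"
  where "linear_maps k M N = {f \<in> carrier M \<rightarrow> carrier N.
    (\<forall>u\<in>carrier M. \<forall>v\<in>carrier M. f (u \<oplus>\<^bsub>M\<^esub> v) = f u \<oplus>\<^bsub>N\<^esub> f v) \<and>
    (\<forall>r\<in>carrier k. \<forall>u\<in>carrier M. f (r \<odot>\<^bsub>M\<^esub> u) = r \<odot>\<^bsub>N\<^esub> f u)}"

definition finitely_generated :: "('c, 'r) ring_scheme \<Rightarrow> ('c, 'a, 'm) module_scheme \<Rightarrow> bool"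
  where "finitely_generated k M \<longleftrightarrow> (\<exists>G. finite G \<and> G \<subseteq> carrier M \<and>
    (\<forall>m\<in>carrier M. \<exists>c\<in>G \<rightarrow> carrier k. m = (\<Oplus>\<^bsub>M\<^esub>g\<in>G. c g \<odot>\<^bsub>M\<^esub> g)))"

text \<open>The fields \<open>mult\<close> and \<open>one\<close>, which the record of modules inherits from that of
  rings, play no role in modules.\<close>

definition free_module :: "('c, 'r) ring_scheme \<Rightarrow> 'i set \<Rightarrow> ('c, 'i \<Rightarrow> 'c) module"
  where "free_module k I =
    \<lparr>carrier = {f. (\<forall>i. f i \<in> carrier k) \<and> (\<forall>i. i \<notin> I \<longrightarrow> f i = \<zero>\<^bsub>k\<^esub>) \<and> finite {i. f i \<noteq> \<zero>\<^bsub>k\<^esub>}},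
     mult = undefined, one = undefined,
     zero = (\<lambda>i. \<zero>\<^bsub>k\<^esub>), add = (\<lambda>f g i. f i \<oplus>\<^bsub>k\<^esub> g i),
     smult = (\<lambda>r f i. r \<otimes>\<^bsub>k\<^esub> f i)\<rparr>"

text \<open>A module is projective if it is a direct summand of a free module, i.e. if the identity
  factors through a free module.  Index sets of the element type suffice: if \<open>M\<close> is a direct
  summand of any free module, it is one of the free module on \<open>carrier M\<close>.\<close>

definition projective :: "('c, 'r) ring_scheme \<Rightarrow> ('c, 'a, 'm) module_scheme \<Rightarrow> bool"
  where "projective k M \<longleftrightarrow> (\<exists>(I::'a set). \<exists>\<iota> \<in> linear_maps k M (free_module k I).
    \<exists>\<pi> \<in> linear_maps k (free_module k I) M. \<forall>m\<in>carrier M. \<pi> (\<iota> m) = m)"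

definition base_module :: "('c, 'r) ring_scheme \<Rightarrow> ('c, 'c) module"
  where "base_module k =
    \<lparr>carrier = carrier k, mult = mult k, one = \<one>\<^bsub>k\<^esub>,
     zero = \<zero>\<^bsub>k\<^esub>, add = add k, smult = mult k\<rparr>"


section \<open>Tensor products\<close>

text \<open>A list of pairs stands for the formal sum of the tensors of its entries.  The tensor
  product is the set of these lists modulo the least congruence (for concatenation) which makes
  concatenation commutative and \<open>(m, n) \<mapsto> [(m, n)]\<close> bilinear.\<close>

inductive tensor_rel ::
  "('c, 'r) ring_scheme \<Rightarrow> ('c, 'a, 'm) module_scheme \<Rightarrow> ('c, 'b, 'n) module_scheme \<Rightarrow>
   ('a \<times> 'b) list \<Rightarrow> ('a \<times> 'b) list \<Rightarrow> bool"
  for k M N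
  where
    refl: "set u \<subseteq> carrier M \<times> carrier N \<Longrightarrow> tensor_rel k M N u u"
  | sym: "tensor_rel k M N u v \<Longrightarrow> tensor_rel k M N v u"
  | trans: "tensor_rel k M N u v \<Longrightarrow> tensor_rel k M N v w \<Longrightarrow> tensor_rel k M N u w"
  | append: "tensor_rel k M N u u' \<Longrightarrow> tensor_rel k M N v v' \<Longrightarrow> tensor_rel k M N (u @ v) (u' @ v')"
  | comm: "set u \<subseteq> carrier M \<times> carrier N \<Longrightarrow> set v \<subseteq> carrier M \<times> carrier N \<Longrightarrow>
      tensor_rel k M N (u @ v) (v @ u)"
  | add_left: "m \<in> carrier M \<Longrightarrow> m' \<in> carrier M \<Longrightarrow> n \<in> carrier N \<Longrightarrow>
      tensor_rel k M N [(m \<oplus>\<^bsub>M\<^esub> m', n)] [(m, n), (m', n)]"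
  | add_right: "m \<in> carrier M \<Longrightarrow> n \<in> carrier N \<Longrightarrow> n' \<in> carrier N \<Longrightarrow>
      tensor_rel k M N [(m, n \<oplus>\<^bsub>N\<^esub> n')] [(m, n), (m, n')]"
  | zero_left: "n \<in> carrier N \<Longrightarrow> tensor_rel k M N [(\<zero>\<^bsub>M\<^esub>, n)] []"
  | balanced: "r \<in> carrier k \<Longrightarrow> m \<in> carrier M \<Longrightarrow> n \<in> carrier N \<Longrightarrow>
      tensor_rel k M N [(r \<odot>\<^bsub>M\<^esub> m, n)] [(m, r \<odot>\<^bsub>N\<^esub> n)]"

definition tensor_class ::
  "('c, 'r) ring_scheme \<Rightarrow> ('c, 'a, 'm) module_scheme \<Rightarrow> ('c, 'b, 'n) module_scheme \<Rightarrow>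
   ('a \<times> 'b) list \<Rightarrow> ('a \<times> 'b) list set"
  where "tensor_class k M N u = {v. tensor_rel k M N u v}"

definition tensor ::
  "('c, 'r) ring_scheme \<Rightarrow> ('c, 'a, 'm) module_scheme \<Rightarrow> ('c, 'b, 'n) module_scheme \<Rightarrow>
   ('c, ('a \<times> 'b) list set) module"
  where "tensor k M N =
    \<lparr>carrier = {tensor_class k M N u | u. set u \<subseteq> carrier M \<times> carrier N},
     mult = undefined, one = undefined,
     zero = tensor_class k M N [],
     add = (\<lambda>s t. {w. \<exists>u\<in>s. \<exists>v\<in>t. tensor_rel k M N (u @ v) w}),
     smult = (\<lambda>r t. {w. \<exists>u\<in>t. tensor_rel k M N (map (\<lambda>(m, n). (r \<odot>\<^bsub>M\<^esub> m, n)) u) w})\<rparr>"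

definition pure_tensor ::
  "('c, 'r) ring_scheme \<Rightarrow> ('c, 'a, 'm) module_scheme \<Rightarrow> ('c, 'b, 'n) module_scheme \<Rightarrow>
   'a \<Rightarrow> 'b \<Rightarrow> ('a \<times> 'b) list set"
  where "pure_tensor k M N m n = tensor_class k M N [(m, n)]"

text \<open>The linear map on a tensor product induced by a bilinear map \<open>b\<close> into \<open>P\<close>; the choice of
  a representative is irrelevant by \<open>tensor_lift_class\<close> below.\<close>

definition formal_sum :: "('c, 'p, 'q) module_scheme \<Rightarrow> ('a \<Rightarrow> 'b \<Rightarrow> 'p) \<Rightarrow> ('a \<times> 'b) list \<Rightarrow> 'p"
  where "formal_sum P b u = foldr (\<lambda>(m, n) s. b m n \<oplus>\<^bsub>P\<^esub> s) u \<zero>\<^bsub>P\<^esub>"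

definition tensor_lift :: "('c, 'p, 'q) module_scheme \<Rightarrow> ('a \<Rightarrow> 'b \<Rightarrow> 'p) \<Rightarrow> ('a \<times> 'b) list set \<Rightarrow> 'p"
  where "tensor_lift P b t = formal_sum P b (SOME u. u \<in> t)"

definition bilinear_maps ::
  "('c, 'r) ring_scheme \<Rightarrow> ('c, 'a, 'm) module_scheme \<Rightarrow> ('c, 'b, 'n) module_scheme \<Rightarrow>
   ('c, 'p, 'q) module_scheme \<Rightarrow> ('a \<Rightarrow> 'b \<Rightarrow> 'p) set"
  where "bilinear_maps k M N P =
    {b. (\<forall>m\<in>carrier M. b m \<in> linear_maps k N P) \<and>
        (\<forall>n\<in>carrier N. (\<lambda>m. b m n) \<in> linear_maps k M P)}"

definition tensor_map ::
  "('c, 'r) ring_scheme \<Rightarrow> ('c, 'p, 'm) module_scheme \<Rightarrow> ('c, 'q, 'n) module_scheme \<Rightarrow>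
   ('a \<Rightarrow> 'p) \<Rightarrow> ('b \<Rightarrow> 'q) \<Rightarrow> ('a \<times> 'b) list set \<Rightarrow> ('p \<times> 'q) list set"
  where "tensor_map k P Q f g =
    tensor_lift (tensor k P Q) (\<lambda>m n. pure_tensor k P Q (f m) (g n))"

definition tensor_assoc ::
  "('c, 'r) ring_scheme \<Rightarrow> ('c, 'a, 'm) module_scheme \<Rightarrow> ('c, 'b, 'n) module_scheme \<Rightarrow>
   ('c, 'd, 'p) module_scheme \<Rightarrow>
   (('a \<times> 'b) list set \<times> 'd) list set \<Rightarrow> ('a \<times> ('b \<times> 'd) list set) list set"
  where "tensor_assoc k L M N =
    tensor_lift (tensor k L (tensor k M N))
      (\<lambda>t n. tensor_lift (tensor k L (tensor k M N))
        (\<lambda>l m. pure_tensor k L (tensor k M N) l (pure_tensor k M N m n)) t)"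


subsection \<open>Well-definedness\<close>

lemma tensor_rel_carrier:
  assumes "module k M" "module k N" "tensor_rel k M N u v"
  shows "set u \<subseteq> carrier M \<times> carrier N \<and> set v \<subseteq> carrier M \<times> carrier N"
proof -
  interpret M: module k M by fact
  interpret N: module k N by fact
  from assms(3) show ?thesis by induction auto
qed

lemma tensor_class_self:
  "set u \<subseteq> carrier M \<times> carrier N \<Longrightarrow> u \<in> tensor_class k M N u"
  by (simp add: tensor_class_def tensor_rel.refl)

lemma tensor_class_eqI:
  "tensor_rel k M N u v \<Longrightarrow> tensor_class k M N u = tensor_class k M N v"
  unfolding tensor_class_def by (blast intro: tensor_rel.sym tensor_rel.trans)

lemma formal_sum_simps [simp]:
  "formal_sum P b [] = \<zero>\<^bsub>P\<^esub>"
  "formal_sum P b ((m, n) # u) = b m n \<oplus>\<^bsub>P\<^esub> formal_sum P b u"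
  by (simp_all add: formal_sum_def)

lemma bilinear_mapsD:
  assumes "b \<in> bilinear_maps k M N P"
  shows "m \<in> carrier M \<Longrightarrow> n \<in> carrier N \<Longrightarrow> b m n \<in> carrier P"
    and "m \<in> carrier M \<Longrightarrow> m' \<in> carrier M \<Longrightarrow> n \<in> carrier N \<Longrightarrow>
      b (m \<oplus>\<^bsub>M\<^esub> m') n = b m n \<oplus>\<^bsub>P\<^esub> b m' n"
    and "m \<in> carrier M \<Longrightarrow> n \<in> carrier N \<Longrightarrow> n' \<in> carrier N \<Longrightarrow>
      b m (n \<oplus>\<^bsub>N\<^esub> n') = b m n \<oplus>\<^bsub>P\<^esub> b m n'"
    and "r \<in> carrier k \<Longrightarrow> m \<in> carrier M \<Longrightarrow> n \<in> carrier N \<Longrightarrow> b (r \<odot>\<^bsub>M\<^esub> m) n = r \<odot>\<^bsub>P\<^esub> b m n"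
    and "r \<in> carrier k \<Longrightarrow> m \<in> carrier M \<Longrightarrow> n \<in> carrier N \<Longrightarrow> b m (r \<odot>\<^bsub>N\<^esub> n) = r \<odot>\<^bsub>P\<^esub> b m n"
  using assms by (auto simp: bilinear_maps_def linear_maps_def)

lemma formal_sum_closed:
  assumes "module k P" "b \<in> bilinear_maps k M N P" "set u \<subseteq> carrier M \<times> carrier N"
  shows "formal_sum P b u \<in> carrier P"
proof -
  interpret P: module k P by fact
  from assms(3) show ?thesis
    by (induction u) (auto simp: bilinear_mapsD[OF assms(2)])
qed

lemma formal_sum_append:
  assumes "module k P" "b \<in> bilinear_maps k M N P"
    "set u \<subseteq> carrier M \<times> carrier N" "set v \<subseteq> carrier M \<times> carrier N"
  shows "formal_sum P b (u @ v) = formal_sum P b u \<oplus>\<^bsub>P\<^esub> formal_sum P b v"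
proof -
  interpret P: module k P by fact
  have v: "formal_sum P b v \<in> carrier P"
    using assms formal_sum_closed by blast
  from assms(3) show ?thesis
  proof (induction u)
    case (Cons x u)
    then have "formal_sum P b u \<in> carrier P"
      using formal_sum_closed[OF assms(1,2)] by auto
    with Cons v show ?case
      by (cases x) (auto simp: bilinear_mapsD[OF assms(2)] P.a_assoc)
  qed (use v in simp)
qed

lemma formal_sum_cong:
  assumes "module k M" "module k N" "module k P" "b \<in> bilinear_maps k M N P"
    "tensor_rel k M N u v"
  shows "formal_sum P b u = formal_sum P b v"
proof -
  interpret M: module k M by fact
  interpret N: module k N by fact
  interpret P: module k P by fact
  note b = bilinear_mapsD[OF assms(4)]
  note app = formal_sum_append[OF assms(3,4)]
  note cl = formal_sum_closed[OF assms(3,4)]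
  from assms(5) show ?thesis
  proof induction
    case (append u u' v v')
    then show ?case
      using tensor_rel_carrier[OF assms(1,2)] app by metis
  next
    case (comm u v)
    then show ?case by (simp add: app cl P.a_comm)
  next
    case (zero_left n)
    have "b (\<zero>\<^bsub>k\<^esub> \<odot>\<^bsub>M\<^esub> \<zero>\<^bsub>M\<^esub>) n = \<zero>\<^bsub>P\<^esub>"
      using zero_left by (simp add: b del: M.smult_l_null M.smult_r_null)
    then show ?case by simp
  qed (auto simp: b P.a_assoc)
qed

lemma tensor_lift_class:
  assumes "module k M" "module k N" "module k P" "b \<in> bilinear_maps k M N P"
    "set u \<subseteq> carrier M \<times> carrier N"
  shows "tensor_lift P b (tensor_class k M N u) = formal_sum P b u"
proof -
  have "(SOME v. v \<in> tensor_class k M N u) \<in> tensor_class k M N u"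
    using tensor_class_self[OF assms(5)] by (rule someI)
  then show ?thesis
    using formal_sum_cong[OF assms(1-4)] by (simp add: tensor_lift_def tensor_class_def)
qed

lemma tensor_add_class:
  assumes "set u \<subseteq> carrier M \<times> carrier N" "set v \<subseteq> carrier M \<times> carrier N"
  shows "tensor_class k M N u \<oplus>\<^bsub>tensor k M N\<^esub> tensor_class k M N v = tensor_class k M N (u @ v)"
  using assms unfolding tensor_def tensor_class_def
  by (auto intro: tensor_rel.refl tensor_rel.append tensor_rel.trans)

lemma tensor_rel_smult:
  assumes "module k M" "module k N" "r \<in> carrier k" "tensor_rel k M N u v"
  shows "tensor_rel k M N (map (\<lambda>(m, n). (r \<odot>\<^bsub>M\<^esub> m, n)) u) (map (\<lambda>(m, n). (r \<odot>\<^bsub>M\<^esub> m, n)) v)"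
proof -
  interpret M: module k M by fact
  interpret N: module k N by fact
  have sub: "set u \<subseteq> carrier M \<times> carrier N \<Longrightarrow>
    set (map (\<lambda>(m, n). (r \<odot>\<^bsub>M\<^esub> m, n)) u) \<subseteq> carrier M \<times> carrier N" for u
    using assms(3) by auto
  from assms(4) show ?thesis
  proof induction
    case (refl u)
    then show ?case using sub by (blast intro: tensor_rel.refl)
  next
    case (comm u v)
    then show ?case using sub by (simp add: tensor_rel.comm)
  next
    case (balanced s m n)
    have "r \<odot>\<^bsub>M\<^esub> (s \<odot>\<^bsub>M\<^esub> m) = s \<odot>\<^bsub>M\<^esub> (r \<odot>\<^bsub>M\<^esub> m)"
      using balanced assms(3) by (metis M.R.m_comm M.smult_assoc1)
    then show ?case
      using balanced assms(3) by (simp add: tensor_rel.balanced)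
  qed (use assms(3) in \<open>auto simp: M.smult_r_distr
      intro: tensor_rel.sym tensor_rel.trans tensor_rel.append
        tensor_rel.add_left tensor_rel.add_right tensor_rel.zero_left\<close>)
qed

lemma tensor_smult_class:
  assumes "module k M" "module k N" "r \<in> carrier k" "set u \<subseteq> carrier M \<times> carrier N"
  shows "r \<odot>\<^bsub>tensor k M N\<^esub> tensor_class k M N u
    = tensor_class k M N (map (\<lambda>(m, n). (r \<odot>\<^bsub>M\<^esub> m, n)) u)"
  using tensor_rel_smult[OF assms(1-3)] assms(4) unfolding tensor_def tensor_class_def
  by (auto intro: tensor_rel.refl tensor_rel.trans)

lemma tensor_module:
  assumes "module k M" "module k N"
  shows "module k (tensor k M N)"
proof -
  interpret M: module k M by fact
  interpret N: module k N by fact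
  let ?T = "tensor k M N" and ?cl = "tensor_class k M N"
  let ?ok = "\<lambda>u. set u \<subseteq> carrier M \<times> carrier N"
  let ?s = "\<lambda>r. map (\<lambda>(m, n). (r \<odot>\<^bsub>M\<^esub> m, n))"
  have s_ok: "r \<in> carrier k \<Longrightarrow> ?ok u \<Longrightarrow> ?ok (?s r u)" for r u by auto
  have rep: "\<exists>u. t = ?cl u \<and> ?ok u" if "t \<in> carrier ?T" for t
    using that by (auto simp: tensor_def)
  have cl: "?ok u \<Longrightarrow> ?cl u \<in> carrier ?T" for u
    by (auto simp: tensor_def)
  have zero: "\<zero>\<^bsub>?T\<^esub> = ?cl []" by (simp add: tensor_def)
  note add = tensor_add_class[of _ M N, where k=k]
  note smult = tensor_smult_class[OF assms]
  have split: "tensor_rel k M N (?s (r \<oplus>\<^bsub>k\<^esub> r') u) (?s r u @ ?s r' u)"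
    if r: "r \<in> carrier k" "r' \<in> carrier k" and "?ok u" for r r' u
    using that(3)
  proof (induction u)
    case Nil
    show ?case by (simp add: tensor_rel.refl)
  next
    case (Cons x u)
    obtain m n where x: "x = (m, n)" "m \<in> carrier M" "n \<in> carrier N"
      using Cons.prems by (cases x) auto
    have ok: "?ok (?s r u)" "?ok (?s r' u)" "?ok [(r \<odot>\<^bsub>M\<^esub> m, n)]" "?ok [(r' \<odot>\<^bsub>M\<^esub> m, n)]"
      using s_ok r Cons.prems x by auto
    have "tensor_rel k M N ([(r \<odot>\<^bsub>M\<^esub> m \<oplus>\<^bsub>M\<^esub> r' \<odot>\<^bsub>M\<^esub> m, n)] @ ?s (r \<oplus>\<^bsub>k\<^esub> r') u)
        ([(r \<odot>\<^bsub>M\<^esub> m, n), (r' \<odot>\<^bsub>M\<^esub> m, n)] @ (?s r u @ ?s r' u))"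
      using Cons r x by (intro tensor_rel.append tensor_rel.add_left) auto
    moreover have "tensor_rel k M N
        ([(r \<odot>\<^bsub>M\<^esub> m, n)] @ (([(r' \<odot>\<^bsub>M\<^esub> m, n)] @ ?s r u) @ ?s r' u))
        ([(r \<odot>\<^bsub>M\<^esub> m, n)] @ ((?s r u @ [(r' \<odot>\<^bsub>M\<^esub> m, n)]) @ ?s r' u))"
      using ok by (intro tensor_rel.append tensor_rel.comm tensor_rel.refl)
    ultimately show ?case
      using r x by (auto simp: M.smult_l_distr intro: tensor_rel.trans)
  qed
  have neg: "\<exists>s \<in> carrier ?T. s \<oplus>\<^bsub>?T\<^esub> ?cl u = \<zero>\<^bsub>?T\<^esub>" if u: "?ok u" for u
  proof -
    have z: "tensor_rel k M N (?s \<zero>\<^bsub>k\<^esub> u) []"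
      using u
    proof (induction u)
      case Nil
      show ?case by (simp add: tensor_rel.refl)
    next
      case (Cons x u)
      obtain m n where x: "x = (m, n)" "m \<in> carrier M" "n \<in> carrier N"
        using Cons.prems by (cases x) auto
      have "tensor_rel k M N ([(\<zero>\<^bsub>M\<^esub>, n)] @ ?s \<zero>\<^bsub>k\<^esub> u) ([] @ [])"
        using Cons x by (intro tensor_rel.append tensor_rel.zero_left) auto
      with x show ?case by simp
    qed
    have one: "?s \<one>\<^bsub>k\<^esub> u = u"
      using u by (induction u) auto
    have "tensor_rel k M N (?s (\<ominus>\<^bsub>k\<^esub> \<one>\<^bsub>k\<^esub> \<oplus>\<^bsub>k\<^esub> \<one>\<^bsub>k\<^esub>) u) (?s (\<ominus>\<^bsub>k\<^esub> \<one>\<^bsub>k\<^esub>) u @ ?s \<one>\<^bsub>k\<^esub> u)"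
      using u by (intro split) auto
    then have "tensor_rel k M N (?s (\<ominus>\<^bsub>k\<^esub> \<one>\<^bsub>k\<^esub>) u @ u) []"
      unfolding one M.R.l_neg[OF M.R.one_closed] using z
      by (blast intro: tensor_rel.sym tensor_rel.trans)
    moreover have "?ok (?s (\<ominus>\<^bsub>k\<^esub> \<one>\<^bsub>k\<^esub>) u)"
      using u s_ok by auto
    ultimately show ?thesis
      using u cl add zero tensor_class_eqI by metis
  qed
  show ?thesis
  proof (intro moduleI abelian_groupI)
    show "cring k" by (rule M.R.cring_axioms)
  next
    fix s t assume "s \<in> carrier ?T" "t \<in> carrier ?T"
    then obtain u v where *: "s = ?cl u" "?ok u" "t = ?cl v" "?ok v"
      using rep by metis
    show "s \<oplus>\<^bsub>?T\<^esub> t \<in> carrier ?T"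
      using * by (simp add: add cl)
    show "s \<oplus>\<^bsub>?T\<^esub> t = t \<oplus>\<^bsub>?T\<^esub> s"
      using * by (simp add: add tensor_class_eqI[OF tensor_rel.comm])
  next
    show "\<zero>\<^bsub>?T\<^esub> \<in> carrier ?T" by (simp add: zero cl)
  next
    fix s t w assume "s \<in> carrier ?T" "t \<in> carrier ?T" "w \<in> carrier ?T"
    then obtain u v x where "s = ?cl u" "?ok u" "t = ?cl v" "?ok v" "w = ?cl x" "?ok x"
      using rep by metis
    then show "(s \<oplus>\<^bsub>?T\<^esub> t) \<oplus>\<^bsub>?T\<^esub> w = s \<oplus>\<^bsub>?T\<^esub> (t \<oplus>\<^bsub>?T\<^esub> w)"
      by (simp add: add)
  next
    fix t assume "t \<in> carrier ?T"
    then obtain u where *: "t = ?cl u" "?ok u" using rep by metis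
    show "\<zero>\<^bsub>?T\<^esub> \<oplus>\<^bsub>?T\<^esub> t = t"
      using * add[of "[]" u] by (simp add: zero)
    show "\<exists>s\<in>carrier ?T. s \<oplus>\<^bsub>?T\<^esub> t = \<zero>\<^bsub>?T\<^esub>"
      using * neg by simp
    have "?s \<one>\<^bsub>k\<^esub> u = u"
      using *(2) by (induction u) auto
    then show "\<one>\<^bsub>k\<^esub> \<odot>\<^bsub>?T\<^esub> t = t"
      using * by (simp add: smult)
  next
    fix r t assume r: "r \<in> carrier k" and "t \<in> carrier ?T"
    then obtain u where "t = ?cl u" "?ok u" using rep by metis
    then show "r \<odot>\<^bsub>?T\<^esub> t \<in> carrier ?T"
      using r by (simp add: smult cl[OF s_ok])
  next
    fix r r' t assume r: "r \<in> carrier k" "r' \<in> carrier k" and "t \<in> carrier ?T"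
    then obtain u where *: "t = ?cl u" "?ok u" using rep by metis
    show "(r \<oplus>\<^bsub>k\<^esub> r') \<odot>\<^bsub>?T\<^esub> t = r \<odot>\<^bsub>?T\<^esub> t \<oplus>\<^bsub>?T\<^esub> r' \<odot>\<^bsub>?T\<^esub> t"
      using * r by (simp add: smult add[OF s_ok s_ok] tensor_class_eqI[OF split])
    have "?s (r \<otimes>\<^bsub>k\<^esub> r') u = ?s r (?s r' u)"
      using *(2) r by (induction u) (auto simp: M.smult_assoc1)
    then show "(r \<otimes>\<^bsub>k\<^esub> r') \<odot>\<^bsub>?T\<^esub> t = r \<odot>\<^bsub>?T\<^esub> (r' \<odot>\<^bsub>?T\<^esub> t)"
      using * r by (simp add: smult smult[OF _ s_ok] del: map_map)
  next
    fix r s t assume r: "r \<in> carrier k" and "s \<in> carrier ?T" "t \<in> carrier ?T"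
    then obtain u v where *: "s = ?cl u" "?ok u" "t = ?cl v" "?ok v"
      using rep by metis
    then have "?ok (u @ v)" by simp
    then show "r \<odot>\<^bsub>?T\<^esub> (s \<oplus>\<^bsub>?T\<^esub> t) = r \<odot>\<^bsub>?T\<^esub> s \<oplus>\<^bsub>?T\<^esub> r \<odot>\<^bsub>?T\<^esub> t"
      using * r by (simp add: add smult add[OF s_ok s_ok])
  qed
qed

lemma pure_tensor_bilinear: assumes "module k M" "module k N"
  shows "pure_tensor k M N \<in> bilinear_maps k M N (tensor k M N)"
proof -
  interpret M: module k M by fact
  interpret N: module k N by fact
  show ?thesis
    unfolding bilinear_maps_def linear_maps_def pure_tensor_def
    apply (auto simp: tensor_add_class tensor_smult_class[OF assms] 
       intro!: tensor_class_eqI tensor_rel.add_left tensor_rel.add_right)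
    subgoal by (auto simp: tensor_def)
    subgoal by (intro tensor_rel.sym[OF tensor_rel.balanced])
    subgoal by (auto simp: tensor_def)
    done
qed

lemma tensor_lift_pure: assumes "module k M" "module k N" "module k P" "b \<in> bilinear_maps k M N P" "m \<in> carrier M" "n \<in> carrier N"
  shows "tensor_lift P b (pure_tensor k M N m n) = b m n"
proof -
  interpret P: module k P by fact
  show ?thesis unfolding pure_tensor_def
   using tensor_lift_class[OF assms(1-4), of "[(m,n)]"] assms bilinear_mapsD(1)[OF assms(4)] by simp
qed

lemma tensor_lift_linear: assumes "module k M" "module k N" "module k P" "b \<in> bilinear_maps k M N P"
  shows "tensor_lift P b \<in> linear_maps k (tensor k M N) P"
proof -
  interpret M: module k M by fact
  interpret N: module k N by fact
  interpret P: module k P by fact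
  note L = tensor_lift_class[OF assms]
  have rep: "\<exists>u. t = tensor_class k M N u \<and> set u \<subseteq> carrier M \<times> carrier N" if "t \<in> carrier (tensor k M N)" for t
    using that by (auto simp: tensor_def)
  have sm: "formal_sum P b (map (\<lambda>(m, n). (r \<odot>\<^bsub>M\<^esub> m, n)) u) = r \<odot>\<^bsub>P\<^esub> formal_sum P b u" 
    if "r \<in> carrier k" "set u \<subseteq> carrier M \<times> carrier N" for r u
    using that(2) 
    by (induction u) (use that(1) in \<open>auto simp: bilinear_mapsD[OF assms(4)] P.smult_r_distr formal_sum_closed[OF assms(3,4)]\<close>)
  show ?thesis unfolding linear_maps_def
  proof (safe, goal_cases)
    case (1 t) then show ?case using rep L formal_sum_closed[OF assms(3,4)] by metis
  next
    case (2 s t) 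
    then obtain u v where *: "s = tensor_class k M N u" "set u \<subseteq> carrier M \<times> carrier N" "t = tensor_class k M N v" "set v \<subseteq> carrier M \<times> carrier N" using rep by metis
    then show ?case by (simp add: tensor_add_class L formal_sum_append[OF assms(3,4)])
  next
    case (3 r t)
    then obtain u where *: "t = tensor_class k M N u" "set u \<subseteq> carrier M \<times> carrier N" using rep by metis
    then have "set (map (\<lambda>(m, n). (r \<odot>\<^bsub>M\<^esub> m, n)) u) \<subseteq> carrier M \<times> carrier N" using 3 by auto
    then show ?case using * 3 by (simp add: tensor_smult_class[OF assms(1,2)] L sm)
  qed
qed

text \<open>The tensor product depends only on the module structures, not on the record types.\<close>

lemma tensor_rel_fields:
  assumes "tensor_rel k M N u v"
    "carrier M = carrier M'" "add M = add M'" "zero M = zero M'" "smult M = smult M'"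
    "carrier N = carrier N'" "add N = add N'" "smult N = smult N'"
  shows "tensor_rel k M' N' u v"
  using assms(1)
  by induction (use assms(2-) in \<open>auto intro: tensor_rel.intros\<close>)

lemma tensor_class_fields:
  assumes 
    "carrier M = carrier M'" "add M = add M'" "zero M = zero M'" "smult M = smult M'"
    "carrier N = carrier N'" "add N = add N'" "smult N = smult N'"
  shows "tensor_class k M N = tensor_class k M' N'"
  unfolding tensor_class_def
  using tensor_rel_fields[of k M N _ _ M' N'] tensor_rel_fields[of k M' N' _ _ M N] assms by (intro ext) auto

lemma tensor_fields:
  assumes 
    "carrier M = carrier M'" "add M = add M'" "zero M = zero M'" "smult M = smult M'"
    "carrier N = carrier N'" "add N = add N'" "smult N = smult N'"
  shows "tensor k M N = tensor k M' N'" "pure_tensor k M N = pure_tensor k M' N'"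
proof -
  have r: "tensor_rel k M N = tensor_rel k M' N'"
    using tensor_class_fields[OF assms, of k] unfolding tensor_class_def by (metis Collect_inj ext)
  have c: "tensor_class k M N = tensor_class k M' N'"
    using tensor_class_fields[OF assms, of k] .
  show "tensor k M N = tensor k M' N'"  unfolding tensor_def r c using assms by simp
  show "pure_tensor k M N = pure_tensor k M' N'"  unfolding pure_tensor_def c ..
qed


section \<open>Coalgebras\<close>

record ('c, 'a) coalgebra = "('c, 'a) module" +
  comult :: "'a \<Rightarrow> ('a \<times> 'a) list set"
  counit :: "'a \<Rightarrow> 'c"

locale coalgebra = module k C for k (structure) and C (structure) +
  assumes comult_linear: "comult C \<in> linear_maps k C (tensor k C C)"
    and counit_linear: "counit C \<in> linear_maps k C (base_module k)"
    and coassoc: "h \<in> carrier C \<Longrightarrow>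
      tensor_assoc k C C C (tensor_map k (tensor k C C) C (comult C) id (comult C h))
      = tensor_map k C (tensor k C C) id (comult C) (comult C h)"
    and counit_left: "h \<in> carrier C \<Longrightarrow>
      tensor_lift C (\<lambda>a b. counit C a \<odot>\<^bsub>C\<^esub> b) (comult C h) = h"
    and counit_right: "h \<in> carrier C \<Longrightarrow>
      tensor_lift C (\<lambda>a b. counit C b \<odot>\<^bsub>C\<^esub> a) (comult C h) = h"

definition coalgebra_maps ::
  "('c, 'r) ring_scheme \<Rightarrow> ('c, 'a, 'm) coalgebra_scheme \<Rightarrow> ('c, 'b, 'n) coalgebra_scheme \<Rightarrow>
   ('a \<Rightarrow> 'b) set"
  where "coalgebra_maps k C D = {f \<in> linear_maps k C D. \<forall>h\<in>carrier C.
    comult D (f h) = tensor_map k D D f f (comult C h) \<and> counit D (f h) = counit C h}"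

definition base_coalgebra :: "('c, 'r) ring_scheme \<Rightarrow> ('c, 'c) coalgebra"
  where "base_coalgebra k = module.extend (base_module k)
    \<lparr>comult = (\<lambda>r. pure_tensor k (base_module k) (base_module k) r \<one>\<^bsub>k\<^esub>), counit = (\<lambda>r. r)\<rparr>"

text \<open>The middle four interchange \<open>(C \<otimes> C) \<otimes> (D \<otimes> D) \<rightarrow> (C \<otimes> D) \<otimes> (C \<otimes> D)\<close>, as a
  function of two arguments.\<close>

definition tensor_interchange ::
  "('c, 'r) ring_scheme \<Rightarrow> ('c, 'a, 'm) module_scheme \<Rightarrow> ('c, 'b, 'n) module_scheme \<Rightarrow>
   ('a \<times> 'a) list set \<Rightarrow> ('b \<times> 'b) list set \<Rightarrow>
   (('a \<times> 'b) list set \<times> ('a \<times> 'b) list set) list set"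
  where "tensor_interchange k C D s t =
    (let T = tensor k C D; TT = tensor k T T in
     tensor_lift TT (\<lambda>c c'.
       tensor_lift TT (\<lambda>d d'. pure_tensor k T T (pure_tensor k C D c d) (pure_tensor k C D c' d')) t) s)"

definition tensor_coalgebra ::
  "('c, 'r) ring_scheme \<Rightarrow> ('c, 'a, 'm) coalgebra_scheme \<Rightarrow> ('c, 'b, 'n) coalgebra_scheme \<Rightarrow>
   ('c, ('a \<times> 'b) list set) coalgebra"
  where "tensor_coalgebra k C D = module.extend (tensor k C D)
    \<lparr>comult = tensor_lift (tensor k (tensor k C D) (tensor k C D))
       (\<lambda>c d. tensor_interchange k C D (comult C c) (comult D d)),
     counit = tensor_lift (base_module k) (\<lambda>c d. counit C c \<otimes>\<^bsub>k\<^esub> counit D d)\<rparr>"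


section \<open>Hopf categories\<close>

text \<open>\<open>\<mu> x y z\<close> is the multiplication \<open>A x y \<otimes> A y z \<rightarrow> A x z\<close> and \<open>\<eta> x\<close> the unit map
  \<open>k \<rightarrow> A x x\<close>, so that \<open>\<eta> x 1\<close> is the unit element of \<open>A x x\<close>.\<close>

definition hopf_mult ::
  "('c, 'r) ring_scheme \<Rightarrow> ('x \<Rightarrow> 'x \<Rightarrow> ('c, 'a) coalgebra) \<Rightarrow>
   ('x \<Rightarrow> 'x \<Rightarrow> 'x \<Rightarrow> ('a \<times> 'a) list set \<Rightarrow> 'a) \<Rightarrow> 'x \<Rightarrow> 'x \<Rightarrow> 'x \<Rightarrow> 'a \<Rightarrow> 'a \<Rightarrow> 'a"
  where "hopf_mult k A \<mu> x y z h l = \<mu> x y z (pure_tensor k (A x y) (A y z) h l)"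

locale hopf_category = cring k
  for k :: "('c, 'r) ring_scheme" (structure)
    and X :: "'x set"
    and A :: "'x \<Rightarrow> 'x \<Rightarrow> ('c, 'a) coalgebra"
    and \<mu> :: "'x \<Rightarrow> 'x \<Rightarrow> 'x \<Rightarrow> ('a \<times> 'a) list set \<Rightarrow> 'a"
    and \<eta> :: "'x \<Rightarrow> 'c \<Rightarrow> 'a"
    and S :: "'x \<Rightarrow> 'x \<Rightarrow> 'a \<Rightarrow> 'a" +
  assumes hom_coalgebra: "x \<in> X \<Longrightarrow> y \<in> X \<Longrightarrow> coalgebra k (A x y)"
    and hom_finitely_generated: "x \<in> X \<Longrightarrow> y \<in> X \<Longrightarrow> finitely_generated k (A x y)"
    and hom_projective: "x \<in> X \<Longrightarrow> y \<in> X \<Longrightarrow> projective k (A x y)"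
    and mult_coalgebra_map: "x \<in> X \<Longrightarrow> y \<in> X \<Longrightarrow> z \<in> X \<Longrightarrow>
      \<mu> x y z \<in> coalgebra_maps k (tensor_coalgebra k (A x y) (A y z)) (A x z)"
    and unit_coalgebra_map: "x \<in> X \<Longrightarrow> \<eta> x \<in> coalgebra_maps k (base_coalgebra k) (A x x)"
    and mult_assoc: "x \<in> X \<Longrightarrow> y \<in> X \<Longrightarrow> z \<in> X \<Longrightarrow> w \<in> X \<Longrightarrow>
      h \<in> carrier (A x y) \<Longrightarrow> l \<in> carrier (A y z) \<Longrightarrow> m \<in> carrier (A z w) \<Longrightarrow>
      hopf_mult k A \<mu> x z w (hopf_mult k A \<mu> x y z h l) m
      = hopf_mult k A \<mu> x y w h (hopf_mult k A \<mu> y z w l m)"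
    and mult_unit_left: "x \<in> X \<Longrightarrow> y \<in> X \<Longrightarrow> h \<in> carrier (A x y) \<Longrightarrow>
      hopf_mult k A \<mu> x x y (\<eta> x \<one>) h = h"
    and mult_unit_right: "x \<in> X \<Longrightarrow> y \<in> X \<Longrightarrow> h \<in> carrier (A x y) \<Longrightarrow>
      hopf_mult k A \<mu> x y y h (\<eta> y \<one>) = h"
    and antipode_linear: "x \<in> X \<Longrightarrow> y \<in> X \<Longrightarrow> S x y \<in> linear_maps k (A x y) (A y x)"
    and antipode_right: "x \<in> X \<Longrightarrow> y \<in> X \<Longrightarrow> h \<in> carrier (A x y) \<Longrightarrow>
      tensor_lift (A x x) (\<lambda>a b. hopf_mult k A \<mu> x y x a (S x y b)) (comult (A x y) h)
      = counit (A x y) h \<odot>\<^bsub>A x x\<^esub> \<eta> x \<one>"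
    and antipode_left: "x \<in> X \<Longrightarrow> y \<in> X \<Longrightarrow> h \<in> carrier (A x y) \<Longrightarrow>
      tensor_lift (A y y) (\<lambda>a b. hopf_mult k A \<mu> y x y (S x y a) b) (comult (A x y) h)
      = counit (A x y) h \<odot>\<^bsub>A y y\<^esub> \<eta> y \<one>"

end

theory Submission
  imports Defs
begin

text \<open>Write \<open>T\<close> for the composite of the two antipodes between \<open>A x y\<close> and \<open>A y x\<close>.  If an antipode
  with values in \<open>M = A x y\<close> is not surjective, its image lies in a maximal submodule \<open>K\<close> of the finitely
  generated module \<open>M\<close>, and the scalars \<open>I\<close> with \<open>I M \<subseteq> K\<close> form a maximal ideal.  Fitting's lemma over
  the residue field gives \<open>n > 0\<close> and an operator \<open>q\<close> commuting with \<open>T\<close> such that \<open>p = T\<^sup>n q\<close> satisfies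
  \<open>T\<^sup>n p = T\<^sup>n\<close> modulo \<open>I\<close>.  As \<open>T\<close> is a coalgebra map, so is \<open>p\<close> modulo \<open>I\<close>.  Consecutive powers of the
  antipode are inverse to each other for convolution, and precomposition with a coalgebra map respects
  convolution; uniqueness of inverses therefore reduces \<open>T\<^sup>n p = T\<^sup>n\<close> step by step to \<open>p = 1\<close>.  Hence
  \<open>M = T M + I M \<subseteq> K\<close>, a contradiction.  So all antipodes are surjective, and \<open>T\<close>, a surjective
  endomorphism of a finitely generated module, is injective.\<close>

section \<open>Linear and bilinear maps\<close>

text \<open>For \<open>x \<noteq> y\<close> the module \<open>A x y\<close> is only a coalgebra and
  its antipode leads out of it, so no single Hopf algebra carries the argument. The composite
  \<open>T\<close> returns to \<open>A x y\<close>, and the two reversals of the comultiplication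
  cancel in it. Over a field the powers of \<open>T\<close> would stabilise by dimension; over
  \<open>k\<close> they need not, and the maximal submodule serves to produce a residue field. The
  reduction is never formed, however: congruences between elements of \<open>M\<close> replace
  quotient modules, quotient coalgebras and their tensor products, so \<open>p\<close> remains a
  linear endomorphism of \<open>M\<close> that respects the coalgebra structure only up to
  \<open>I\<close>. Modulo \<open>I\<close> it is the projection onto the stable image of
  \<open>T\<close>: with \<open>E = T\<^sup>n\<close>, both \<open>E p\<close> and
  \<open>p E\<close> agree with \<open>E\<close>, and this transfers the compatibility of
  \<open>E\<close> with counit and comultiplication to \<open>p\<close>. The descent rests on the
  fact that if \<open>g\<close> is the convolution inverse of \<open>f\<close> and
  \<open>g p = g\<close>, then \<open>f p\<close> and \<open>f\<close> share the inverse
  \<open>g\<close>.\<close>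

lemma linear_mapsI:
  assumes "\<And>u. u \<in> carrier M \<Longrightarrow> f u \<in> carrier N"
    and "\<And>u v. u \<in> carrier M \<Longrightarrow> v \<in> carrier M \<Longrightarrow> f (u \<oplus>\<^bsub>M\<^esub> v) = f u \<oplus>\<^bsub>N\<^esub> f v"
    and "\<And>r u. r \<in> carrier k \<Longrightarrow> u \<in> carrier M \<Longrightarrow> f (r \<odot>\<^bsub>M\<^esub> u) = r \<odot>\<^bsub>N\<^esub> f u"
  shows "f \<in> linear_maps k M N"
  using assms by (auto simp: linear_maps_def)

lemma linear_mapsD:
  assumes "f \<in> linear_maps k M N"
  shows "u \<in> carrier M \<Longrightarrow> f u \<in> carrier N"
    and "u \<in> carrier M \<Longrightarrow> v \<in> carrier M \<Longrightarrow> f (u \<oplus>\<^bsub>M\<^esub> v) = f u \<oplus>\<^bsub>N\<^esub> f v"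
    and "r \<in> carrier k \<Longrightarrow> u \<in> carrier M \<Longrightarrow> f (r \<odot>\<^bsub>M\<^esub> u) = r \<odot>\<^bsub>N\<^esub> f u"
  using assms by (auto simp: linear_maps_def)

lemma linear_maps_zero:
  assumes "module k M" "module k N" "f \<in> linear_maps k M N"
  shows "f \<zero>\<^bsub>M\<^esub> = \<zero>\<^bsub>N\<^esub>"
proof -
  interpret M: module k M by fact
  interpret N: module k N by fact
  have "f \<zero>\<^bsub>M\<^esub> = f (\<zero>\<^bsub>k\<^esub> \<odot>\<^bsub>M\<^esub> \<zero>\<^bsub>M\<^esub>)" by simp
  also have "\<dots> = \<zero>\<^bsub>N\<^esub>"
    by (simp add: linear_mapsD[OF assms(3)] del: M.smult_l_null M.smult_r_null)
  finally show ?thesis .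
qed

lemma linear_maps_id: "(\<lambda>u. u) \<in> linear_maps k M M"
  by (simp add: linear_maps_def)

lemma linear_maps_const_zero:
  assumes "module k N"
  shows "(\<lambda>u. \<zero>\<^bsub>N\<^esub>) \<in> linear_maps k M N"
proof -
  interpret N: module k N by fact
  show ?thesis by (auto simp: linear_maps_def)
qed

lemma linear_maps_comp:
  assumes "g \<in> linear_maps k N P" "f \<in> linear_maps k M N"
  shows "(\<lambda>u. g (f u)) \<in> linear_maps k M P"
  using assms by (auto simp: linear_maps_def Pi_iff)

lemma linear_maps_add:
  assumes "module k N" "f \<in> linear_maps k M N" "g \<in> linear_maps k M N"
  shows "(\<lambda>u. f u \<oplus>\<^bsub>N\<^esub> g u) \<in> linear_maps k M N"
proof -
  interpret N: module k N by fact
  show ?thesis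
    by (rule linear_mapsI)
      (simp_all add: linear_mapsD[OF assms(2)] linear_mapsD[OF assms(3)] N.smult_r_distr
        N.a_assoc N.a_comm N.M.a_lcomm)
qed

lemma linear_maps_smult:
  assumes "module k N" "r \<in> carrier k" "f \<in> linear_maps k M N"
  shows "(\<lambda>u. r \<odot>\<^bsub>N\<^esub> f u) \<in> linear_maps k M N"
proof -
  interpret N: module k N by fact
  have "r \<odot>\<^bsub>N\<^esub> (s \<odot>\<^bsub>N\<^esub> u) = s \<odot>\<^bsub>N\<^esub> (r \<odot>\<^bsub>N\<^esub> u)" if "s \<in> carrier k" "u \<in> carrier N" for s u
    using assms(2) that by (metis N.R.m_comm N.smult_assoc1)
  then show ?thesis
    using assms(2) by (intro linear_mapsI)
      (simp_all add: linear_mapsD[OF assms(3)] N.smult_r_distr)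
qed

lemma linear_maps_cong:
  assumes "module k M" "\<And>u. u \<in> carrier M \<Longrightarrow> f u = g u"
  shows "f \<in> linear_maps k M N \<longleftrightarrow> g \<in> linear_maps k M N"
proof -
  interpret M: module k M by fact
  show ?thesis using assms(2) by (auto simp: linear_maps_def Pi_iff)
qed

lemma base_module_simps [simp]:
  "carrier (base_module k) = carrier k" "\<zero>\<^bsub>base_module k\<^esub> = \<zero>\<^bsub>k\<^esub>"
  "u \<oplus>\<^bsub>base_module k\<^esub> v = u \<oplus>\<^bsub>k\<^esub> v" "u \<odot>\<^bsub>base_module k\<^esub> v = u \<otimes>\<^bsub>k\<^esub> v"
  by (simp_all add: base_module_def)

lemma base_module_module:
  assumes "cring k"
  shows "module k (base_module k)"
proof -
  interpret cring k by fact
  have "abelian_group (base_module k)"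
  proof (rule abelian_groupI)
    show "\<exists>v\<in>carrier (base_module k). v \<oplus>\<^bsub>base_module k\<^esub> u = \<zero>\<^bsub>base_module k\<^esub>"
      if "u \<in> carrier (base_module k)" for u
      using that l_neg by (intro bexI[of _ "\<ominus>\<^bsub>k\<^esub> u"]) simp_all
  qed (simp_all add: a_assoc a_comm a_lcomm)
  then show ?thesis
    by (intro moduleI assms) (simp_all add: l_distr r_distr m_assoc)
qed

lemma bilinear_mapsI:
  assumes "\<And>m. m \<in> carrier M \<Longrightarrow> b m \<in> linear_maps k N P"
    and "\<And>n. n \<in> carrier N \<Longrightarrow> (\<lambda>m. b m n) \<in> linear_maps k M P"
  shows "b \<in> bilinear_maps k M N P"
  using assms by (simp add: bilinear_maps_def)

lemma bilinear_maps_linear: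
  assumes "b \<in> bilinear_maps k M N P"
  shows "m \<in> carrier M \<Longrightarrow> b m \<in> linear_maps k N P"
    and "n \<in> carrier N \<Longrightarrow> (\<lambda>m. b m n) \<in> linear_maps k M P"
  using assms by (simp_all add: bilinear_maps_def)

lemma bilinear_maps_comp:
  assumes "b \<in> bilinear_maps k M N P" "f \<in> linear_maps k M' M" "g \<in> linear_maps k N' N"
  shows "(\<lambda>m n. b (f m) (g n)) \<in> bilinear_maps k M' N' P"
proof (rule bilinear_mapsI)
  show "(\<lambda>n. b (f m) (g n)) \<in> linear_maps k N' P" if "m \<in> carrier M'" for m
    using linear_maps_comp[OF bilinear_maps_linear(1)[OF assms(1) linear_mapsD(1)[OF assms(2) that]]
        assms(3)] .
  show "(\<lambda>m. b (f m) (g n)) \<in> linear_maps k M' P" if "n \<in> carrier N'" for n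
    using linear_maps_comp[OF bilinear_maps_linear(2)[OF assms(1) linear_mapsD(1)[OF assms(3) that]]
        assms(2)] .
qed

lemma bilinear_maps_post:
  assumes "F \<in> linear_maps k P P'" "b \<in> bilinear_maps k M N P"
  shows "(\<lambda>m n. F (b m n)) \<in> bilinear_maps k M N P'"
  by (rule bilinear_mapsI; rule linear_maps_comp[OF assms(1)])
    (simp_all add: bilinear_maps_linear[OF assms(2)])

lemma bilinear_maps_swap:
  "b \<in> bilinear_maps k M N P \<Longrightarrow> (\<lambda>n m. b m n) \<in> bilinear_maps k N M P"
  by (simp add: bilinear_maps_def)

lemma smult_bilinear:
  assumes "module k M"
  shows "(\<lambda>r m. r \<odot>\<^bsub>M\<^esub> m) \<in> bilinear_maps k (base_module k) M M"
proof -
  interpret M: module k M by fact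
  have "r \<odot>\<^bsub>M\<^esub> (s \<odot>\<^bsub>M\<^esub> u) = s \<odot>\<^bsub>M\<^esub> (r \<odot>\<^bsub>M\<^esub> u)"
    if "r \<in> carrier k" "s \<in> carrier k" "u \<in> carrier M" for r s u
    using that by (metis M.R.m_comm M.smult_assoc1)
  then show ?thesis
    by (intro bilinear_mapsI linear_mapsI) (auto simp: M.smult_l_distr M.smult_r_distr M.smult_assoc1)
qed


section \<open>Maps out of a tensor product\<close>

lemma pure_tensor_closed:
  "m \<in> carrier M \<Longrightarrow> n \<in> carrier N \<Longrightarrow> pure_tensor k M N m n \<in> carrier (tensor k M N)"
  unfolding pure_tensor_def tensor_def by auto

text \<open>Elements are classes of lists, and prefixing a pair adds a pure tensor to the class, so
  list induction becomes induction over sums of pure tensors.\<close>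

lemma tensor_induct [consumes 3, case_names zero add]:
  assumes "module k M" "module k N" "t \<in> carrier (tensor k M N)"
    and "P \<zero>\<^bsub>tensor k M N\<^esub>"
    and "\<And>m n t. m \<in> carrier M \<Longrightarrow> n \<in> carrier N \<Longrightarrow> t \<in> carrier (tensor k M N) \<Longrightarrow> P t \<Longrightarrow>
      P (pure_tensor k M N m n \<oplus>\<^bsub>tensor k M N\<^esub> t)"
  shows "P t"
proof -
  have "P (tensor_class k M N u)" if "set u \<subseteq> carrier M \<times> carrier N" for u
    using that
  proof (induction u)
    case Nil
    then show ?case using assms(4) by (simp add: tensor_def)
  next
    case (Cons x u)
    obtain m n where x: "x = (m, n)" by fastforce
    have "P (pure_tensor k M N m n \<oplus>\<^bsub>tensor k M N\<^esub> tensor_class k M N u)"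
      using Cons x by (intro assms(5)) (auto simp: tensor_def)
    moreover have "pure_tensor k M N m n \<oplus>\<^bsub>tensor k M N\<^esub> tensor_class k M N u
        = tensor_class k M N ([(m, n)] @ u)"
      unfolding pure_tensor_def using Cons x by (intro tensor_add_class) auto
    ultimately show ?case using x by simp
  qed
  then show ?thesis using assms(3) by (auto simp: tensor_def)
qed

text \<open>The uniqueness half of the universal property, by which identities between linear maps
  on a tensor product are reduced to pure tensors.\<close>

lemma linear_maps_tensor_ext:
  assumes "module k M" "module k N" "module k P" "t \<in> carrier (tensor k M N)"
    and f: "f \<in> linear_maps k (tensor k M N) P" and g: "g \<in> linear_maps k (tensor k M N) P"
    and "\<And>m n. m \<in> carrier M \<Longrightarrow> n \<in> carrier N \<Longrightarrow>
      f (pure_tensor k M N m n) = g (pure_tensor k M N m n)"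
  shows "f t = g t"
  using assms(1,2,4)
proof (induction rule: tensor_induct)
  case zero
  show ?case
    by (simp add: linear_maps_zero[OF tensor_module[OF assms(1,2)] assms(3) f]
        linear_maps_zero[OF tensor_module[OF assms(1,2)] assms(3) g])
next
  case (add m n t)
  then show ?case
    by (simp add: linear_mapsD(2)[OF f] linear_mapsD(2)[OF g] pure_tensor_closed assms(7))
qed

lemma tensor_lift_comp:
  assumes "module k M" "module k N" "module k P" "module k P'"
    and "F \<in> linear_maps k P P'" "b \<in> bilinear_maps k M N P" "t \<in> carrier (tensor k M N)"
  shows "F (tensor_lift P b t) = tensor_lift P' (\<lambda>m n. F (b m n)) t"
  using assms(1,2,4,7)
proof (rule linear_maps_tensor_ext[where f = "\<lambda>t. F (tensor_lift P b t)"])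
  note b' = bilinear_maps_post[OF assms(5,6)]
  show "(\<lambda>t. F (tensor_lift P b t)) \<in> linear_maps k (tensor k M N) P'"
    using assms by (intro linear_maps_comp[OF assms(5)] tensor_lift_linear)
  show "tensor_lift P' (\<lambda>m n. F (b m n)) \<in> linear_maps k (tensor k M N) P'"
    using assms b' by (intro tensor_lift_linear)
  show "F (tensor_lift P b (pure_tensor k M N m n))
      = tensor_lift P' (\<lambda>m n. F (b m n)) (pure_tensor k M N m n)"
    if "m \<in> carrier M" "n \<in> carrier N" for m n
    using that by (simp add: tensor_lift_pure[OF assms(1-3,6)] tensor_lift_pure[OF assms(1,2,4) b'])
qed

text \<open>Here the tensor \<open>t\<close> is fixed and the bilinear map varies with the parameter
  \<open>l\<close>. This yields linearity of nested lifts in their outer variables without forming a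
  module of bilinear maps.\<close>

lemma linear_maps_tensor_lift:
  assumes "module k M" "module k N" "module k P" "module k L" "t \<in> carrier (tensor k M N)"
    and b: "\<And>l. l \<in> carrier L \<Longrightarrow> b l \<in> bilinear_maps k M N P"
    and lin: "\<And>m n. m \<in> carrier M \<Longrightarrow> n \<in> carrier N \<Longrightarrow> (\<lambda>l. b l m n) \<in> linear_maps k L P"
  shows "(\<lambda>l. tensor_lift P (b l) t) \<in> linear_maps k L P"
  using assms(1,2,5)
proof (induction rule: tensor_induct)
  case zero
  have "tensor_lift P (b l) \<zero>\<^bsub>tensor k M N\<^esub> = \<zero>\<^bsub>P\<^esub>" if "l \<in> carrier L" for l
    using that assms
    by (intro linear_maps_zero[OF tensor_module[OF assms(1,2)] assms(3)] tensor_lift_linear)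
  then show ?case
    by (rule iffD2[OF linear_maps_cong[OF assms(4)] linear_maps_const_zero[OF assms(3)]])
next
  case (add m n t)
  have "tensor_lift P (b l) (pure_tensor k M N m n \<oplus>\<^bsub>tensor k M N\<^esub> t)
      = b l m n \<oplus>\<^bsub>P\<^esub> tensor_lift P (b l) t" if "l \<in> carrier L" for l
    using linear_mapsD(2)[OF tensor_lift_linear[OF assms(1-3) b[OF that]] pure_tensor_closed add(3)]
      add(1,2) tensor_lift_pure[OF assms(1-3) b[OF that]] by simp
  then show ?case
    by (rule iffD2[OF linear_maps_cong[OF assms(4)]
          linear_maps_add[OF assms(3) lin[OF add(1,2)] add(4)]])
qed

lemma tensor_map_bilinear:
  assumes "module k P" "module k Q" "f \<in> linear_maps k M P" "g \<in> linear_maps k N Q"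
  shows "(\<lambda>m n. pure_tensor k P Q (f m) (g n)) \<in> bilinear_maps k M N (tensor k P Q)"
  using bilinear_maps_comp[OF pure_tensor_bilinear[OF assms(1,2)] assms(3,4)] .

lemma tensor_lift_tensor_map:
  assumes "module k M" "module k N" "module k P" "module k Q" "module k R"
    and "f \<in> linear_maps k M P" "g \<in> linear_maps k N Q" "b \<in> bilinear_maps k P Q R"
    and "t \<in> carrier (tensor k M N)"
  shows "tensor_lift R b (tensor_map k P Q f g t) = tensor_lift R (\<lambda>m n. b (f m) (g n)) t"
proof -
  have T: "module k (tensor k P Q)"
    using tensor_module[OF assms(3,4)] .
  have L: "tensor_lift R b \<in> linear_maps k (tensor k P Q) R"
    using tensor_lift_linear[OF assms(3,4,5,8)] .
  have M: "(\<lambda>m n. pure_tensor k P Q (f m) (g n)) \<in> bilinear_maps k M N (tensor k P Q)"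
    using tensor_map_bilinear[OF assms(3,4,6,7)] .
  have "tensor_lift R b (tensor_map k P Q f g t)
      = tensor_lift R (\<lambda>m n. tensor_lift R b (pure_tensor k P Q (f m) (g n))) t"
    unfolding tensor_map_def using tensor_lift_comp[OF assms(1,2) T assms(5) L M assms(9)] .
  also have "\<dots> = tensor_lift R (\<lambda>m n. b (f m) (g n)) t"
  proof (rule linear_maps_tensor_ext[OF assms(1,2,5,9)])
    note b1 = bilinear_maps_post[OF L M] and b2 = bilinear_maps_comp[OF assms(8,6,7)]
    show "tensor_lift R (\<lambda>m n. tensor_lift R b (pure_tensor k P Q (f m) (g n)))
        \<in> linear_maps k (tensor k M N) R"
      using tensor_lift_linear[OF assms(1,2,5) b1] .
    show "tensor_lift R (\<lambda>m n. b (f m) (g n)) \<in> linear_maps k (tensor k M N) R"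
      using tensor_lift_linear[OF assms(1,2,5) b2] .
    fix m n assume mn: "m \<in> carrier M" "n \<in> carrier N"
    then have "f m \<in> carrier P" "g n \<in> carrier Q"
      using assms(6,7) by (simp_all add: linear_mapsD(1))
    then show "tensor_lift R (\<lambda>m n. tensor_lift R b (pure_tensor k P Q (f m) (g n))) (pure_tensor k M N m n)
        = tensor_lift R (\<lambda>m n. b (f m) (g n)) (pure_tensor k M N m n)"
      by (simp add: tensor_lift_pure[OF assms(1,2,5) b1 mn] tensor_lift_pure[OF assms(1,2,5) b2 mn]
          tensor_lift_pure[OF assms(3,4,5,8)])
  qed
  finally show ?thesis .
qed

text \<open>A lift evaluates its map on the entries of one representative, and every representative
  of a class has its entries in the carriers. This is the rule for rewriting under a Sweedler
  sum.\<close>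

lemma tensor_lift_cong:
  assumes "module k M" "module k N" "t \<in> carrier (tensor k M N)"
    and "\<And>m n. m \<in> carrier M \<Longrightarrow> n \<in> carrier N \<Longrightarrow> b m n = b' m n"
  shows "tensor_lift P b t = tensor_lift P b' t"
proof -
  obtain u where t: "t = tensor_class k M N u" "set u \<subseteq> carrier M \<times> carrier N"
    using assms(3) by (auto simp: tensor_def)
  have "(SOME v. v \<in> t) \<in> t"
    unfolding t(1) using tensor_class_self[OF t(2)] by (rule someI)
  then have "set (SOME v. v \<in> t) \<subseteq> carrier M \<times> carrier N"
    using tensor_rel_carrier[OF assms(1,2)] by (auto simp: t tensor_class_def)
  moreover have "formal_sum P b v = formal_sum P b' v" if "set v \<subseteq> carrier M \<times> carrier N" for v
    using that by (induction v) (auto simp: assms(4))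
  ultimately show ?thesis by (simp add: tensor_lift_def)
qed


section \<open>Congruence modulo a set of scalars\<close>

text \<open>The submodule \<open>I M\<close> for an arbitrary set \<open>I\<close> of scalars. For
  \<open>I = {}\<close> it is zero and congruence becomes equality, so that one uniqueness lemma for
  convolution inverses covers exact identities and congruences alike.\<close>

inductive_set ideal_mult :: "'c set \<Rightarrow> ('c, 'a, 'm) module_scheme \<Rightarrow> 'a set" for I M
  where
    zero: "\<zero>\<^bsub>M\<^esub> \<in> ideal_mult I M"
  | step: "r \<in> I \<Longrightarrow> a \<in> carrier M \<Longrightarrow> b \<in> ideal_mult I M \<Longrightarrow> (r \<odot>\<^bsub>M\<^esub> a) \<oplus>\<^bsub>M\<^esub> b \<in> ideal_mult I M"

text \<open>Stands in for equality in \<open>M / I M\<close>. Membership in the carrier is included,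
  so that a congruence also supplies the typing facts that linear maps ask for.\<close>

definition mcong :: "'c set \<Rightarrow> ('c, 'a, 'm) module_scheme \<Rightarrow> 'a \<Rightarrow> 'a \<Rightarrow> bool"
  where "mcong I M a b \<longleftrightarrow> a \<in> carrier M \<and> b \<in> carrier M \<and> (\<exists>c\<in>ideal_mult I M. a = b \<oplus>\<^bsub>M\<^esub> c)"

section \<open>Arithmetic of congruences\<close>

context module
begin

lemma ideal_mult_closed:
  assumes "I \<subseteq> carrier R" "a \<in> ideal_mult I M"
  shows "a \<in> carrier M"
  using assms(2) by induction (use assms(1) in auto)

lemma ideal_mult_mem:
  assumes "I \<subseteq> carrier R" "r \<in> I" "a \<in> carrier M"
  shows "r \<odot>\<^bsub>M\<^esub> a \<in> ideal_mult I M"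
proof -
  have "r \<odot>\<^bsub>M\<^esub> a \<in> carrier M" using assms by auto
  then show ?thesis
    using ideal_mult.step[OF assms(2,3) ideal_mult.zero] by simp
qed

lemma ideal_mult_add:
  assumes "I \<subseteq> carrier R" "a \<in> ideal_mult I M" "b \<in> ideal_mult I M"
  shows "a \<oplus>\<^bsub>M\<^esub> b \<in> ideal_mult I M"
  using assms(2)
proof induction
  case zero
  then show ?case using assms ideal_mult_closed[OF assms(1,3)] by simp
next
  case (step r a c)
  have "r \<odot>\<^bsub>M\<^esub> a \<oplus>\<^bsub>M\<^esub> c \<oplus>\<^bsub>M\<^esub> b = r \<odot>\<^bsub>M\<^esub> a \<oplus>\<^bsub>M\<^esub> (c \<oplus>\<^bsub>M\<^esub> b)"
    using step assms(1) ideal_mult_closed[OF assms(1,3)] ideal_mult_closed[OF assms(1)]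
    by (intro M.a_assoc) auto
  then show ?case using ideal_mult.step[OF step(1,2,4)] by simp
qed

lemma mcong_empty: "mcong {} M a b \<longleftrightarrow> a \<in> carrier M \<and> a = b"
proof -
  have "c = \<zero>\<^bsub>M\<^esub>" if "c \<in> ideal_mult {} M" for c
    using that by induction auto
  then have "ideal_mult {} M = {\<zero>\<^bsub>M\<^esub>}"
    using ideal_mult.zero by blast
  then show ?thesis by (auto simp: mcong_def)
qed

lemma mcong_refl: "a \<in> carrier M \<Longrightarrow> mcong I M a a"
  by (auto simp: mcong_def intro!: bexI[of _ "\<zero>\<^bsub>M\<^esub>"] ideal_mult.zero)

lemma mcong_add:
  assumes "I \<subseteq> carrier R" "mcong I M a b" "mcong I M a' b'"
  shows "mcong I M (a \<oplus>\<^bsub>M\<^esub> a') (b \<oplus>\<^bsub>M\<^esub> b')"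
proof -
  obtain c c' where c: "c \<in> ideal_mult I M" "a = b \<oplus>\<^bsub>M\<^esub> c" "c' \<in> ideal_mult I M" "a' = b' \<oplus>\<^bsub>M\<^esub> c'"
    using assms by (auto simp: mcong_def)
  have cl: "b \<in> carrier M" "b' \<in> carrier M" "c \<in> carrier M" "c' \<in> carrier M"
    using assms c ideal_mult_closed by (auto simp: mcong_def)
  then have "a \<oplus>\<^bsub>M\<^esub> a' = (b \<oplus>\<^bsub>M\<^esub> b') \<oplus>\<^bsub>M\<^esub> (c \<oplus>\<^bsub>M\<^esub> c')"
    by (simp add: c M.add.m_ac)
  then show ?thesis
    using cl ideal_mult_add[OF assms(1) c(1,3)] by (auto simp: mcong_def c)
qed

lemma mcong_trans:
  assumes "I \<subseteq> carrier R" "mcong I M a b" "mcong I M b c"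
  shows "mcong I M a c"
proof -
  obtain d d' where d: "d \<in> ideal_mult I M" "a = b \<oplus>\<^bsub>M\<^esub> d" "d' \<in> ideal_mult I M" "b = c \<oplus>\<^bsub>M\<^esub> d'"
    using assms by (auto simp: mcong_def)
  have cl: "c \<in> carrier M" "d \<in> carrier M" "d' \<in> carrier M"
    using assms d ideal_mult_closed by (auto simp: mcong_def)
  then have "a = c \<oplus>\<^bsub>M\<^esub> (d' \<oplus>\<^bsub>M\<^esub> d)"
    by (simp add: d M.a_assoc)
  then show ?thesis
    using assms cl ideal_mult_add[OF assms(1) d(3,1)] by (auto simp: mcong_def)
qed

end

lemma linear_maps_ideal_mult:
  assumes "module k M" "module k N" "I \<subseteq> carrier k" "f \<in> linear_maps k M N" "a \<in> ideal_mult I M"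
  shows "f a \<in> ideal_mult I N"
  using assms(5)
proof induction
  case zero
  then show ?case using linear_maps_zero[OF assms(1,2,4)] ideal_mult.zero by metis
next
  case (step r a b)
  interpret M: module k M by fact
  have "r \<in> carrier k" "b \<in> carrier M"
    using step M.ideal_mult_closed[OF assms(3)] assms(3) by auto
  then have "f (r \<odot>\<^bsub>M\<^esub> a \<oplus>\<^bsub>M\<^esub> b) = r \<odot>\<^bsub>N\<^esub> f a \<oplus>\<^bsub>N\<^esub> f b"
    using step by (simp add: linear_mapsD[OF assms(4)])
  then show ?case
    using ideal_mult.step[OF step(1) linear_mapsD(1)[OF assms(4) step(2)] step(4)] by simp
qed

lemma mcong_linear:
  assumes "module k M" "module k N" "I \<subseteq> carrier k" "f \<in> linear_maps k M N" "mcong I M a b"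
  shows "mcong I N (f a) (f b)"
proof -
  interpret M: module k M by fact
  obtain c where c: "c \<in> ideal_mult I M" "a = b \<oplus>\<^bsub>M\<^esub> c" using assms(5) by (auto simp: mcong_def)
  then have "f a = f b \<oplus>\<^bsub>N\<^esub> f c"
    using assms(5) M.ideal_mult_closed[OF assms(3)] linear_mapsD(2)[OF assms(4)]
    by (simp add: mcong_def)
  moreover have "f a \<in> carrier N" "f b \<in> carrier N"
    using assms(5) linear_mapsD(1)[OF assms(4)] by (auto simp: mcong_def)
  ultimately show ?thesis
    using linear_maps_ideal_mult[OF assms(1-4) c(1)] unfolding mcong_def by blast
qed

lemma mcong_sym:
  assumes "module k M" "I \<subseteq> carrier k" "mcong I M a b"
  shows "mcong I M b a"
proof -
  interpret M: module k M by fact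
  obtain c where c: "c \<in> ideal_mult I M" "a = b \<oplus>\<^bsub>M\<^esub> c" using assms(3) by (auto simp: mcong_def)
  have b: "b \<in> carrier M" "c \<in> carrier M"
    using assms(3) c M.ideal_mult_closed[OF assms(2)] by (auto simp: mcong_def)
  \<comment> \<open>Negation is multiplication by \<open>-1\<close>, a linear map, and linear maps
    preserve \<open>I M\<close>; nothing about negatives inside \<open>I\<close> itself
    enters.\<close>
  have "(\<lambda>u. (\<ominus>\<^bsub>k\<^esub> \<one>\<^bsub>k\<^esub>) \<odot>\<^bsub>M\<^esub> u) \<in> linear_maps k M M"
    using linear_maps_smult[OF assms(1) _ linear_maps_id] by simp
  then have "(\<ominus>\<^bsub>k\<^esub> \<one>\<^bsub>k\<^esub>) \<odot>\<^bsub>M\<^esub> c \<in> ideal_mult I M"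
    using linear_maps_ideal_mult[OF assms(1,1,2) _ c(1)] by blast
  then have "\<ominus>\<^bsub>M\<^esub> c \<in> ideal_mult I M"
    using b by (simp add: M.smult_l_minus)
  moreover have "b = a \<oplus>\<^bsub>M\<^esub> \<ominus>\<^bsub>M\<^esub> c"
    using b by (simp add: c M.M.a_assoc M.M.r_neg)
  ultimately show ?thesis
    using assms(3) by (auto simp: mcong_def)
qed

lemma mcong_bilinear:
  assumes "module k M" "module k N" "module k P" "I \<subseteq> carrier k" "b \<in> bilinear_maps k M N P"
    and "mcong I M m m'" "mcong I N n n'"
  shows "mcong I P (b m n) (b m' n')"
proof -
  interpret P: module k P by fact
  have "mcong I P (b m n) (b m' n)"
    using mcong_linear[OF assms(1,3,4) bilinear_maps_linear(2)[OF assms(5)] assms(6)] assms(7)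
    by (simp add: mcong_def)
  moreover have "mcong I P (b m' n) (b m' n')"
    using mcong_linear[OF assms(2,3,4) bilinear_maps_linear(1)[OF assms(5)] assms(7)] assms(6)
    by (simp add: mcong_def)
  ultimately show ?thesis using P.mcong_trans[OF assms(4)] by blast
qed

text \<open>Lets a congruence be inserted under a Sweedler sum. It is tested in the target
  \<open>P\<close>, never in \<open>tensor k M N\<close>.\<close>

lemma mcong_tensor_lift:
  assumes "module k M" "module k N" "module k P" "I \<subseteq> carrier k"
    and b: "b \<in> bilinear_maps k M N P" and b': "b' \<in> bilinear_maps k M N P"
    and "t \<in> carrier (tensor k M N)"
    and "\<And>m n. m \<in> carrier M \<Longrightarrow> n \<in> carrier N \<Longrightarrow> mcong I P (b m n) (b' m n)"
  shows "mcong I P (tensor_lift P b t) (tensor_lift P b' t)"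
  using assms(1,2,7)
proof (induction rule: tensor_induct)
  case zero
  interpret P: module k P by fact
  show ?case
    by (simp add: linear_maps_zero[OF tensor_module[OF assms(1,2)] assms(3)]
        tensor_lift_linear[OF assms(1-3)] b b' P.mcong_refl)
next
  case (add m n t)
  interpret P: module k P by fact
  show ?case
    using add P.mcong_add[OF assms(4) assms(8)[OF add(1,2)] add(4)]
    by (simp add: linear_mapsD(2)[OF tensor_lift_linear[OF assms(1-3) b]]
        linear_mapsD(2)[OF tensor_lift_linear[OF assms(1-3) b']] pure_tensor_closed
        tensor_lift_pure[OF assms(1-3) b] tensor_lift_pure[OF assms(1-3) b'])
qed


section \<open>Sweedler calculus\<close>

text \<open>Curried like the bilinear maps, so that a Sweedler sum with three legs can be evaluated
  by two nested lifts in either bracketing.\<close>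

definition trilinear_maps ::
  "('c, 'r) ring_scheme \<Rightarrow> ('c, 'a, 'l) module_scheme \<Rightarrow> ('c, 'b, 'm) module_scheme \<Rightarrow>
   ('c, 'd, 'n) module_scheme \<Rightarrow> ('c, 'p, 'q) module_scheme \<Rightarrow> ('a \<Rightarrow> 'b \<Rightarrow> 'd \<Rightarrow> 'p) set"
  where "trilinear_maps k L M N P = {t. (\<forall>l\<in>carrier L. t l \<in> bilinear_maps k M N P) \<and>
    (\<forall>m\<in>carrier M. \<forall>n\<in>carrier N. (\<lambda>l. t l m n) \<in> linear_maps k L P)}"

lemma trilinear_mapsD:
  assumes "t \<in> trilinear_maps k L M N P"
  shows "l \<in> carrier L \<Longrightarrow> t l \<in> bilinear_maps k M N P"
    and "n \<in> carrier N \<Longrightarrow> (\<lambda>l m. t l m n) \<in> bilinear_maps k L M P"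
    and "m \<in> carrier M \<Longrightarrow> (\<lambda>l n. t l m n) \<in> bilinear_maps k L N P"
    and "l \<in> carrier L \<Longrightarrow> m \<in> carrier M \<Longrightarrow> t l m \<in> linear_maps k N P"
    and "l \<in> carrier L \<Longrightarrow> n \<in> carrier N \<Longrightarrow> (\<lambda>m. t l m n) \<in> linear_maps k M P"
    and "m \<in> carrier M \<Longrightarrow> n \<in> carrier N \<Longrightarrow> (\<lambda>l. t l m n) \<in> linear_maps k L P"
  using assms unfolding trilinear_maps_def bilinear_maps_def by blast+

lemma trilinear_mapsI:
  assumes "\<And>l m. l \<in> carrier L \<Longrightarrow> m \<in> carrier M \<Longrightarrow> t l m \<in> linear_maps k N P"
    and "\<And>l n. l \<in> carrier L \<Longrightarrow> n \<in> carrier N \<Longrightarrow> (\<lambda>m. t l m n) \<in> linear_maps k M P"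
    and "\<And>m n. m \<in> carrier M \<Longrightarrow> n \<in> carrier N \<Longrightarrow> (\<lambda>l. t l m n) \<in> linear_maps k L P"
  shows "t \<in> trilinear_maps k L M N P"
  using assms unfolding trilinear_maps_def bilinear_maps_def by blast

lemma trilinear_lift_right:
  assumes "module k L" "module k M" "module k N" "module k P" "t \<in> trilinear_maps k L M N P"
  shows "(\<lambda>l s. tensor_lift P (t l) s) \<in> bilinear_maps k L (tensor k M N) P"
  using assms(1-4) trilinear_mapsD[OF assms(5)]
  by (intro bilinear_mapsI tensor_lift_linear linear_maps_tensor_lift)

lemma trilinear_lift_left:
  assumes "module k L" "module k M" "module k N" "module k P" "t \<in> trilinear_maps k L M N P"
  shows "(\<lambda>s n. tensor_lift P (\<lambda>l m. t l m n) s) \<in> bilinear_maps k (tensor k L M) N P"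
  using assms(1-4) trilinear_mapsD[OF assms(5)]
  by (intro bilinear_mapsI tensor_lift_linear[where b = "\<lambda>l m. t l m _"] linear_maps_tensor_lift)

section \<open>Sweedler sums over one coalgebra\<close>

context coalgebra
begin

lemma comult_closed: "h \<in> carrier C \<Longrightarrow> comult C h \<in> carrier (tensor k C C)"
  using linear_mapsD(1)[OF comult_linear] .

lemma counit_closed: "h \<in> carrier C \<Longrightarrow> counit C h \<in> carrier k"
  using linear_mapsD(1)[OF counit_linear] by simp

lemma sweedler_linear:
  assumes "module k P" "b \<in> bilinear_maps k C C P"
  shows "(\<lambda>h. tensor_lift P b (comult C h)) \<in> linear_maps k C P"
  using linear_maps_comp[OF tensor_lift_linear[OF module_axioms module_axioms assms] comult_linear] .

lemma sweedler_cong: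
  assumes "h \<in> carrier C" "\<And>u v. u \<in> carrier C \<Longrightarrow> v \<in> carrier C \<Longrightarrow> b u v = b' u v"
  shows "tensor_lift P b (comult C h) = tensor_lift P b' (comult C h)"
  using tensor_lift_cong[OF module_axioms module_axioms comult_closed[OF assms(1)] assms(2)] .

lemma sweedler_comp:
  assumes "module k P" "module k P'" "F \<in> linear_maps k P P'" "b \<in> bilinear_maps k C C P"
    "h \<in> carrier C"
  shows "F (tensor_lift P b (comult C h)) = tensor_lift P' (\<lambda>u v. F (b u v)) (comult C h)"
  using tensor_lift_comp[OF module_axioms module_axioms assms(1-4) comult_closed[OF assms(5)]] .

lemma sweedler_mcong:
  assumes "module k P" "I \<subseteq> carrier k" "b \<in> bilinear_maps k C C P" "b' \<in> bilinear_maps k C C P"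
    and "h \<in> carrier C"
    and "\<And>u v. u \<in> carrier C \<Longrightarrow> v \<in> carrier C \<Longrightarrow> mcong I P (b u v) (b' u v)"
  shows "mcong I P (tensor_lift P b (comult C h)) (tensor_lift P b' (comult C h))"
  using mcong_tensor_lift[OF module_axioms module_axioms assms(1-4) comult_closed[OF assms(5)]
      assms(6)] .

text \<open>A trilinear \<open>t\<close> induces a linear map \<open>F\<close> on
  \<open>C \<otimes> (C \<otimes> C)\<close>; applying \<open>F\<close> to both sides of the
  coassociativity axiom and unfolding the lifts gives the usual freedom to rebracket the
  legs.\<close>

lemma sweedler_coassoc:
  assumes P: "module k P" and t: "t \<in> trilinear_maps k C C C P" and h: "h \<in> carrier C"
  shows "tensor_lift P (\<lambda>u v. tensor_lift P (\<lambda>a b. t a b v) (comult C u)) (comult C h)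
    = tensor_lift P (\<lambda>u v. tensor_lift P (t u) (comult C v)) (comult C h)"
proof -
  let ?T = "tensor k C C" and ?TT = "tensor k C (tensor k C C)"
  note C = module_axioms
  note T = tensor_module[OF C C]
  note TT = tensor_module[OF C T]
  define G where "G = (\<lambda>l s. tensor_lift P (t l) s)"
  have G: "G \<in> bilinear_maps k C ?T P"
    unfolding G_def using trilinear_lift_right[OF C C C P t] .
  define F where "F = tensor_lift P G"
  have F: "F \<in> linear_maps k ?TT P"
    unfolding F_def using tensor_lift_linear[OF C T P G] .
  have id: "id \<in> linear_maps k C C" by (simp add: linear_maps_def)
  let ?p = "\<lambda>l m n. pure_tensor k C ?T l (pure_tensor k C C m n)"
  have p: "?p \<in> trilinear_maps k C C C ?TT"
  proof (rule trilinear_mapsI)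
    note p1 = bilinear_maps_linear[OF pure_tensor_bilinear[OF C C]]
      and p2 = bilinear_maps_linear[OF pure_tensor_bilinear[OF C T]]
    show "?p l m \<in> linear_maps k C ?TT" if "l \<in> carrier C" "m \<in> carrier C" for l m
      using linear_maps_comp[OF p2(1)[OF that(1)] p1(1)[OF that(2)]] .
    show "(\<lambda>m. ?p l m n) \<in> linear_maps k C ?TT" if "l \<in> carrier C" "n \<in> carrier C" for l n
      using linear_maps_comp[OF p2(1)[OF that(1)] p1(2)[OF that(2)]] .
    show "(\<lambda>l. ?p l m n) \<in> linear_maps k C ?TT" if "m \<in> carrier C" "n \<in> carrier C" for m n
      using p2(2)[OF pure_tensor_closed[OF that]] .
  qed
  \<comment> \<open>\<open>B\<close> is the reassociation as a function of two arguments; its lift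
    over the outer tensor is \<open>tensor_assoc\<close>.\<close>
  define B where "B = (\<lambda>s n. tensor_lift ?TT (\<lambda>l m. ?p l m n) s)"
  have B: "B \<in> bilinear_maps k ?T C ?TT"
    unfolding B_def using trilinear_lift_left[OF C C C TT p] .
  have FB: "F (B s v) = tensor_lift P (\<lambda>a b. t a b v) s" if "s \<in> carrier ?T" "v \<in> carrier C" for s v
  proof -
    have "F (B s v) = tensor_lift P (\<lambda>l m. F (?p l m v)) s"
      unfolding B_def by (rule tensor_lift_comp[OF C C TT P F trilinear_mapsD(2)[OF p that(2)] that(1)])
    also have "\<dots> = tensor_lift P (\<lambda>a b. t a b v) s"
    proof (rule tensor_lift_cong[OF C C that(1)])
      fix l m assume "l \<in> carrier C" "m \<in> carrier C"
      then show "F (?p l m v) = t l m v"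
        using that by (simp add: F_def G_def tensor_lift_pure[OF C T P G[unfolded G_def]]
            tensor_lift_pure[OF C C P trilinear_mapsD(1)[OF t]] pure_tensor_closed)
    qed
    finally show ?thesis .
  qed
  have "tensor_lift P (\<lambda>u v. tensor_lift P (\<lambda>a b. t a b v) (comult C u)) (comult C h)
      = tensor_lift P (\<lambda>u v. F (B (comult C u) (id v))) (comult C h)"
    using h by (intro sweedler_cong) (simp_all add: FB comult_closed)
  also have "\<dots> = F (tensor_lift ?TT (\<lambda>u v. B (comult C u) (id v)) (comult C h))"
    using sweedler_comp[OF TT P F bilinear_maps_comp[OF B comult_linear id] h] by simp
  also have "tensor_lift ?TT (\<lambda>u v. B (comult C u) (id v)) (comult C h)
      = tensor_assoc k C C C (tensor_map k ?T C (comult C) id (comult C h))"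
    using tensor_lift_tensor_map[OF C C T C TT comult_linear id B comult_closed[OF h]]
    by (simp add: tensor_assoc_def B_def)
  also have "\<dots> = tensor_map k C ?T id (comult C) (comult C h)"
    using coassoc[OF h] .
  also have "F \<dots> = tensor_lift P (\<lambda>u v. tensor_lift P (t u) (comult C v)) (comult C h)"
    using tensor_lift_tensor_map[OF C C C T P id comult_linear G comult_closed[OF h]]
    by (simp add: F_def G_def)
  finally show ?thesis .
qed

end

text \<open>The classical computation \<open>f = f * (g * f') = (f * g) * f' = f'\<close> for the
  convolution \<open>*\<close>. In a Hopf category the factors and the two products lie in different
  hom modules, hence four modules, four bilinear products and one unit on each side;
  \<open>assoc\<close> is the only link between the products.\<close>

lemma (in coalgebra) convolution_inverse_unique:
  assumes mods: "module k P" "module k Q" "module k R" "module k R'" and I: "I \<subseteq> carrier k"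
    and f: "f \<in> linear_maps k C P" and g: "g \<in> linear_maps k C Q" and f': "f' \<in> linear_maps k C P"
    and pq: "pq \<in> bilinear_maps k P Q R" and rp: "rp \<in> bilinear_maps k R P P"
    and qp: "qp \<in> bilinear_maps k Q P R'" and pr: "pr \<in> bilinear_maps k P R' P"
    and assoc: "\<And>p q p'. p \<in> carrier P \<Longrightarrow> q \<in> carrier Q \<Longrightarrow> p' \<in> carrier P \<Longrightarrow>
      rp (pq p q) p' = pr p (qp q p')"
    and e: "e \<in> carrier R" "\<And>p. p \<in> carrier P \<Longrightarrow> rp e p = p"
    and e': "e' \<in> carrier R'" "\<And>p. p \<in> carrier P \<Longrightarrow> pr p e' = p"
    and fg: "\<And>h. h \<in> carrier C \<Longrightarrow>
      mcong I R (tensor_lift R (\<lambda>u v. pq (f u) (g v)) (comult C h)) (counit C h \<odot>\<^bsub>R\<^esub> e)"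
    and gf': "\<And>h. h \<in> carrier C \<Longrightarrow>
      mcong I R' (tensor_lift R' (\<lambda>u v. qp (g u) (f' v)) (comult C h)) (counit C h \<odot>\<^bsub>R'\<^esub> e')"
    and h: "h \<in> carrier C"
  shows "mcong I P (f h) (f' h)"
proof -
  note C = module_axioms
  interpret P: module k P by fact
  note clf = linear_mapsD(1)[OF f] and clg = linear_mapsD(1)[OF g] and clf' = linear_mapsD(1)[OF f']
  \<comment> \<open>The summand of the triple convolution \<open>f * (g * f')\<close>, bracketed to
    the right.\<close>
  define t where "t = (\<lambda>a b c. pr (f a) (qp (g b) (f' c)))"
  have t: "t \<in> trilinear_maps k C C C P"
    unfolding t_def
  proof (rule trilinear_mapsI)
    note qp_lin = bilinear_maps_linear[OF bilinear_maps_comp[OF qp g f']]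
    show "(\<lambda>c. pr (f a) (qp (g b) (f' c))) \<in> linear_maps k C P" if "a \<in> carrier C" "b \<in> carrier C" for a b
      using linear_maps_comp[OF bilinear_maps_linear(1)[OF pr clf[OF that(1)]] qp_lin(1)[OF that(2)]] .
    show "(\<lambda>b. pr (f a) (qp (g b) (f' c))) \<in> linear_maps k C P" if "a \<in> carrier C" "c \<in> carrier C" for a c
      using linear_maps_comp[OF bilinear_maps_linear(1)[OF pr clf[OF that(1)]] qp_lin(2)[OF that(2)]] .
    show "(\<lambda>a. pr (f a) (qp (g b) (f' c))) \<in> linear_maps k C P" if "b \<in> carrier C" "c \<in> carrier C" for b c
      using linear_maps_comp[OF bilinear_maps_linear(2)[OF pr
            bilinear_mapsD(1)[OF qp clg[OF that(1)] clf'[OF that(2)]]] f] .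
  qed
  have smult_e': "(\<lambda>u. counit C u \<odot>\<^bsub>R'\<^esub> e') \<in> linear_maps k C R'"
    using linear_maps_comp[OF bilinear_maps_linear(2)[OF smult_bilinear[OF mods(4)] e'(1)] counit_linear] .
  have smult_e: "(\<lambda>u. counit C u \<odot>\<^bsub>R\<^esub> e) \<in> linear_maps k C R"
    using linear_maps_comp[OF bilinear_maps_linear(2)[OF smult_bilinear[OF mods(3)] e(1)] counit_linear] .
  have b1: "(\<lambda>u v. pr (f u) (counit C v \<odot>\<^bsub>R'\<^esub> e')) \<in> bilinear_maps k C C P"
    using bilinear_maps_comp[OF pr f smult_e'] .
  have b2: "(\<lambda>u v. rp (counit C u \<odot>\<^bsub>R\<^esub> e) (f' v)) \<in> bilinear_maps k C C P"
    using bilinear_maps_comp[OF rp smult_e f'] .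
  have counit_smult: "(\<lambda>u v. counit C u \<odot>\<^bsub>C\<^esub> v) \<in> bilinear_maps k C C C"
    using bilinear_maps_comp[OF smult_bilinear[OF C] counit_linear linear_maps_id] .
  have sw_qp: "(\<lambda>v. tensor_lift R' (\<lambda>a b. qp (g a) (f' b)) (comult C v)) \<in> linear_maps k C R'"
    using sweedler_linear[OF mods(4) bilinear_maps_comp[OF qp g f']] .
  have sw_pq: "(\<lambda>u. tensor_lift R (\<lambda>a b. pq (f a) (g b)) (comult C u)) \<in> linear_maps k C R"
    using sweedler_linear[OF mods(3) bilinear_maps_comp[OF pq f g]] .

  \<comment> \<open>The right counit law writes \<open>f\<close> as its convolution with the
    multiples \<open>counit C v\<close> of the unit \<open>e'\<close>; these are then replaced, up
    to congruence, by the convolution of \<open>g\<close> and \<open>f'\<close>.\<close>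
  have "f h = tensor_lift P (\<lambda>u v. pr (f u) (counit C v \<odot>\<^bsub>R'\<^esub> e')) (comult C h)"
  proof -
    have "f h = f (tensor_lift C (\<lambda>u v. counit C v \<odot>\<^bsub>C\<^esub> u) (comult C h))"
      using counit_right[OF h] by simp
    also have "\<dots> = tensor_lift P (\<lambda>u v. f (counit C v \<odot>\<^bsub>C\<^esub> u)) (comult C h)"
      using sweedler_comp[OF C mods(1) f bilinear_maps_swap[OF counit_smult] h] .
    also have "\<dots> = tensor_lift P (\<lambda>u v. pr (f u) (counit C v \<odot>\<^bsub>R'\<^esub> e')) (comult C h)"
      using h by (intro sweedler_cong)
        (simp_all add: linear_mapsD(3)[OF f] bilinear_mapsD(5)[OF pr] counit_closed e' clf)
    finally show ?thesis .
  qed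
  moreover have "mcong I P (tensor_lift P (\<lambda>u v. pr (f u) (tensor_lift R' (\<lambda>a b. qp (g a) (f' b))
      (comult C v))) (comult C h)) \<dots>"
    using bilinear_maps_comp[OF pr f sw_qp] b1 h
  proof (rule sweedler_mcong[OF mods(1) I])
    fix u v assume "u \<in> carrier C" "v \<in> carrier C"
    then show "mcong I P (pr (f u) (tensor_lift R' (\<lambda>a b. qp (g a) (f' b)) (comult C v)))
        (pr (f u) (counit C v \<odot>\<^bsub>R'\<^esub> e'))"
      using mcong_linear[OF mods(4,1) I bilinear_maps_linear(1)[OF pr clf] gf'] by blast
  qed
  moreover have "tensor_lift P (\<lambda>u v. pr (f u) (tensor_lift R' (\<lambda>a b. qp (g a) (f' b))
      (comult C v))) (comult C h) = tensor_lift P (\<lambda>u v. tensor_lift P (t u) (comult C v)) (comult C h)"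
    using h
  proof (rule sweedler_cong)
    fix u v assume uv: "u \<in> carrier C" "v \<in> carrier C"
    show "pr (f u) (tensor_lift R' (\<lambda>a b. qp (g a) (f' b)) (comult C v))
      = tensor_lift P (t u) (comult C v)"
      unfolding t_def
      using sweedler_comp[OF mods(4,1) bilinear_maps_linear(1)[OF pr clf[OF uv(1)]]
          bilinear_maps_comp[OF qp g f'] uv(2)] .
  qed
  \<comment> \<open>Coassociativity moves the comultiplied leg to the left, and \<open>assoc\<close>
    exchanges the products \<open>pr\<close>, \<open>qp\<close> for \<open>rp\<close>,
    \<open>pq\<close>.\<close>
  moreover have "\<dots> = tensor_lift P (\<lambda>u v. rp (tensor_lift R (\<lambda>a b. pq (f a) (g b)) (comult C u)) (f' v)) (comult C h)"
    unfolding sweedler_coassoc[OF mods(1) t h, symmetric] using h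
  proof (rule sweedler_cong)
    fix u v assume uv: "u \<in> carrier C" "v \<in> carrier C"
    have "rp (tensor_lift R (\<lambda>a b. pq (f a) (g b)) (comult C u)) (f' v)
      = tensor_lift P (\<lambda>a b. rp (pq (f a) (g b)) (f' v)) (comult C u)"
      using sweedler_comp[OF mods(3,1) bilinear_maps_linear(2)[OF rp clf'[OF uv(2)]]
          bilinear_maps_comp[OF pq f g] uv(1)] .
    also have "\<dots> = tensor_lift P (\<lambda>a b. t a b v) (comult C u)"
      unfolding t_def using uv by (intro sweedler_cong) (simp_all add: assoc clf clg clf')
    finally show "tensor_lift P (\<lambda>a b. t a b v) (comult C u)
      = rp (tensor_lift R (\<lambda>a b. pq (f a) (g b)) (comult C u)) (f' v)" ..
  qed
  moreover have "mcong I P \<dots> (tensor_lift P (\<lambda>u v. rp (counit C u \<odot>\<^bsub>R\<^esub> e) (f' v)) (comult C h))"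
    using bilinear_maps_comp[OF rp sw_pq f'] b2 h
  proof (rule sweedler_mcong[OF mods(1) I])
    fix u v assume "u \<in> carrier C" "v \<in> carrier C"
    then show "mcong I P (rp (tensor_lift R (\<lambda>a b. pq (f a) (g b)) (comult C u)) (f' v))
        (rp (counit C u \<odot>\<^bsub>R\<^esub> e) (f' v))"
      using mcong_linear[OF mods(3,1) I bilinear_maps_linear(2)[OF rp clf'] fg] by blast
  qed
  moreover have "tensor_lift P (\<lambda>u v. rp (counit C u \<odot>\<^bsub>R\<^esub> e) (f' v)) (comult C h) = f' h"
  proof -
    have "f' h = f' (tensor_lift C (\<lambda>u v. counit C u \<odot>\<^bsub>C\<^esub> v) (comult C h))"
      using counit_left[OF h] by simp
    also have "\<dots> = tensor_lift P (\<lambda>u v. f' (counit C u \<odot>\<^bsub>C\<^esub> v)) (comult C h)"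
      using sweedler_comp[OF C mods(1) f' counit_smult h] .
    also have "\<dots> = tensor_lift P (\<lambda>u v. rp (counit C u \<odot>\<^bsub>R\<^esub> e) (f' v)) (comult C h)"
      using h by (intro sweedler_cong)
        (simp_all add: linear_mapsD(3)[OF f'] bilinear_mapsD(4)[OF rp] counit_closed e clf')
    finally show ?thesis by simp
  qed
  ultimately show ?thesis
    using mcong_sym[OF mods(1) I] P.mcong_trans[OF I] by metis
qed

section \<open>Products of tensors\<close>

text \<open>Grouped in pairs because the variables come from two tensors, one in
  \<open>C \<otimes> C'\<close> and one in \<open>D \<otimes> D'\<close>; bilinearity within each
  pair is what the two nested lifts consume.\<close>

definition quadrilinear_maps ::
  "('c, 'r) ring_scheme \<Rightarrow> ('c, 'a, 'm1) module_scheme \<Rightarrow> ('c, 'b, 'm2) module_scheme \<Rightarrow>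
   ('c, 'd, 'm3) module_scheme \<Rightarrow> ('c, 'e, 'm4) module_scheme \<Rightarrow> ('c, 'p, 'm5) module_scheme \<Rightarrow>
   ('a \<Rightarrow> 'b \<Rightarrow> 'd \<Rightarrow> 'e \<Rightarrow> 'p) set"
  where "quadrilinear_maps k C C' D D' P = {q.
    (\<forall>c\<in>carrier C. \<forall>c'\<in>carrier C'. q c c' \<in> bilinear_maps k D D' P) \<and>
    (\<forall>d\<in>carrier D. \<forall>d'\<in>carrier D'. (\<lambda>c c'. q c c' d d') \<in> bilinear_maps k C C' P)}"

lemma quadrilinear_mapsD:
  assumes "q \<in> quadrilinear_maps k C C' D D' P"
  shows "c \<in> carrier C \<Longrightarrow> c' \<in> carrier C' \<Longrightarrow> q c c' \<in> bilinear_maps k D D' P"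
    and "d \<in> carrier D \<Longrightarrow> d' \<in> carrier D' \<Longrightarrow> (\<lambda>c c'. q c c' d d') \<in> bilinear_maps k C C' P"
  using assms by (simp_all add: quadrilinear_maps_def)

lemma quadrilinear_lift_inner:
  assumes "module k C" "module k C'" "module k D" "module k D'" "module k P"
    and q: "q \<in> quadrilinear_maps k C C' D D' P" and t: "t \<in> carrier (tensor k D D')"
  shows "(\<lambda>c c'. tensor_lift P (q c c') t) \<in> bilinear_maps k C C' P"
proof (rule bilinear_mapsI)
  note q1 = quadrilinear_mapsD(1)[OF q] and q2 = bilinear_maps_linear[OF quadrilinear_mapsD(2)[OF q]]
  show "(\<lambda>c'. tensor_lift P (q c c') t) \<in> linear_maps k C' P" if c: "c \<in> carrier C" for c
    by (rule linear_maps_tensor_lift[OF assms(3-5,2) t q1[OF c] q2(1)[OF _ _ c]])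
  show "(\<lambda>c. tensor_lift P (q c c') t) \<in> linear_maps k C P" if c': "c' \<in> carrier C'" for c'
    by (rule linear_maps_tensor_lift[OF assms(3-5,1) t q1[OF _ c'] q2(2)[OF _ _ c']])
qed

lemma quadrilinear_lift:
  assumes "module k C" "module k C'" "module k D" "module k D'" "module k P"
    and q: "q \<in> quadrilinear_maps k C C' D D' P"
  shows "(\<lambda>s t. tensor_lift P (\<lambda>c c'. tensor_lift P (q c c') t) s)
    \<in> bilinear_maps k (tensor k C C') (tensor k D D') P"
proof (rule bilinear_mapsI)
  note inner = quadrilinear_lift_inner[OF assms]
  show "tensor_lift P (\<lambda>c c'. tensor_lift P (q c c') t) \<in> linear_maps k (tensor k C C') P"
    if "t \<in> carrier (tensor k D D')" for t
    using tensor_lift_linear[OF assms(1,2,5) inner[OF that]] .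
  show "(\<lambda>t. tensor_lift P (\<lambda>c c'. tensor_lift P (q c c') t) s) \<in> linear_maps k (tensor k D D') P"
    if "s \<in> carrier (tensor k C C')" for s
    by (rule linear_maps_tensor_lift[OF assms(1,2,5) tensor_module[OF assms(3,4)] that inner
          tensor_lift_linear[OF assms(3-5) quadrilinear_mapsD(1)[OF q]]])
qed

lemma quadrilinear_mult:
  assumes "b \<in> bilinear_maps k E E' P" "m \<in> bilinear_maps k C D E" "m' \<in> bilinear_maps k C' D' E'"
  shows "(\<lambda>c c' d d'. b (m c d) (m' c' d')) \<in> quadrilinear_maps k C C' D D' P"
  unfolding quadrilinear_maps_def
  using bilinear_maps_comp[OF assms(1) bilinear_maps_linear(1)[OF assms(2)] bilinear_maps_linear(1)[OF assms(3)]]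
    bilinear_maps_comp[OF assms(1) bilinear_maps_linear(2)[OF assms(2)] bilinear_maps_linear(2)[OF assms(3)]]
  by blast

text \<open>The componentwise product
  \<open>(c \<otimes> c') (d \<otimes> d') = m c d \<otimes> m c' d'\<close>. It makes the tensor
  squares of the hom modules into a category again, in which the comultiplication has convolution
  inverses.\<close>

definition tensor_mult ::
  "('c, 'r) ring_scheme \<Rightarrow> ('c, 'e, 'm) module_scheme \<Rightarrow> ('a \<Rightarrow> 'b \<Rightarrow> 'e) \<Rightarrow>
   ('a \<times> 'a) list set \<Rightarrow> ('b \<times> 'b) list set \<Rightarrow> ('e \<times> 'e) list set"
  where "tensor_mult k E m s t = tensor_lift (tensor k E E)
    (\<lambda>c c'. tensor_lift (tensor k E E) (\<lambda>d d'. pure_tensor k E E (m c d) (m c' d')) t) s"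

lemma tensor_mult_bilinear:
  assumes "module k C" "module k D" "module k E" "m \<in> bilinear_maps k C D E"
  shows "tensor_mult k E m \<in> bilinear_maps k (tensor k C C) (tensor k D D) (tensor k E E)"
  unfolding tensor_mult_def
  by (rule quadrilinear_lift[OF assms(1,1,2,2) tensor_module[OF assms(3,3)]
        quadrilinear_mult[OF pure_tensor_bilinear[OF assms(3,3)] assms(4,4)]])

lemma tensor_mult_pure:
  assumes "module k C" "module k D" "module k E" "m \<in> bilinear_maps k C D E"
    and "c \<in> carrier C" "c' \<in> carrier C" "d \<in> carrier D" "d' \<in> carrier D"
  shows "tensor_mult k E m (pure_tensor k C C c c') (pure_tensor k D D d d')
    = pure_tensor k E E (m c d) (m c' d')"
proof -
  note E = tensor_module[OF assms(3,3)]
  note q = quadrilinear_mult[OF pure_tensor_bilinear[OF assms(3,3)] assms(4,4)]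
  have t: "pure_tensor k D D d d' \<in> carrier (tensor k D D)"
    using assms by (simp add: pure_tensor_closed)
  show ?thesis
    unfolding tensor_mult_def
    using tensor_lift_pure[OF assms(1,1) E quadrilinear_lift_inner[OF assms(1,1,2,2) E q t] assms(5,6)]
      tensor_lift_pure[OF assms(2,2) E quadrilinear_mapsD(1)[OF q assms(5,6)] assms(7,8)]
    by simp
qed

text \<open>Both sides are linear in each argument, so the law extends from pure tensors to
  arbitrary ones, one argument at a time: \<open>w\<close>, then \<open>t\<close>, then
  \<open>s\<close>.\<close>

lemma tensor_mult_assoc:
  assumes mods: "module k P" "module k Q" "module k L" "module k R" "module k R'" "module k N"
    and pq: "pq \<in> bilinear_maps k P Q R" and rl: "rl \<in> bilinear_maps k R L N"
    and ql: "ql \<in> bilinear_maps k Q L R'" and pr: "pr \<in> bilinear_maps k P R' N"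
    and assoc: "\<And>p q l. p \<in> carrier P \<Longrightarrow> q \<in> carrier Q \<Longrightarrow> l \<in> carrier L \<Longrightarrow>
      rl (pq p q) l = pr p (ql q l)"
    and s: "s \<in> carrier (tensor k P P)" and t: "t \<in> carrier (tensor k Q Q)"
    and w: "w \<in> carrier (tensor k L L)"
  shows "tensor_mult k N rl (tensor_mult k R pq s t) w = tensor_mult k N pr s (tensor_mult k R' ql t w)"
proof -
  note PQ = tensor_mult_bilinear[OF mods(1,2,4) pq] and RL = tensor_mult_bilinear[OF mods(4,3,6) rl]
    and QL = tensor_mult_bilinear[OF mods(2,3,5) ql] and PR = tensor_mult_bilinear[OF mods(1,5,6) pr]
  note N = tensor_module[OF mods(6,6)]
  let ?E = "\<lambda>s t w. tensor_mult k N rl (tensor_mult k R pq s t) w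
    = tensor_mult k N pr s (tensor_mult k R' ql t w)"
  let ?p = "pure_tensor k P P" and ?q = "pure_tensor k Q Q" and ?l = "pure_tensor k L L"
  have 1: "?E (?p a a') (?q b b') (?l c c')"
    if "a \<in> carrier P" "a' \<in> carrier P" "b \<in> carrier Q" "b' \<in> carrier Q" "c \<in> carrier L" "c' \<in> carrier L"
    for a a' b b' c c'
    using that by (simp add: tensor_mult_pure[OF mods(1,2,4) pq] tensor_mult_pure[OF mods(4,3,6) rl]
        tensor_mult_pure[OF mods(2,3,5) ql] tensor_mult_pure[OF mods(1,5,6) pr]
        bilinear_mapsD(1)[OF pq] bilinear_mapsD(1)[OF ql] assoc)
  have 2: "?E (?p a a') (?q b b') w"
    if "a \<in> carrier P" "a' \<in> carrier P" "b \<in> carrier Q" "b' \<in> carrier Q" for a a' b b'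
  proof (rule linear_maps_tensor_ext[OF mods(3,3) N w,
        where f = "tensor_mult k N rl (tensor_mult k R pq (?p a a') (?q b b'))"])
    have p: "?p a a' \<in> carrier (tensor k P P)" and q: "?q b b' \<in> carrier (tensor k Q Q)"
      using that by (simp_all add: pure_tensor_closed)
    show "tensor_mult k N rl (tensor_mult k R pq (?p a a') (?q b b'))
        \<in> linear_maps k (tensor k L L) (tensor k N N)"
      using bilinear_maps_linear(1)[OF RL bilinear_mapsD(1)[OF PQ p q]] .
    show "(\<lambda>w. tensor_mult k N pr (?p a a') (tensor_mult k R' ql (?q b b') w))
        \<in> linear_maps k (tensor k L L) (tensor k N N)"
      using linear_maps_comp[OF bilinear_maps_linear(1)[OF PR p] bilinear_maps_linear(1)[OF QL q]] .
  qed (use that 1 in simp)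
  have 3: "?E (?p a a') t w" if "a \<in> carrier P" "a' \<in> carrier P" for a a'
  proof (rule linear_maps_tensor_ext[OF mods(2,2) N t,
        where f = "\<lambda>t. tensor_mult k N rl (tensor_mult k R pq (?p a a') t) w"])
    have p: "?p a a' \<in> carrier (tensor k P P)"
      using that by (simp add: pure_tensor_closed)
    show "(\<lambda>t. tensor_mult k N rl (tensor_mult k R pq (?p a a') t) w)
        \<in> linear_maps k (tensor k Q Q) (tensor k N N)"
      using linear_maps_comp[OF bilinear_maps_linear(2)[OF RL w] bilinear_maps_linear(1)[OF PQ p]] .
    show "(\<lambda>t. tensor_mult k N pr (?p a a') (tensor_mult k R' ql t w))
        \<in> linear_maps k (tensor k Q Q) (tensor k N N)"
      using linear_maps_comp[OF bilinear_maps_linear(1)[OF PR p] bilinear_maps_linear(2)[OF QL w]] .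
  qed (use that 2 in simp)
  show ?thesis
  proof (rule linear_maps_tensor_ext[OF mods(1,1) N s,
        where f = "\<lambda>s. tensor_mult k N rl (tensor_mult k R pq s t) w"])
    show "(\<lambda>s. tensor_mult k N rl (tensor_mult k R pq s t) w)
        \<in> linear_maps k (tensor k P P) (tensor k N N)"
      using linear_maps_comp[OF bilinear_maps_linear(2)[OF RL w] bilinear_maps_linear(2)[OF PQ t]] .
    show "(\<lambda>s. tensor_mult k N pr s (tensor_mult k R' ql t w))
        \<in> linear_maps k (tensor k P P) (tensor k N N)"
      using bilinear_maps_linear(2)[OF PR bilinear_mapsD(1)[OF QL t w]] .
  qed (use 3 in simp)
qed

lemma tensor_mult_unit_left:
  assumes "module k P" "module k R" "m \<in> bilinear_maps k R P P" "e \<in> carrier R"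
    "\<And>p. p \<in> carrier P \<Longrightarrow> m e p = p" "t \<in> carrier (tensor k P P)"
  shows "tensor_mult k P m (pure_tensor k R R e e) t = t"
proof (rule linear_maps_tensor_ext[OF assms(1,1) tensor_module[OF assms(1,1)] assms(6) _ linear_maps_id])
  show "tensor_mult k P m (pure_tensor k R R e e) \<in> linear_maps k (tensor k P P) (tensor k P P)"
    using bilinear_maps_linear(1)[OF tensor_mult_bilinear[OF assms(2,1,1,3)] pure_tensor_closed[OF assms(4,4)]] .
  show "tensor_mult k P m (pure_tensor k R R e e) (pure_tensor k P P a b) = pure_tensor k P P a b"
    if "a \<in> carrier P" "b \<in> carrier P" for a b
    using that assms(4,5) by (simp add: tensor_mult_pure[OF assms(2,1,1,3)])
qed

lemma tensor_mult_unit_right: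
  assumes "module k P" "module k R" "m \<in> bilinear_maps k P R P" "e \<in> carrier R"
    "\<And>p. p \<in> carrier P \<Longrightarrow> m p e = p" "t \<in> carrier (tensor k P P)"
  shows "tensor_mult k P m t (pure_tensor k R R e e) = t"
proof (rule linear_maps_tensor_ext[OF assms(1,1) tensor_module[OF assms(1,1)] assms(6) _ linear_maps_id])
  show "(\<lambda>t. tensor_mult k P m t (pure_tensor k R R e e)) \<in> linear_maps k (tensor k P P) (tensor k P P)"
    using bilinear_maps_linear(2)[OF tensor_mult_bilinear[OF assms(1,2,1,3)] pure_tensor_closed[OF assms(4,4)]] .
  show "tensor_mult k P m (pure_tensor k P P a b) (pure_tensor k R R e e) = pure_tensor k P P a b"
    if "a \<in> carrier P" "b \<in> carrier P" for a b
    using that assms(4,5) by (simp add: tensor_mult_pure[OF assms(1,2,1,3)])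
qed

section \<open>The antipode reverses the comultiplication\<close>

text \<open>The coalgebra structure adds record fields on top of the tensor module and leaves the
  module fields alone; this translates between the two record types.\<close>

lemma linear_maps_tensor_coalgebra:
  "linear_maps k (tensor_coalgebra k C D) P = linear_maps k (tensor k C D) P"
  "carrier (tensor_coalgebra k C D) = carrier (tensor k C D)"
  by (simp_all add: linear_maps_def tensor_coalgebra_def module.extend_def)

lemma comult_tensor_coalgebra:
  assumes "coalgebra k C" "coalgebra k D" "c \<in> carrier C" "d \<in> carrier D"
  shows "comult (tensor_coalgebra k C D) (pure_tensor k C D c d)
    = tensor_interchange k C D (comult C c) (comult D d)"
    and "tensor_interchange k C D (comult C c) (comult D d)
      \<in> carrier (tensor k (tensor k C D) (tensor k C D))"
proof -
  interpret C: coalgebra k C by fact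
  interpret D: coalgebra k D by fact
  note C = C.module_axioms and D = D.module_axioms
  note T = tensor_module[OF C D]
  note TT = tensor_module[OF T T]
  note pure = pure_tensor_bilinear[OF C D]
  have b: "tensor_interchange k C D \<in> bilinear_maps k (tensor k C C) (tensor k D D)
      (tensor k (tensor k C D) (tensor k C D))"
    unfolding tensor_interchange_def Let_def
    by (rule quadrilinear_lift[OF C C D D TT
          quadrilinear_mult[OF pure_tensor_bilinear[OF T T] pure pure]])
  show "comult (tensor_coalgebra k C D) (pure_tensor k C D c d)
    = tensor_interchange k C D (comult C c) (comult D d)"
    using tensor_lift_pure[OF C D TT bilinear_maps_comp[OF b C.comult_linear D.comult_linear] assms(3,4)]
    by (simp add: tensor_coalgebra_def module.extend_def)
  show "tensor_interchange k C D (comult C c) (comult D d)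
      \<in> carrier (tensor k (tensor k C D) (tensor k C D))"
    using bilinear_mapsD(1)[OF b C.comult_closed[OF assms(3)] D.comult_closed[OF assms(4)]] .
qed

lemma counit_tensor_coalgebra:
  assumes "coalgebra k C" "coalgebra k D" "c \<in> carrier C" "d \<in> carrier D"
  shows "counit (tensor_coalgebra k C D) (pure_tensor k C D c d) = counit C c \<otimes>\<^bsub>k\<^esub> counit D d"
proof -
  interpret C: coalgebra k C by fact
  interpret D: coalgebra k D by fact
  note K = base_module_module[OF C.R.is_cring]
  have "(\<lambda>c d. counit C c \<otimes>\<^bsub>k\<^esub> counit D d) \<in> bilinear_maps k C D (base_module k)"
    using bilinear_maps_comp[OF smult_bilinear[OF K] C.counit_linear D.counit_linear] by simp
  from tensor_lift_pure[OF C.module_axioms D.module_axioms K this assms(3,4)]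
  show ?thesis by (simp add: tensor_coalgebra_def module.extend_def)
qed

section \<open>Structure maps and antipodes of a Hopf category\<close>

context hopf_category
begin

abbreviation mul :: "'x \<Rightarrow> 'x \<Rightarrow> 'x \<Rightarrow> 'a \<Rightarrow> 'a \<Rightarrow> 'a"
  where "mul \<equiv> hopf_mult k A \<mu>"

abbreviation sweedler :: "'x \<Rightarrow> 'x \<Rightarrow> ('c, 'p, 'q) module_scheme \<Rightarrow> ('a \<Rightarrow> 'a \<Rightarrow> 'p) \<Rightarrow> 'a \<Rightarrow> 'p"
  where "sweedler x y P b h \<equiv> tensor_lift P b (comult (A x y) h)"

lemma hom_module: "x \<in> X \<Longrightarrow> y \<in> X \<Longrightarrow> module k (A x y)"
  using hom_coalgebra by (simp add: coalgebra_def)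

lemma mult_linear:
  "x \<in> X \<Longrightarrow> y \<in> X \<Longrightarrow> z \<in> X \<Longrightarrow>
    \<mu> x y z \<in> linear_maps k (tensor k (A x y) (A y z)) (A x z)"
  using mult_coalgebra_map[of x y z] by (simp add: coalgebra_maps_def linear_maps_tensor_coalgebra)

lemma mul_bilinear:
  assumes "x \<in> X" "y \<in> X" "z \<in> X"
  shows "mul x y z \<in> bilinear_maps k (A x y) (A y z) (A x z)"
  unfolding hopf_mult_def
  using bilinear_maps_post[OF mult_linear[OF assms] pure_tensor_bilinear] hom_module assms
  by blast

lemma unit_closed: "x \<in> X \<Longrightarrow> \<eta> x \<one> \<in> carrier (A x x)"
  using unit_coalgebra_map[of x]
  by (auto simp: coalgebra_maps_def linear_maps_def base_coalgebra_def module.extend_def)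

lemma unit_linear:
  "x \<in> X \<Longrightarrow> \<eta> x \<in> linear_maps k (base_module k) (A x x)"
  using unit_coalgebra_map[of x]
  by (simp add: coalgebra_maps_def linear_maps_def base_coalgebra_def module.extend_def)

lemma comult_unit:
  assumes "x \<in> X"
  shows "comult (A x x) (\<eta> x \<one>) = pure_tensor k (A x x) (A x x) (\<eta> x \<one>) (\<eta> x \<one>)"
proof -
  have "comult (A x x) (\<eta> x \<one>)
      = tensor_map k (A x x) (A x x) (\<eta> x) (\<eta> x) (comult (base_coalgebra k) \<one>)"
    using unit_coalgebra_map[OF assms]
    by (simp add: coalgebra_maps_def base_coalgebra_def module.extend_def)
  also have "comult (base_coalgebra k) \<one> = pure_tensor k (base_module k) (base_module k) \<one> \<one>"
    by (simp add: base_coalgebra_def module.extend_def)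
  also have "tensor_map k (A x x) (A x x) (\<eta> x) (\<eta> x) \<dots>
      = pure_tensor k (A x x) (A x x) (\<eta> x \<one>) (\<eta> x \<one>)"
  proof -
    note K = base_module_module[OF is_cring] and M = hom_module[OF assms assms]
    show ?thesis
      unfolding tensor_map_def
      by (rule tensor_lift_pure[OF K K tensor_module[OF M M]
            tensor_map_bilinear[OF M M unit_linear[OF assms] unit_linear[OF assms]]]) simp_all
  qed
  finally show ?thesis .
qed

lemma counit_unit: "x \<in> X \<Longrightarrow> counit (A x x) (\<eta> x \<one>) = \<one>"
  using unit_coalgebra_map[of x]
  by (simp add: coalgebra_maps_def base_coalgebra_def module.extend_def)

lemma counit_mul:
  assumes "x \<in> X" "y \<in> X" "z \<in> X" "h \<in> carrier (A x y)" "l \<in> carrier (A y z)"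
  shows "counit (A x z) (mul x y z h l) = counit (A x y) h \<otimes> counit (A y z) l"
  using mult_coalgebra_map[OF assms(1-3)] pure_tensor_closed[OF assms(4,5), where k = k]
    counit_tensor_coalgebra[OF hom_coalgebra hom_coalgebra assms(4,5)] assms
  by (simp add: coalgebra_maps_def hopf_mult_def linear_maps_tensor_coalgebra)

text \<open>That \<open>\<mu>\<close> respects the comultiplication becomes
  \<open>\<Delta>(h l) = \<Delta>(h) \<Delta>(l)\<close> once \<open>\<mu> \<otimes> \<mu>\<close>
  has been carried through the middle four interchange, across its two nested lifts one after the
  other.\<close>

lemma comult_mul:
  assumes "x \<in> X" "y \<in> X" "z \<in> X" "h \<in> carrier (A x y)" "l \<in> carrier (A y z)"
  shows "comult (A x z) (mul x y z h l)
    = tensor_mult k (A x z) (mul x y z) (comult (A x y) h) (comult (A y z) l)"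
proof -
  let ?C = "A x y" and ?D = "A y z" and ?E = "A x z"
  let ?T = "tensor k ?C ?D"
  note coalg = hom_coalgebra[OF assms(1,2)] hom_coalgebra[OF assms(2,3)]
  interpret C: coalgebra k ?C by (rule coalg)
  interpret D: coalgebra k ?D by (rule coalg)
  note C = C.module_axioms and D = D.module_axioms and E = hom_module[OF assms(1,3)]
  note T = tensor_module[OF C D]
  note TT = tensor_module[OF T T] and EE = tensor_module[OF E E]
  note m = mult_linear[OF assms(1-3)]
  note pure = pure_tensor_bilinear[OF C D]
  note q = quadrilinear_mult[OF pure_tensor_bilinear[OF T T] pure pure]
  define b where "b = (\<lambda>s t. pure_tensor k ?E ?E (\<mu> x y z s) (\<mu> x y z t))"
  have b: "b \<in> bilinear_maps k ?T ?T (tensor k ?E ?E)"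
    unfolding b_def using tensor_map_bilinear[OF E E m m] .
  have L: "tensor_lift (tensor k ?E ?E) b \<in> linear_maps k (tensor k ?T ?T) (tensor k ?E ?E)"
    using tensor_lift_linear[OF T T EE b] .
  let ?p = "\<lambda>c c' d d'. pure_tensor k ?T ?T (pure_tensor k ?C ?D c d) (pure_tensor k ?C ?D c' d')"
  have "comult ?E (mul x y z h l) = tensor_map k ?E ?E (\<mu> x y z) (\<mu> x y z)
      (tensor_interchange k ?C ?D (comult ?C h) (comult ?D l))"
    using mult_coalgebra_map[OF assms(1-3)] pure_tensor_closed[OF assms(4,5), where k = k]
      comult_tensor_coalgebra(1)[OF coalg assms(4,5)]
    by (simp add: coalgebra_maps_def hopf_mult_def linear_maps_tensor_coalgebra)
  also have "\<dots> = tensor_lift (tensor k ?E ?E) b (tensor_lift (tensor k ?T ?T)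
      (\<lambda>c c'. tensor_lift (tensor k ?T ?T) (?p c c') (comult ?D l)) (comult ?C h))"
    by (simp add: tensor_map_def b_def tensor_interchange_def Let_def)
  also have "\<dots> = tensor_lift (tensor k ?E ?E) (\<lambda>c c'. tensor_lift (tensor k ?E ?E) b
      (tensor_lift (tensor k ?T ?T) (?p c c') (comult ?D l))) (comult ?C h)"
    using C.sweedler_comp[OF TT EE L quadrilinear_lift_inner[OF C C D D TT q D.comult_closed[OF assms(5)]] assms(4)] .
  also have "\<dots> = tensor_lift (tensor k ?E ?E) (\<lambda>c c'. tensor_lift (tensor k ?E ?E)
      (\<lambda>d d'. pure_tensor k ?E ?E (mul x y z c d) (mul x y z c' d')) (comult ?D l)) (comult ?C h)"
  proof (rule C.sweedler_cong[OF assms(4)])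
    fix c c' assume c: "c \<in> carrier ?C" "c' \<in> carrier ?C"
    have "tensor_lift (tensor k ?E ?E) b (tensor_lift (tensor k ?T ?T) (?p c c') (comult ?D l))
      = tensor_lift (tensor k ?E ?E) (\<lambda>d d'. tensor_lift (tensor k ?E ?E) b (?p c c' d d')) (comult ?D l)"
      using D.sweedler_comp[OF TT EE L quadrilinear_mapsD(1)[OF q c] assms(5)] .
    also have "\<dots> = tensor_lift (tensor k ?E ?E)
      (\<lambda>d d'. pure_tensor k ?E ?E (mul x y z c d) (mul x y z c' d')) (comult ?D l)"
    proof (rule D.sweedler_cong[OF assms(5)])
      fix d d' assume d: "d \<in> carrier ?D" "d' \<in> carrier ?D"
      show "tensor_lift (tensor k ?E ?E) b (?p c c' d d')
        = pure_tensor k ?E ?E (mul x y z c d) (mul x y z c' d')"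
        using tensor_lift_pure[OF T T EE b pure_tensor_closed[OF c(1) d(1)] pure_tensor_closed[OF c(2) d(2)]]
        by (simp add: b_def hopf_mult_def)
    qed
    finally show "tensor_lift (tensor k ?E ?E) b (tensor_lift (tensor k ?T ?T) (?p c c') (comult ?D l))
      = tensor_lift (tensor k ?E ?E)
      (\<lambda>d d'. pure_tensor k ?E ?E (mul x y z c d) (mul x y z c' d')) (comult ?D l)" .
  qed
  finally show ?thesis by (simp add: tensor_mult_def)
qed

text \<open>Apply the counit of \<open>A x x\<close> to
  \<open>h\<^sub>1 S(h\<^sub>2) = \<epsilon>(h) 1\<close>; multiplicativity and the left counit law
  collapse the left side to \<open>\<epsilon>(S(h))\<close>.\<close>

lemma counit_antipode:
  assumes "x \<in> X" "y \<in> X" "h \<in> carrier (A x y)"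
  shows "counit (A y x) (S x y h) = counit (A x y) h"
proof -
  interpret C: coalgebra k "A x y" by (rule hom_coalgebra[OF assms(1,2)])
  interpret D: coalgebra k "A y x" by (rule hom_coalgebra[OF assms(2,1)])
  interpret E: coalgebra k "A x x" by (rule hom_coalgebra[OF assms(1,1)])
  note K = base_module_module[OF is_cring]
  note S = antipode_linear[OF assms(1,2)]
  have eS: "(\<lambda>u. counit (A y x) (S x y u)) \<in> linear_maps k (A x y) (base_module k)"
    using linear_maps_comp[OF D.counit_linear S] .
  have b: "(\<lambda>a b. mul x y x a (S x y b)) \<in> bilinear_maps k (A x y) (A x y) (A x x)"
    using bilinear_maps_comp[OF mul_bilinear[OF assms(1,2,1)] linear_maps_id S] .
  have b': "(\<lambda>u v. counit (A x y) u \<odot>\<^bsub>A x y\<^esub> v) \<in> bilinear_maps k (A x y) (A x y) (A x y)"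
    using bilinear_maps_comp[OF smult_bilinear[OF C.module_axioms] C.counit_linear linear_maps_id] .
  have "counit (A y x) (S x y h)
      = counit (A y x) (S x y (sweedler x y (A x y) (\<lambda>u v. counit (A x y) u \<odot>\<^bsub>A x y\<^esub> v) h))"
    using C.counit_left[OF assms(3)] by simp
  also have "\<dots> = sweedler x y (base_module k)
      (\<lambda>u v. counit (A y x) (S x y (counit (A x y) u \<odot>\<^bsub>A x y\<^esub> v))) h"
    using C.sweedler_comp[OF C.module_axioms K eS b' assms(3)] .
  also have "\<dots> = sweedler x y (base_module k) (\<lambda>u v. counit (A x x) (mul x y x u (S x y v))) h"
    using assms(1,2) by (intro C.sweedler_cong[OF assms(3)])
      (simp add: linear_mapsD(3)[OF eS] C.counit_closed counit_mul linear_mapsD(1)[OF S])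
  also have "\<dots> = counit (A x x) (counit (A x y) h \<odot>\<^bsub>A x x\<^esub> \<eta> x \<one>)"
    using C.sweedler_comp[OF E.module_axioms K E.counit_linear b assms(3)] antipode_right[OF assms]
    by simp
  also have "\<dots> = counit (A x y) h"
    using assms by (simp add: linear_mapsD(3)[OF E.counit_linear] C.counit_closed unit_closed counit_unit)
  finally show ?thesis .
qed

text \<open>The comultiplication of \<open>A y y\<close>, applied to
  \<open>S(h\<^sub>1) h\<^sub>2 = \<epsilon>(h) 1\<close>, shows that \<open>\<Delta> S\<close> is a
  left convolution inverse of \<open>\<Delta>\<close>.\<close>

lemma comult_convolution_antipode:
  assumes "x \<in> X" "y \<in> X" "h \<in> carrier (A x y)"
  shows "sweedler x y (tensor k (A y y) (A y y))
      (\<lambda>u v. tensor_mult k (A y y) (mul y x y) (comult (A y x) (S x y u)) (comult (A x y) v)) h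
    = counit (A x y) h \<odot>\<^bsub>tensor k (A y y) (A y y)\<^esub> pure_tensor k (A y y) (A y y) (\<eta> y \<one>) (\<eta> y \<one>)"
proof -
  interpret C: coalgebra k "A x y" by (rule hom_coalgebra[OF assms(1,2)])
  interpret E: coalgebra k "A y y" by (rule hom_coalgebra[OF assms(2,2)])
  let ?R = "tensor k (A y y) (A y y)"
  note R = tensor_module[OF E.module_axioms E.module_axioms]
  note S = antipode_linear[OF assms(1,2)]
  have b: "(\<lambda>u v. mul y x y (S x y u) v) \<in> bilinear_maps k (A x y) (A x y) (A y y)"
    using bilinear_maps_comp[OF mul_bilinear[OF assms(2,1,2)] S linear_maps_id] .
  have "sweedler x y ?R
      (\<lambda>u v. tensor_mult k (A y y) (mul y x y) (comult (A y x) (S x y u)) (comult (A x y) v)) h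
    = sweedler x y ?R (\<lambda>u v. comult (A y y) (mul y x y (S x y u) v)) h"
    using assms(1,2) by (intro C.sweedler_cong[OF assms(3)])
      (simp add: comult_mul linear_mapsD(1)[OF S])
  also have "\<dots> = comult (A y y) (sweedler x y (A y y) (\<lambda>u v. mul y x y (S x y u) v) h)"
    using C.sweedler_comp[OF E.module_axioms R E.comult_linear b assms(3)] by simp
  also have "\<dots> = counit (A x y) h \<odot>\<^bsub>?R\<^esub> pure_tensor k (A y y) (A y y) (\<eta> y \<one>) (\<eta> y \<one>)"
    using assms by (simp add: antipode_left linear_mapsD(3)[OF E.comult_linear] C.counit_closed
        unit_closed comult_unit)
  finally show ?thesis .
qed

text \<open>In Sweedler notation this is
  \<open>h\<^sub>1 S(h\<^sub>4) \<otimes> h\<^sub>2 S(h\<^sub>3) = \<epsilon>(h) 1 \<otimes> 1\<close>.\<close>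

lemma comult_convolution_flipped_antipode:
  assumes "x \<in> X" "y \<in> X" "h \<in> carrier (A x y)"
  shows "sweedler x y (tensor k (A x x) (A x x))
      (\<lambda>u v. tensor_mult k (A x x) (mul x y x) (comult (A x y) u)
        (sweedler x y (tensor k (A y x) (A y x)) (\<lambda>a b. pure_tensor k (A y x) (A y x) (S x y b) (S x y a)) v)) h
    = counit (A x y) h \<odot>\<^bsub>tensor k (A x x) (A x x)\<^esub> pure_tensor k (A x x) (A x x) (\<eta> x \<one>) (\<eta> x \<one>)"
proof -
  let ?C = "A x y" and ?D = "A y x" and ?E = "A x x"
  interpret C: coalgebra k ?C by (rule hom_coalgebra[OF assms(1,2)])
  note C = C.module_axioms and D = hom_module[OF assms(2,1)] and E = hom_module[OF assms(1,1)]
  let ?P = "tensor k ?D ?D" and ?R = "tensor k ?E ?E"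
  let ?m = "mul x y x" and ?S = "S x y" and ?pure = "pure_tensor k ?E ?E" and ?one = "\<eta> x \<one>"
  note P = tensor_module[OF D D] and R = tensor_module[OF E E]
  note S = antipode_linear[OF assms(1,2)]
  note clS = linear_mapsD(1)[OF S]
  note m = mul_bilinear[OF assms(1,2,1)]
  note pure = pure_tensor_bilinear[OF E E]
  note one = unit_closed[OF assms(1)]
  have mS: "(\<lambda>a b. ?m a (?S b)) \<in> bilinear_maps k ?C ?C ?E"
    using bilinear_maps_comp[OF m linear_maps_id S] .
  note clmS = bilinear_mapsD(1)[OF mS]
  let ?F = "\<lambda>v. sweedler x y ?P (\<lambda>a b. pure_tensor k ?D ?D (?S b) (?S a)) v"
  have SS: "(\<lambda>a b. pure_tensor k ?D ?D (?S b) (?S a)) \<in> bilinear_maps k ?C ?C ?P"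
    using bilinear_maps_swap[OF tensor_map_bilinear[OF D D S S]] .
  have F: "?F \<in> linear_maps k ?C ?P"
    using C.sweedler_linear[OF P SS] .
  note clF = linear_mapsD(1)[OF F]
  have tm: "tensor_mult k ?E ?m \<in> bilinear_maps k (tensor k ?C ?C) ?P ?R"
    using tensor_mult_bilinear[OF C D E m] .
  note q = quadrilinear_mult[OF pure m m]
  \<comment> \<open>In Sweedler notation \<open>t a b v\<close> is
    \<open>a S(v\<^sub>2) \<otimes> b S(v\<^sub>1)\<close>, as \<open>t_eq\<close> makes explicit.
    Going through \<open>?F\<close> keeps it visibly linear in \<open>v\<close>.\<close>
  define t where "t = (\<lambda>a b v. tensor_lift ?R (\<lambda>d d'. ?pure (?m a d) (?m b d')) (?F v))"
  have t: "t \<in> trilinear_maps k ?C ?C ?C ?R"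
  proof (rule trilinear_mapsI)
    show "t a b \<in> linear_maps k ?C ?R" if "a \<in> carrier ?C" "b \<in> carrier ?C" for a b
      unfolding t_def
      using linear_maps_comp[OF tensor_lift_linear[OF D D R quadrilinear_mapsD(1)[OF q that]] F] .
    show "(\<lambda>b. t a b v) \<in> linear_maps k ?C ?R" "(\<lambda>b. t b a v) \<in> linear_maps k ?C ?R"
      if "a \<in> carrier ?C" "v \<in> carrier ?C" for a v
      unfolding t_def
      using bilinear_maps_linear[OF quadrilinear_lift_inner[OF C C D D R q clF[OF that(2)]]] that(1)
      by simp_all
  qed
  have t_eq: "t a b v = sweedler x y ?R (\<lambda>c d. ?pure (?m a (?S d)) (?m b (?S c))) v"
    if "a \<in> carrier ?C" "b \<in> carrier ?C" "v \<in> carrier ?C" for a b v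
  proof -
    note qab = quadrilinear_mapsD(1)[OF q that(1,2)]
    have "t a b v = sweedler x y ?R (\<lambda>c d. tensor_lift ?R (\<lambda>d d'. ?pure (?m a d) (?m b d'))
        (pure_tensor k ?D ?D (?S d) (?S c))) v"
      unfolding t_def using C.sweedler_comp[OF P R tensor_lift_linear[OF D D R qab] SS that(3)] .
    also have "\<dots> = sweedler x y ?R (\<lambda>c d. ?pure (?m a (?S d)) (?m b (?S c))) v"
      by (rule C.sweedler_cong[OF that(3)]) (rule tensor_lift_pure[OF D D R qab clS clS])
    finally show ?thesis .
  qed
  have "sweedler x y ?R (\<lambda>u v. tensor_mult k ?E ?m (comult ?C u) (?F v)) h
      = sweedler x y ?R (\<lambda>u v. sweedler x y ?R (\<lambda>a b. t a b v) u) h"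
    by (simp add: tensor_mult_def t_def)
  \<comment> \<open>The first of the four legs is detached as \<open>u\<close>; the other three stay
    together in \<open>v\<close>.\<close>
  also have "\<dots> = sweedler x y ?R (\<lambda>u v. sweedler x y ?R (t u) v) h"
    by (rule C.sweedler_coassoc[OF R t assms(3)])
  also have "\<dots> = sweedler x y ?R (\<lambda>u v. ?pure (?m u (?S v)) ?one) h"
  proof (rule C.sweedler_cong[OF assms(3)])
    fix u v assume u: "u \<in> carrier ?C" and v: "v \<in> carrier ?C"
    define r where "r = (\<lambda>b c d. ?pure (?m u (?S d)) (?m b (?S c)))"
    have muS: "(\<lambda>d. ?m u (?S d)) \<in> linear_maps k ?C ?E"
      using bilinear_maps_linear(1)[OF mS u] .
    have r: "r \<in> trilinear_maps k ?C ?C ?C ?R"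
      unfolding r_def
    proof (rule trilinear_mapsI)
      show "(\<lambda>d. ?pure (?m u (?S d)) (?m b (?S c))) \<in> linear_maps k ?C ?R"
        if "b \<in> carrier ?C" "c \<in> carrier ?C" for b c
        using linear_maps_comp[OF bilinear_maps_linear(2)[OF pure clmS[OF that]] muS] .
      show "(\<lambda>c. ?pure (?m u (?S d)) (?m b (?S c))) \<in> linear_maps k ?C ?R"
        if "b \<in> carrier ?C" "d \<in> carrier ?C" for b d
        using linear_maps_comp[OF bilinear_maps_linear(1)[OF pure clmS[OF u that(2)]]
            bilinear_maps_linear(1)[OF mS that(1)]] .
      show "(\<lambda>b. ?pure (?m u (?S d)) (?m b (?S c))) \<in> linear_maps k ?C ?R"
        if "c \<in> carrier ?C" "d \<in> carrier ?C" for c d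
        using linear_maps_comp[OF bilinear_maps_linear(1)[OF pure clmS[OF u that(2)]]
            bilinear_maps_linear(2)[OF mS that(1)]] .
    qed
    have "sweedler x y ?R (t u) v = sweedler x y ?R (\<lambda>b w. sweedler x y ?R (r b) w) v"
      by (rule C.sweedler_cong[OF v]) (simp add: t_eq[OF u] r_def)
    \<comment> \<open>A second rebracketing makes the two middle legs adjacent inside
      \<open>w\<close>, where the antipode axiom turns them into \<open>\<epsilon>(w) 1\<close>. The
      scalar is then carried across the tensor sign and absorbed into \<open>d\<close>, ready for
      the counit law.\<close>
    also have "\<dots> = sweedler x y ?R (\<lambda>w d. sweedler x y ?R (\<lambda>b c. r b c d) w) v"
      by (rule C.sweedler_coassoc[OF R r v, symmetric])
    also have "\<dots> = sweedler x y ?R (\<lambda>w d. ?pure (?m u (?S (counit ?C w \<odot>\<^bsub>?C\<^esub> d))) ?one) v"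
    proof (rule C.sweedler_cong[OF v])
      fix w d assume w: "w \<in> carrier ?C" and d: "d \<in> carrier ?C"
      have "sweedler x y ?R (\<lambda>b c. r b c d) w
          = ?pure (?m u (?S d)) (sweedler x y ?E (\<lambda>b c. ?m b (?S c)) w)"
        unfolding r_def
        by (rule C.sweedler_comp[OF E R bilinear_maps_linear(1)[OF pure clmS[OF u d]] mS w, symmetric])
      also have "\<dots> = ?pure (?m u (?S d)) (counit ?C w \<odot>\<^bsub>?E\<^esub> ?one)"
        by (simp add: antipode_right[OF assms(1,2) w])
      also have "\<dots> = ?pure (?m u (?S (counit ?C w \<odot>\<^bsub>?C\<^esub> d))) ?one"
        using C.counit_closed[OF w] clmS[OF u d] one d
        by (simp add: linear_mapsD(3)[OF muS] bilinear_mapsD(4,5)[OF pure])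
      finally show "sweedler x y ?R (\<lambda>b c. r b c d) w
          = ?pure (?m u (?S (counit ?C w \<odot>\<^bsub>?C\<^esub> d))) ?one" .
    qed
    also have "\<dots> = ?pure (?m u (?S (sweedler x y ?C (\<lambda>w d. counit ?C w \<odot>\<^bsub>?C\<^esub> d) v))) ?one"
      by (rule C.sweedler_comp[OF C R linear_maps_comp[OF bilinear_maps_linear(2)[OF pure one] muS]
            bilinear_maps_comp[OF smult_bilinear[OF C] C.counit_linear linear_maps_id] v, symmetric])
    also have "\<dots> = ?pure (?m u (?S v)) ?one"
      using C.counit_left[OF v] by simp
    finally show "sweedler x y ?R (t u) v = ?pure (?m u (?S v)) ?one" .
  qed
  also have "\<dots> = ?pure (sweedler x y ?E (\<lambda>u v. ?m u (?S v)) h) ?one"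
    by (rule C.sweedler_comp[OF E R bilinear_maps_linear(2)[OF pure one] mS assms(3), symmetric])
  also have "\<dots> = ?pure (counit ?C h \<odot>\<^bsub>?E\<^esub> ?one) ?one"
    by (simp add: antipode_right[OF assms])
  also have "\<dots> = counit ?C h \<odot>\<^bsub>?R\<^esub> ?pure ?one ?one"
    using C.counit_closed[OF assms(3)] one by (simp add: bilinear_mapsD(4)[OF pure])
  finally show ?thesis .
qed

text \<open>Both sides are convolution inverses of \<open>\<Delta>\<close> in the tensor squares,
  \<open>\<Delta> S\<close> on the left and the flipped \<open>S \<otimes> S\<close> after
  \<open>\<Delta>\<close> on the right; uniqueness with \<open>I = {}\<close> gives
  equality.\<close>

lemma comult_antipode:
  assumes x: "x \<in> X" and y: "y \<in> X" and h: "h \<in> carrier (A x y)"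
  shows "comult (A y x) (S x y h) = sweedler x y (tensor k (A y x) (A y x))
    (\<lambda>u v. pure_tensor k (A y x) (A y x) (S x y v) (S x y u)) h"
proof -
  interpret C: coalgebra k "A x y" by (rule hom_coalgebra[OF x y])
  interpret D: coalgebra k "A y x" by (rule hom_coalgebra[OF y x])
  note mods = hom_module[OF x y] hom_module[OF y x] hom_module[OF x x] hom_module[OF y y]
  note tens = tensor_module[OF mods(1,1)] tensor_module[OF mods(2,2)]
    tensor_module[OF mods(3,3)] tensor_module[OF mods(4,4)]
  interpret P: module k "tensor k (A y x) (A y x)" by (rule tens(2))
  note S = antipode_linear[OF x y]
  have f: "(\<lambda>h. comult (A y x) (S x y h)) \<in> linear_maps k (A x y) (tensor k (A y x) (A y x))"
    using linear_maps_comp[OF D.comult_linear S] .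
  have f': "sweedler x y (tensor k (A y x) (A y x))
      (\<lambda>u v. pure_tensor k (A y x) (A y x) (S x y v) (S x y u))
      \<in> linear_maps k (A x y) (tensor k (A y x) (A y x))"
    using C.sweedler_linear[OF tens(2) bilinear_maps_swap[OF tensor_map_bilinear[OF mods(2,2) S S]]] .
  have "mcong {} (tensor k (A y x) (A y x)) (comult (A y x) (S x y h))
    (sweedler x y (tensor k (A y x) (A y x))
      (\<lambda>u v. pure_tensor k (A y x) (A y x) (S x y v) (S x y u)) h)"
  proof (rule C.convolution_inverse_unique[where
        e = "pure_tensor k (A y y) (A y y) (\<eta> y \<one>) (\<eta> y \<one>)" and
        e' = "pure_tensor k (A x x) (A x x) (\<eta> x \<one>) (\<eta> x \<one>)" and
        f = "\<lambda>h. comult (A y x) (S x y h)" and g = "comult (A x y)" and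
        f' = "sweedler x y (tensor k (A y x) (A y x))
          (\<lambda>u v. pure_tensor k (A y x) (A y x) (S x y v) (S x y u))" and
        pq = "tensor_mult k (A y y) (mul y x y)" and rp = "tensor_mult k (A y x) (mul y y x)" and
        qp = "tensor_mult k (A x x) (mul x y x)" and pr = "tensor_mult k (A y x) (mul y x x)",
        OF tens(2,1,4,3) _ f C.comult_linear f'
        tensor_mult_bilinear[OF mods(2,1,4) mul_bilinear[OF y x y]]
        tensor_mult_bilinear[OF mods(4,2,2) mul_bilinear[OF y y x]]
        tensor_mult_bilinear[OF mods(1,2,3) mul_bilinear[OF x y x]]
        tensor_mult_bilinear[OF mods(2,3,2) mul_bilinear[OF y x x]] _ _ _ _ _ _ _ h])
    show "tensor_mult k (A y x) (mul y y x) (tensor_mult k (A y y) (mul y x y) p q) p'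
      = tensor_mult k (A y x) (mul y x x) p (tensor_mult k (A x x) (mul x y x) q p')"
      if "p \<in> carrier (tensor k (A y x) (A y x))" "q \<in> carrier (tensor k (A x y) (A x y))"
        "p' \<in> carrier (tensor k (A y x) (A y x))" for p q p'
      using mods(2,1,2,4,3,2) mul_bilinear[OF y x y] mul_bilinear[OF y y x]
        mul_bilinear[OF x y x] mul_bilinear[OF y x x] _ that
      by (rule tensor_mult_assoc) (rule mult_assoc[OF y x y x])
    show "pure_tensor k (A y y) (A y y) (\<eta> y \<one>) (\<eta> y \<one>) \<in> carrier (tensor k (A y y) (A y y))"
      "pure_tensor k (A x x) (A x x) (\<eta> x \<one>) (\<eta> x \<one>) \<in> carrier (tensor k (A x x) (A x x))"
      using x y by (simp_all add: pure_tensor_closed unit_closed)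
    show "tensor_mult k (A y x) (mul y y x) (pure_tensor k (A y y) (A y y) (\<eta> y \<one>) (\<eta> y \<one>)) p = p"
      if "p \<in> carrier (tensor k (A y x) (A y x))" for p
      by (rule tensor_mult_unit_left[OF mods(2,4) mul_bilinear[OF y y x] unit_closed[OF y]
            mult_unit_left[OF y x] that])
    show "tensor_mult k (A y x) (mul y x x) p (pure_tensor k (A x x) (A x x) (\<eta> x \<one>) (\<eta> x \<one>)) = p"
      if "p \<in> carrier (tensor k (A y x) (A y x))" for p
      by (rule tensor_mult_unit_right[OF mods(2,3) mul_bilinear[OF y x x] unit_closed[OF x]
            mult_unit_right[OF y x] that])
    interpret R: module k "tensor k (A y y) (A y y)" by (rule tens(4))
    interpret R': module k "tensor k (A x x) (A x x)" by (rule tens(3))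
    show "mcong {} (tensor k (A y y) (A y y)) (sweedler x y (tensor k (A y y) (A y y))
      (\<lambda>u v. tensor_mult k (A y y) (mul y x y) (comult (A y x) (S x y u)) (comult (A x y) v)) h)
      (counit (A x y) h \<odot>\<^bsub>tensor k (A y y) (A y y)\<^esub> pure_tensor k (A y y) (A y y) (\<eta> y \<one>) (\<eta> y \<one>))"
      if "h \<in> carrier (A x y)" for h
      using that x y
      by (simp add: comult_convolution_antipode R.mcong_empty C.counit_closed pure_tensor_closed unit_closed)
    show "mcong {} (tensor k (A x x) (A x x)) (sweedler x y (tensor k (A x x) (A x x))
      (\<lambda>u v. tensor_mult k (A x x) (mul x y x) (comult (A x y) u)
        (sweedler x y (tensor k (A y x) (A y x))
          (\<lambda>a b. pure_tensor k (A y x) (A y x) (S x y b) (S x y a)) v)) h)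
      (counit (A x y) h \<odot>\<^bsub>tensor k (A x x) (A x x)\<^esub> pure_tensor k (A x x) (A x x) (\<eta> x \<one>) (\<eta> x \<one>))"
      if "h \<in> carrier (A x y)" for h
      using that x y
      by (simp add: comult_convolution_flipped_antipode R'.mcong_empty C.counit_closed
          pure_tensor_closed unit_closed)
  qed simp
  then show ?thesis by (simp add: P.mcong_empty)
qed

text \<open>The same reversal in the form used for computing: it can be substituted under any
  bilinear map, so the flipped tensor need not be handled again.\<close>

lemma sweedler_antipode:
  assumes x: "x \<in> X" and y: "y \<in> X" and h: "h \<in> carrier (A x y)"
    and P: "module k P" and b: "b \<in> bilinear_maps k (A y x) (A y x) P"
  shows "sweedler y x P b (S x y h) = sweedler x y P (\<lambda>u v. b (S x y v) (S x y u)) h"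
proof -
  interpret C: coalgebra k "A x y" by (rule hom_coalgebra[OF x y])
  note D = hom_module[OF y x]
  note S = antipode_linear[OF x y]
  have "sweedler y x P b (S x y h)
      = sweedler x y P (\<lambda>u v. tensor_lift P b (pure_tensor k (A y x) (A y x) (S x y v) (S x y u))) h"
    unfolding comult_antipode[OF x y h]
    by (rule C.sweedler_comp[OF tensor_module[OF D D] P tensor_lift_linear[OF D D P b]
          bilinear_maps_swap[OF tensor_map_bilinear[OF D D S S]] h])
  also have "\<dots> = sweedler x y P (\<lambda>u v. b (S x y v) (S x y u)) h"
    by (rule C.sweedler_cong[OF h]) (simp add: tensor_lift_pure[OF D D P b] linear_mapsD(1)[OF S])
  finally show ?thesis .
qed

end

section \<open>The bicommutant of an operator on a finitely generated module\<close>

context module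
begin

lemma submodule_image:
  assumes "module R L" "f \<in> linear_maps R L M"
  shows "submodule (f ` carrier L) R M"
proof -
  interpret L: module R L by fact
  note f = linear_mapsD[OF assms(2)]
  show ?thesis
  proof (rule submoduleI)
    show "f ` carrier L \<subseteq> carrier M" using f(1) by auto
    show "\<zero>\<^bsub>M\<^esub> \<in> f ` carrier L"
      using linear_maps_zero[OF assms(1) module_axioms assms(2)] by (metis L.zero_closed imageI)
    show smult: "r \<odot>\<^bsub>M\<^esub> a \<in> f ` carrier L" if r: "r \<in> carrier R" and "a \<in> f ` carrier L" for r a
    proof -
      obtain u where u: "u \<in> carrier L" "a = f u" using \<open>a \<in> f ` carrier L\<close> by auto
      have "r \<odot>\<^bsub>M\<^esub> a = f (r \<odot>\<^bsub>L\<^esub> u)" using r u f(3) by simp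
      then show ?thesis using r u by auto
    qed
    show "\<ominus>\<^bsub>M\<^esub> a \<in> f ` carrier L" if "a \<in> f ` carrier L" for a
      using smult[OF R.a_inv_closed[OF R.one_closed] that] that f(1) by (auto simp: smult_l_minus)
    show "a \<oplus>\<^bsub>M\<^esub> b \<in> f ` carrier L" if "a \<in> f ` carrier L" "b \<in> f ` carrier L" for a b
    proof -
      obtain u v where "u \<in> carrier L" "v \<in> carrier L" "a = f u" "b = f v" using \<open>a \<in> _\<close> \<open>b \<in> _\<close> by auto
      then show ?thesis using f(2)[of u v] L.a_closed[of u v] by (metis imageI)
    qed
  qed
qed

lemma submodule_zero: "submodule H R M \<Longrightarrow> \<zero>\<^bsub>M\<^esub> \<in> H"
  using subgroup.one_closed[OF submodule.axioms(1), of H R M] by simp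

lemma submodule_minus:
  assumes "submodule H R M" "a \<in> H" "b \<in> H"
  shows "a \<ominus>\<^bsub>M\<^esub> b \<in> H"
  using submoduleE(3,5)[OF assms(1)] assms(2,3) by (simp add: M.minus_eq)

lemma submodule_ideal_mult:
  assumes "I \<subseteq> carrier R"
  shows "submodule (ideal_mult I M) R M"
proof (rule submoduleI)
  show "ideal_mult I M \<subseteq> carrier M" using ideal_mult_closed[OF assms] by blast
  show "\<zero>\<^bsub>M\<^esub> \<in> ideal_mult I M" by (rule ideal_mult.zero)
  show "a \<oplus>\<^bsub>M\<^esub> b \<in> ideal_mult I M" if "a \<in> ideal_mult I M" "b \<in> ideal_mult I M" for a b
    using ideal_mult_add[OF assms that] .
  show smult: "r \<odot>\<^bsub>M\<^esub> a \<in> ideal_mult I M" if "r \<in> carrier R" "a \<in> ideal_mult I M" for r a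
    using linear_maps_ideal_mult[OF module_axioms module_axioms assms
        linear_maps_smult[OF module_axioms that(1) linear_maps_id] that(2)] .
  show "\<ominus>\<^bsub>M\<^esub> a \<in> ideal_mult I M" if "a \<in> ideal_mult I M" for a
    using smult[OF R.a_inv_closed[OF R.one_closed] that] that ideal_mult_closed[OF assms]
    by (simp add: smult_l_minus)
qed

text \<open>Generation of \<open>M\<close> by \<open>G\<close> modulo \<open>N\<close>, phrased
  through the submodules containing both. In the inductions on \<open>G\<close> a generator moves
  from \<open>G\<close> into an enlarged \<open>N\<close>, and this form makes the exchange
  immediate.\<close>

definition generates
  where "generates N G \<longleftrightarrow>
    G \<subseteq> carrier M \<and> (\<forall>N'. submodule N' R M \<longrightarrow> N \<subseteq> N' \<longrightarrow> G \<subseteq> N' \<longrightarrow> N' = carrier M)"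

lemma finitely_generated_generates:
  assumes "finitely_generated R M"
  obtains G where "finite G" "\<And>N. generates N G"
proof -
  obtain G where G: "finite G" "G \<subseteq> carrier M"
    and gen: "\<And>m. m \<in> carrier M \<Longrightarrow> \<exists>c\<in>G \<rightarrow> carrier R. m = (\<Oplus>\<^bsub>M\<^esub>g\<in>G. c g \<odot>\<^bsub>M\<^esub> g)"
    using assms unfolding finitely_generated_def by blast
  have "N' = carrier M" if N': "submodule N' R M" and "G \<subseteq> N'" for N'
  proof -
    note sub = submoduleE[OF N']
    have "(\<Oplus>\<^bsub>M\<^esub>g\<in>F. c g \<odot>\<^bsub>M\<^esub> g) \<in> N'" if "F \<subseteq> G" "c \<in> G \<rightarrow> carrier R" for F c
      using finite_subset[OF that(1) G(1)] that
    proof (induction F)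
      case empty
      then show ?case using submodule_zero[OF N'] by simp
    next
      case (insert g F)
      have mem: "c u \<odot>\<^bsub>M\<^esub> u \<in> N'" if "u \<in> insert g F" for u
        using that insert \<open>G \<subseteq> N'\<close> by (intro sub(4)) auto
      then have "(\<Oplus>\<^bsub>M\<^esub>u\<in>insert g F. c u \<odot>\<^bsub>M\<^esub> u) = c g \<odot>\<^bsub>M\<^esub> g \<oplus>\<^bsub>M\<^esub> (\<Oplus>\<^bsub>M\<^esub>u\<in>F. c u \<odot>\<^bsub>M\<^esub> u)"
        using insert sub(1) by (intro M.finsum_insert) auto
      then show ?case using insert mem sub(5) by simp
    qed
    then show ?thesis using gen sub(1) by blast
  qed
  then show thesis using G by (intro that[of G]) (simp_all add: generates_def)
qed

text \<open>Zorn's lemma. The union of a chain stays proper because a finite generating set inside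
  the union would already lie in one member of the chain.\<close>

lemma maximal_submodule:
  assumes fg: "finitely_generated R M" and N: "submodule N R M" "N \<noteq> carrier M"
  obtains K where "submodule K R M" "N \<subseteq> K" "K \<noteq> carrier M"
    "\<forall>K'. submodule K' R M \<longrightarrow> K \<subseteq> K' \<longrightarrow> K' \<noteq> carrier M \<longrightarrow> K' = K"
proof -
  obtain G where G: "finite G" "\<And>N. generates N G"
    using finitely_generated_generates[OF fg] by blast
  let ?F = "{K. submodule K R M \<and> N \<subseteq> K \<and> K \<noteq> carrier M}"
  have "\<exists>K\<in>?F. \<forall>K'\<in>?F. K \<subseteq> K' \<longrightarrow> K' = K"
  proof (rule subset_Zorn_nonempty)
    show "?F \<noteq> {}" using N by blast
    fix \<C> assume ne: "\<C> \<noteq> {}" and chain: "subset.chain ?F \<C>"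
    have mem: "submodule K R M" "N \<subseteq> K" "K \<noteq> carrier M" if "K \<in> \<C>" for K
      using chain that by (auto simp: subset.chain_def)
    have "submodule (\<Union>\<C>) R M"
    proof (rule submoduleI)
      note sub = submoduleE[OF mem(1)]
      show "\<Union>\<C> \<subseteq> carrier M" using sub(1) by blast
      show "\<zero>\<^bsub>M\<^esub> \<in> \<Union>\<C>" using ne submodule_zero[OF mem(1)] by blast
      show "\<ominus>\<^bsub>M\<^esub> a \<in> \<Union>\<C>" if "a \<in> \<Union>\<C>" for a
        using that sub(3) by blast
      show "r \<odot>\<^bsub>M\<^esub> a \<in> \<Union>\<C>" if "r \<in> carrier R" "a \<in> \<Union>\<C>" for r a
        using that sub(4) by blast
      show "a \<oplus>\<^bsub>M\<^esub> b \<in> \<Union>\<C>" if ab: "a \<in> \<Union>\<C>" "b \<in> \<Union>\<C>" for a b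
      proof -
        have "finite {a, b}" "{a, b} \<subseteq> \<Union>\<C>" using ab by auto
        then obtain K where K: "K \<in> \<C>" "{a, b} \<subseteq> K"
          using finite_subset_Union_chain[OF _ _ ne chain] by metis
        then have "a \<oplus>\<^bsub>M\<^esub> b \<in> K" using submoduleE(5)[OF mem(1)[OF K(1)]] by simp
        then show ?thesis using K(1) by blast
      qed
    qed
    moreover have "\<Union>\<C> \<noteq> carrier M"
    proof
      assume "\<Union>\<C> = carrier M"
      then have "G \<subseteq> \<Union>\<C>" using G(2) by (simp add: generates_def)
      then obtain K where K: "K \<in> \<C>" "G \<subseteq> K"
        using finite_subset_Union_chain[OF G(1) _ ne chain] by metis
      moreover have "submodule K R M" "K \<noteq> carrier M" using mem[OF K(1)] by simp_all
      ultimately show False using G(2)[of K] unfolding generates_def by blast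
    qed
    ultimately show "\<Union>\<C> \<in> ?F" using ne mem(2) by blast
  qed
  then obtain K where "submodule K R M" "N \<subseteq> K" "K \<noteq> carrier M" and
    "\<forall>K'\<in>?F. K \<subseteq> K' \<longrightarrow> K' = K" by blast
  then show thesis by (intro that[of K]) auto
qed

definition adjoin
  where "adjoin N g = (\<lambda>(n, s). n \<oplus>\<^bsub>M\<^esub> s \<odot>\<^bsub>M\<^esub> g) ` (N \<times> carrier R)"

lemma adjoinI: "n \<in> N \<Longrightarrow> s \<in> carrier R \<Longrightarrow> a = n \<oplus>\<^bsub>M\<^esub> s \<odot>\<^bsub>M\<^esub> g \<Longrightarrow> a \<in> adjoin N g"
  by (auto simp: adjoin_def)

lemma adjoinE:
  assumes "a \<in> adjoin N g"
  obtains n s where "n \<in> N" "s \<in> carrier R" "a = n \<oplus>\<^bsub>M\<^esub> s \<odot>\<^bsub>M\<^esub> g"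
  using assms by (auto simp: adjoin_def)

lemma submodule_adjoin:
  assumes N: "submodule N R M" and g: "g \<in> carrier M"
  shows "submodule (adjoin N g) R M" "N \<subseteq> adjoin N g" "g \<in> adjoin N g"
proof -
  note sub = submoduleE[OF N]
  have cl: "n \<in> carrier M" if "n \<in> N" for n using that sub(1) by blast
  show NN: "N \<subseteq> adjoin N g"
  proof
    fix n assume n: "n \<in> N"
    show "n \<in> adjoin N g" by (rule adjoinI[OF n R.zero_closed]) (simp add: g cl[OF n])
  qed
  show "g \<in> adjoin N g"
    by (rule adjoinI[OF submodule_zero[OF N] R.one_closed]) (simp add: g)
  show "submodule (adjoin N g) R M"
  proof (rule submoduleI)
    show closed: "adjoin N g \<subseteq> carrier M" using g cl by (auto elim!: adjoinE)
    show "\<zero>\<^bsub>M\<^esub> \<in> adjoin N g" using NN submodule_zero[OF N] by blast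
    show smult: "r \<odot>\<^bsub>M\<^esub> a \<in> adjoin N g" if r: "r \<in> carrier R" and "a \<in> adjoin N g" for r a
    proof -
      obtain n s where n: "n \<in> N" "s \<in> carrier R" "a = n \<oplus>\<^bsub>M\<^esub> s \<odot>\<^bsub>M\<^esub> g"
        using \<open>a \<in> adjoin N g\<close> by (rule adjoinE)
      show ?thesis
        by (rule adjoinI[OF sub(4)[OF r n(1)] R.m_closed[OF r n(2)]])
          (use r n g cl in \<open>simp add: smult_r_distr smult_assoc1\<close>)
    qed
    show "\<ominus>\<^bsub>M\<^esub> a \<in> adjoin N g" if "a \<in> adjoin N g" for a
    proof -
      have "a \<in> carrier M" using that closed by blast
      then show ?thesis
        using smult[OF R.a_inv_closed[OF R.one_closed] that] by (simp add: smult_l_minus)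
    qed
    show "a \<oplus>\<^bsub>M\<^esub> b \<in> adjoin N g" if a: "a \<in> adjoin N g" and b: "b \<in> adjoin N g" for a b
    proof -
      obtain n s where n: "n \<in> N" "s \<in> carrier R" "a = n \<oplus>\<^bsub>M\<^esub> s \<odot>\<^bsub>M\<^esub> g"
        using a by (rule adjoinE)
      obtain n' s' where n': "n' \<in> N" "s' \<in> carrier R" "b = n' \<oplus>\<^bsub>M\<^esub> s' \<odot>\<^bsub>M\<^esub> g"
        using b by (rule adjoinE)
      show ?thesis
        by (rule adjoinI[OF sub(5)[OF n(1) n'(1)] R.a_closed[OF n(2) n'(2)]])
          (use n n' g cl in \<open>simp add: smult_l_distr M.add.m_ac\<close>)
    qed
  qed
qed

text \<open>\<open>M / K\<close> is simple, so \<open>e = s a\<close>, being nonzero there,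
  generates it. Writing \<open>a = n + c e\<close> with \<open>n \<in> K\<close> gives
  \<open>(1 - c s) a \<in> K\<close>, and as every \<open>b\<close> is a multiple of
  \<open>s a\<close> modulo \<open>K\<close>, the scalar \<open>1 - c s\<close> kills the whole
  quotient. Thus \<open>c\<close> inverts \<open>s\<close> modulo the annihilator of
  \<open>M / K\<close>.\<close>

lemma maximal_submodule_scalars:
  assumes K: "submodule K R M" "K \<noteq> carrier M"
    and max: "\<forall>K'. submodule K' R M \<longrightarrow> K \<subseteq> K' \<longrightarrow> K' \<noteq> carrier M \<longrightarrow> K' = K"
    and s: "s \<in> carrier R" "a \<in> carrier M" "s \<odot>\<^bsub>M\<^esub> a \<notin> K"
  obtains c where "c \<in> carrier R" "\<forall>b\<in>carrier M. (\<one> \<ominus> c \<otimes> s) \<odot>\<^bsub>M\<^esub> b \<in> K"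
proof -
  note sub = submoduleE[OF K(1)]
  have cl: "n \<in> carrier M" if "n \<in> K" for n using that sub(1) by blast
  let ?e = "s \<odot>\<^bsub>M\<^esub> a"
  have e: "?e \<in> carrier M" using s by simp
  have gen: "b \<in> adjoin K ?e" if "b \<in> carrier M" for b
    using max submodule_adjoin[OF K(1) e] s(3) that by blast
  obtain n c where n: "n \<in> K" "c \<in> carrier R" "a = n \<oplus>\<^bsub>M\<^esub> c \<odot>\<^bsub>M\<^esub> ?e"
    using gen[OF s(2)] by (rule adjoinE)
  have c: "\<one> \<ominus> c \<otimes> s \<in> carrier R" using n s by simp
  have "(\<one> \<ominus> c \<otimes> s) \<odot>\<^bsub>M\<^esub> a = n"
  proof -
    have "(\<one> \<ominus> c \<otimes> s) \<odot>\<^bsub>M\<^esub> a = a \<oplus>\<^bsub>M\<^esub> \<ominus>\<^bsub>M\<^esub> (c \<odot>\<^bsub>M\<^esub> ?e)"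
      using n(2) s by (simp add: R.minus_eq smult_l_distr smult_l_minus smult_assoc1)
    also have "\<dots> = n"
      using n e cl[OF n(1)] by (metis M.add.inv_solve_right smult_closed s(2))
    finally show ?thesis .
  qed
  then have ca: "(\<one> \<ominus> c \<otimes> s) \<odot>\<^bsub>M\<^esub> a \<in> K" using n by simp
  have "(\<one> \<ominus> c \<otimes> s) \<odot>\<^bsub>M\<^esub> b \<in> K" if b: "b \<in> carrier M" for b
  proof -
    obtain m r where m: "m \<in> K" "r \<in> carrier R" "b = m \<oplus>\<^bsub>M\<^esub> r \<odot>\<^bsub>M\<^esub> ?e"
      using gen[OF b] by (rule adjoinE)
    have "(\<one> \<ominus> c \<otimes> s) \<odot>\<^bsub>M\<^esub> b
        = (\<one> \<ominus> c \<otimes> s) \<odot>\<^bsub>M\<^esub> m \<oplus>\<^bsub>M\<^esub> ((\<one> \<ominus> c \<otimes> s) \<otimes> (r \<otimes> s)) \<odot>\<^bsub>M\<^esub> a"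
      using m c s e cl[OF m(1)] by (simp add: smult_r_distr smult_assoc1)
    also have "(\<one> \<ominus> c \<otimes> s) \<otimes> (r \<otimes> s) = (r \<otimes> s) \<otimes> (\<one> \<ominus> c \<otimes> s)"
      using m(2) s(1) c by (simp add: R.m_comm)
    also have "\<dots> \<odot>\<^bsub>M\<^esub> a = (r \<otimes> s) \<odot>\<^bsub>M\<^esub> ((\<one> \<ominus> c \<otimes> s) \<odot>\<^bsub>M\<^esub> a)"
      using m(2) s c by (intro smult_assoc1) simp_all
    finally show ?thesis
      using ca m s c sub(4,5) by simp
  qed
  then show thesis using that n(2) by blast
qed

end

section \<open>The commutative algebra of operators attached to \<open>T\<close>\<close>

locale linear_operator = module R M for R (structure) and M (structure) +
  fixes T
  assumes T_linear: "T \<in> linear_maps R M M"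
begin

text \<open>Plays the part of the polynomials in \<open>T\<close>: it contains \<open>T\<close> and
  the scalars, is closed under sums and composition, and is commutative, while membership can be
  checked without exhibiting coefficients.\<close>

definition bicommutant
  where "bicommutant = {r \<in> linear_maps R M M. \<forall>s\<in>linear_maps R M M.
    (\<forall>u\<in>carrier M. s (T u) = T (s u)) \<longrightarrow> (\<forall>u\<in>carrier M. r (s u) = s (r u))}"

lemma bicommutantI:
  assumes "r \<in> linear_maps R M M"
    and "\<And>s u. s \<in> linear_maps R M M \<Longrightarrow> (\<And>u. u \<in> carrier M \<Longrightarrow> s (T u) = T (s u)) \<Longrightarrow>
      u \<in> carrier M \<Longrightarrow> r (s u) = s (r u)"
  shows "r \<in> bicommutant"
  using assms by (simp add: bicommutant_def)

lemma bicommutant_linear: "r \<in> bicommutant \<Longrightarrow> r \<in> linear_maps R M M"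
  by (simp add: bicommutant_def)

lemma bicommutantD:
  assumes "r \<in> bicommutant" "s \<in> linear_maps R M M"
    and "\<And>u. u \<in> carrier M \<Longrightarrow> s (T u) = T (s u)" "u \<in> carrier M"
  shows "r (s u) = s (r u)"
  using assms by (simp add: bicommutant_def)

lemmas bicommutant_closed = linear_mapsD(1)[OF bicommutant_linear]
  and bicommutant_add = linear_mapsD(2)[OF bicommutant_linear]
  and bicommutant_smult = linear_mapsD(3)[OF bicommutant_linear]

lemma bicommutant_T: "r \<in> bicommutant \<Longrightarrow> u \<in> carrier M \<Longrightarrow> r (T u) = T (r u)"
  by (rule bicommutantD[OF _ T_linear HOL.refl])

text \<open>\<open>T\<close> commutes with itself, so every \<open>s\<close> in the bicommutant
  commutes with \<open>T\<close>; hence \<open>s\<close> is among the operators with which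
  \<open>r\<close> has to commute.\<close>

lemma bicommutant_commute:
  "r \<in> bicommutant \<Longrightarrow> s \<in> bicommutant \<Longrightarrow> u \<in> carrier M \<Longrightarrow> r (s u) = s (r u)"
  by (rule bicommutantD[OF _ bicommutant_linear]) (simp_all add: bicommutant_T)

lemma T_bicommutant: "T \<in> bicommutant"
  by (rule bicommutantI[OF T_linear]) simp

lemma id_bicommutant: "(\<lambda>u. u) \<in> bicommutant"
  by (rule bicommutantI[OF linear_maps_id]) simp

lemma zero_bicommutant: "(\<lambda>u. \<zero>\<^bsub>M\<^esub>) \<in> bicommutant"
  by (rule bicommutantI[OF linear_maps_const_zero[OF module_axioms]])
    (simp add: linear_maps_zero[OF module_axioms module_axioms])

lemma comp_bicommutant:
  assumes "r \<in> bicommutant" "s \<in> bicommutant"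
  shows "(\<lambda>u. r (s u)) \<in> bicommutant"
proof (rule bicommutantI[OF linear_maps_comp[OF assms[THEN bicommutant_linear]]])
  fix f u assume f: "f \<in> linear_maps R M M" "\<And>u. u \<in> carrier M \<Longrightarrow> f (T u) = T (f u)" "u \<in> carrier M"
  have "r (s (f u)) = r (f (s u))" using bicommutantD[OF assms(2) f] by simp
  also have "\<dots> = f (r (s u))"
    using bicommutantD[OF assms(1) f(1,2) bicommutant_closed[OF assms(2) f(3)]] .
  finally show "r (s (f u)) = f (r (s u))" .
qed

lemma add_bicommutant:
  assumes "r \<in> bicommutant" "s \<in> bicommutant"
  shows "(\<lambda>u. r u \<oplus>\<^bsub>M\<^esub> s u) \<in> bicommutant"
proof (rule bicommutantI[OF linear_maps_add[OF module_axioms assms[THEN bicommutant_linear]]])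
  fix f u assume f: "f \<in> linear_maps R M M" "\<And>u. u \<in> carrier M \<Longrightarrow> f (T u) = T (f u)" "u \<in> carrier M"
  show "r (f u) \<oplus>\<^bsub>M\<^esub> s (f u) = f (r u \<oplus>\<^bsub>M\<^esub> s u)"
    using bicommutantD[OF assms(1) f] bicommutantD[OF assms(2) f] linear_mapsD(2)[OF f(1)]
      bicommutant_closed[OF assms(1) f(3)] bicommutant_closed[OF assms(2) f(3)] by simp
qed

lemma smult_bicommutant:
  assumes "c \<in> carrier R" "r \<in> bicommutant"
  shows "(\<lambda>u. c \<odot>\<^bsub>M\<^esub> r u) \<in> bicommutant"
proof (rule bicommutantI[OF linear_maps_smult[OF module_axioms assms(1) bicommutant_linear[OF assms(2)]]])
  fix f u assume f: "f \<in> linear_maps R M M" "\<And>u. u \<in> carrier M \<Longrightarrow> f (T u) = T (f u)" "u \<in> carrier M"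
  show "c \<odot>\<^bsub>M\<^esub> r (f u) = f (c \<odot>\<^bsub>M\<^esub> r u)"
    using bicommutantD[OF assms(2) f] linear_mapsD(3)[OF f(1) assms(1)]
      bicommutant_closed[OF assms(2) f(3)] by simp
qed

lemma diff_bicommutant:
  assumes "r \<in> bicommutant" "s \<in> bicommutant"
  shows "(\<lambda>u. r u \<ominus>\<^bsub>M\<^esub> s u) \<in> bicommutant"
proof -
  have eq: "r u \<oplus>\<^bsub>M\<^esub> (\<ominus> \<one>) \<odot>\<^bsub>M\<^esub> s u = r u \<ominus>\<^bsub>M\<^esub> s u" if "u \<in> carrier M" for u
    using bicommutant_closed[OF assms(2) that] by (simp add: M.minus_eq smult_l_minus)
  have mem: "(\<lambda>u. r u \<oplus>\<^bsub>M\<^esub> (\<ominus> \<one>) \<odot>\<^bsub>M\<^esub> s u) \<in> bicommutant"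
    using assms by (intro add_bicommutant smult_bicommutant) simp_all
  show ?thesis
  proof (rule bicommutantI)
    show "(\<lambda>u. r u \<ominus>\<^bsub>M\<^esub> s u) \<in> linear_maps R M M"
      using iffD1[OF linear_maps_cong[OF module_axioms eq] bicommutant_linear[OF mem]] .
    fix f u assume f: "f \<in> linear_maps R M M" "\<And>u. u \<in> carrier M \<Longrightarrow> f (T u) = T (f u)" "u \<in> carrier M"
    show "r (f u) \<ominus>\<^bsub>M\<^esub> s (f u) = f (r u \<ominus>\<^bsub>M\<^esub> s u)"
      using bicommutantD[OF mem f] eq[OF f(3)] eq[OF linear_mapsD(1)[OF f(1,3)]] by simp
  qed
qed

lemma funpow_bicommutant: "r \<in> bicommutant \<Longrightarrow> r ^^ n \<in> bicommutant"
proof (induction n)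
  case 0
  then show ?case using id_bicommutant by (simp add: id_def)
next
  case (Suc n)
  then show ?case using comp_bicommutant[of r "r ^^ n"] by (simp add: comp_def)
qed

lemmas T_power_bicommutant = funpow_bicommutant[OF T_bicommutant]

text \<open>The operators of the form \<open>1 - T r\<close>.\<close>

definition one_mod_T
  where "one_mod_T = {\<phi> \<in> bicommutant. \<exists>r\<in>bicommutant. \<forall>a\<in>carrier M. \<phi> a \<oplus>\<^bsub>M\<^esub> T (r a) = a}"

lemma one_mod_T_bicommutant: "\<phi> \<in> one_mod_T \<Longrightarrow> \<phi> \<in> bicommutant"
  by (simp add: one_mod_T_def)

lemma one_mod_TI:
  assumes "\<phi> \<in> bicommutant" "r \<in> bicommutant" "\<And>a. a \<in> carrier M \<Longrightarrow> \<phi> a \<oplus>\<^bsub>M\<^esub> T (r a) = a"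
  shows "\<phi> \<in> one_mod_T"
  using assms by (auto simp: one_mod_T_def)

lemma one_mod_TE:
  assumes "\<phi> \<in> one_mod_T"
  obtains r where "r \<in> bicommutant" "\<And>a. a \<in> carrier M \<Longrightarrow> \<phi> a \<oplus>\<^bsub>M\<^esub> T (r a) = a"
  using assms by (auto simp: one_mod_T_def)

lemma id_one_mod_T: "(\<lambda>u. u) \<in> one_mod_T"
  by (rule one_mod_TI[OF id_bicommutant zero_bicommutant])
    (simp add: linear_maps_zero[OF module_axioms module_axioms T_linear])

text \<open>The witness comes from \<open>1 - \<phi> \<psi> = (1 - \<phi>) \<psi> + (1 - \<psi>) = T
  (r \<psi> + s)\<close>.\<close>

lemma comp_one_mod_T:
  assumes "\<phi> \<in> one_mod_T" "\<psi> \<in> one_mod_T"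
  shows "(\<lambda>u. \<phi> (\<psi> u)) \<in> one_mod_T"
proof -
  obtain r where r: "r \<in> bicommutant" "\<And>a. a \<in> carrier M \<Longrightarrow> \<phi> a \<oplus>\<^bsub>M\<^esub> T (r a) = a"
    using assms(1) by (rule one_mod_TE) blast
  obtain s where s: "s \<in> bicommutant" "\<And>a. a \<in> carrier M \<Longrightarrow> \<psi> a \<oplus>\<^bsub>M\<^esub> T (s a) = a"
    using assms(2) by (rule one_mod_TE) blast
  note B = one_mod_T_bicommutant[OF assms(1)] one_mod_T_bicommutant[OF assms(2)]
  show ?thesis
  proof (rule one_mod_TI[OF comp_bicommutant[OF B] add_bicommutant[OF comp_bicommutant[OF r(1) B(2)] s(1)]])
    fix a assume a: "a \<in> carrier M"
    note cl = bicommutant_closed[OF B(2) a] bicommutant_closed[OF s(1) a]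
    have "\<phi> (\<psi> a) \<oplus>\<^bsub>M\<^esub> T (r (\<psi> a) \<oplus>\<^bsub>M\<^esub> s a) = (\<phi> (\<psi> a) \<oplus>\<^bsub>M\<^esub> T (r (\<psi> a))) \<oplus>\<^bsub>M\<^esub> T (s a)"
      using cl by (simp add: linear_mapsD[OF T_linear] bicommutant_closed[OF B(1)]
          bicommutant_closed[OF r(1)] M.a_assoc)
    also have "\<dots> = a" using r(2)[OF cl(1)] s(2)[OF a] by simp
    finally show "\<phi> (\<psi> a) \<oplus>\<^bsub>M\<^esub> T (r (\<psi> a) \<oplus>\<^bsub>M\<^esub> s a) = a" .
  qed
qed

lemma diff_one_mod_T:
  assumes "\<phi> \<in> one_mod_T" "s \<in> bicommutant"
  shows "(\<lambda>u. \<phi> u \<ominus>\<^bsub>M\<^esub> T (s u)) \<in> one_mod_T"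
proof -
  obtain r where r: "r \<in> bicommutant" "\<And>a. a \<in> carrier M \<Longrightarrow> \<phi> a \<oplus>\<^bsub>M\<^esub> T (r a) = a"
    using assms(1) by (rule one_mod_TE) blast
  note B = one_mod_T_bicommutant[OF assms(1)]
  show ?thesis
  proof (rule one_mod_TI[OF diff_bicommutant[OF B comp_bicommutant[OF T_bicommutant assms(2)]]
        add_bicommutant[OF assms(2) r(1)]])
    fix a assume a: "a \<in> carrier M"
    note cl = bicommutant_closed[OF B a] bicommutant_closed[OF assms(2) a] bicommutant_closed[OF r(1) a]
    note clT = cl[THEN linear_mapsD(1)[OF T_linear]]
    have "\<phi> a \<ominus>\<^bsub>M\<^esub> T (s a) \<oplus>\<^bsub>M\<^esub> T (s a \<oplus>\<^bsub>M\<^esub> r a)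
        = \<phi> a \<oplus>\<^bsub>M\<^esub> (\<ominus>\<^bsub>M\<^esub> T (s a) \<oplus>\<^bsub>M\<^esub> (T (s a) \<oplus>\<^bsub>M\<^esub> T (r a)))"
      using cl clT by (simp add: linear_mapsD(2)[OF T_linear] M.minus_eq M.a_assoc)
    also have "\<dots> = a"
      using r(2)[OF a] clT by (simp add: M.r_neg1)
    finally show "\<phi> a \<ominus>\<^bsub>M\<^esub> T (s a) \<oplus>\<^bsub>M\<^esub> T (s a \<oplus>\<^bsub>M\<^esub> r a) = a" .
  qed
qed

text \<open>Nakayama's lemma for the ideal generated by \<open>T\<close> in its bicommutant, by induction on the number
  of generators instead of a determinant.\<close>

lemma surjective_imp_injective:
  assumes fg: "finitely_generated R M" and surj: "T ` carrier M = carrier M"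
  shows "inj_on T (carrier M)"
proof -
  have Tcl: "T a \<in> carrier M" if "a \<in> carrier M" for a using linear_mapsD(1)[OF T_linear that] .
  \<comment> \<open>The submodule \<open>N\<close> is kept arbitrary, so that a generator can be
    removed at the price of enlarging \<open>N\<close>, and stable under the bicommutant, so that
    the enlargement may use all operator multiples of the generator.\<close>
  have key: "\<exists>\<phi>\<in>one_mod_T. \<phi> ` carrier M \<subseteq> N"
    if "finite G" "submodule N R M" "\<forall>r\<in>bicommutant. r ` N \<subseteq> N" "generates N G"
    for G N
    using that
  proof (induction G arbitrary: N)
    case empty
    have "N = carrier M" using empty.prems(1,3) unfolding generates_def by blast
    then show ?case by (intro bexI[OF _ id_one_mod_T]) simp
  next
    case (insert g G)
    note sub = submoduleE[OF insert.prems(1)]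
    have stable: "r a \<in> N" if "r \<in> bicommutant" "a \<in> N" for r a
      using insert.prems(2) that by blast
    have g: "g \<in> carrier M" using insert.prems(3) by (simp add: generates_def)
    have cl: "n \<in> carrier M" if "n \<in> N" for n using that sub(1) by blast
    \<comment> \<open>The smallest stable submodule containing \<open>N\<close> and
      \<open>g\<close>: the multiples of \<open>g\<close> by operators are adjoined, not just those
      by scalars.\<close>
    define N' where "N' = (\<lambda>(n, s). n \<oplus>\<^bsub>M\<^esub> s g) ` (N \<times> bicommutant)"
    have N'I: "n \<oplus>\<^bsub>M\<^esub> s g \<in> N'" if "n \<in> N" "s \<in> bicommutant" for n s
      using that by (auto simp: N'_def)
    have N'E: thesis
      if "a \<in> N'" "\<And>n s. n \<in> N \<Longrightarrow> s \<in> bicommutant \<Longrightarrow> a = n \<oplus>\<^bsub>M\<^esub> s g \<Longrightarrow> thesis" for a thesis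
      using that by (auto simp: N'_def)
    have N'_cl: "N' \<subseteq> carrier M"
    proof
      fix a assume "a \<in> N'"
      then show "a \<in> carrier M"
        by (rule N'E) (simp add: cl bicommutant_closed[OF _ g])
    qed
    have stable': "r a \<in> N'" if r: "r \<in> bicommutant" and "a \<in> N'" for r a
    proof -
      obtain n s where n: "n \<in> N" "s \<in> bicommutant" "a = n \<oplus>\<^bsub>M\<^esub> s g" using \<open>a \<in> N'\<close> by (rule N'E)
      have "r a = r n \<oplus>\<^bsub>M\<^esub> r (s g)"
        unfolding n(3) using bicommutant_add[OF r cl[OF n(1)] bicommutant_closed[OF n(2) g]] .
      then show ?thesis using N'I[OF stable[OF r n(1)] comp_bicommutant[OF r n(2)]] by simp
    qed
    have "N \<subseteq> N'"
    proof
      fix n assume "n \<in> N"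
      then show "n \<in> N'" using N'I[OF _ zero_bicommutant] cl by simp
    qed
    have "g \<in> N'" using N'I[OF submodule_zero[OF insert.prems(1)] id_bicommutant] g by simp
    have "submodule N' R M"
    proof (rule submoduleI)
      show "N' \<subseteq> carrier M" by (rule N'_cl)
      show "\<zero>\<^bsub>M\<^esub> \<in> N'" using \<open>N \<subseteq> N'\<close> submodule_zero[OF insert.prems(1)] by blast
      show smult: "c \<odot>\<^bsub>M\<^esub> a \<in> N'" if "c \<in> carrier R" "a \<in> N'" for c a
        using stable'[OF smult_bicommutant[OF that(1) id_bicommutant] that(2)] .
      show "\<ominus>\<^bsub>M\<^esub> a \<in> N'" if "a \<in> N'" for a
        using smult[OF R.a_inv_closed[OF R.one_closed] that] subsetD[OF N'_cl that]
        by (simp add: smult_l_minus)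
      show "a \<oplus>\<^bsub>M\<^esub> b \<in> N'" if "a \<in> N'" "b \<in> N'" for a b
      proof -
        obtain n s where n: "n \<in> N" "s \<in> bicommutant" "a = n \<oplus>\<^bsub>M\<^esub> s g" using \<open>a \<in> N'\<close> by (rule N'E)
        obtain m r where m: "m \<in> N" "r \<in> bicommutant" "b = m \<oplus>\<^bsub>M\<^esub> r g" using \<open>b \<in> N'\<close> by (rule N'E)
        have "a \<oplus>\<^bsub>M\<^esub> b = (n \<oplus>\<^bsub>M\<^esub> m) \<oplus>\<^bsub>M\<^esub> (s g \<oplus>\<^bsub>M\<^esub> r g)"
          using cl[OF n(1)] cl[OF m(1)] bicommutant_closed[OF n(2) g] bicommutant_closed[OF m(2) g]
          by (simp add: n m M.add.m_ac)
        then show ?thesis using N'I[OF sub(5)[OF n(1) m(1)] add_bicommutant[OF n(2) m(2)]] by simp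
      qed
    qed
    moreover have "generates N' G"
      unfolding generates_def
    proof (intro conjI allI impI)
      show "G \<subseteq> carrier M" using insert.prems(3) by (simp add: generates_def)
      fix L assume L: "submodule L R M" "N' \<subseteq> L" "G \<subseteq> L"
      then have "N \<subseteq> L" "insert g G \<subseteq> L" using \<open>N \<subseteq> N'\<close> \<open>g \<in> N'\<close> by blast+
      then show "L = carrier M" using insert.prems(3) L(1) unfolding generates_def by blast
    qed
    moreover have "\<forall>r\<in>bicommutant. r ` N' \<subseteq> N'" using stable' by (simp add: image_subset_iff)
    ultimately obtain \<phi> where \<phi>: "\<phi> \<in> one_mod_T" "\<phi> ` carrier M \<subseteq> N'"
      using insert.IH by blast
    have \<phi>_mem: "\<phi> a \<in> N'" if "a \<in> carrier M" for a using \<phi>(2) that by blast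
    note \<phi>B = one_mod_T_bicommutant[OF \<phi>(1)]
    \<comment> \<open>The only use of surjectivity. Applying \<open>T\<close> to
      \<open>\<phi> g' = n + s g\<close> gives \<open>\<phi> g = T n + T (s g)\<close>, so the
      operator \<open>\<psi> = \<phi> - T s\<close> sends \<open>g\<close> to \<open>T n\<close>,
      which lies in \<open>N\<close>.\<close>
    obtain g' where g': "g' \<in> carrier M" "g = T g'" using g surj by blast
    obtain n s where n: "n \<in> N" "s \<in> bicommutant" "\<phi> g' = n \<oplus>\<^bsub>M\<^esub> s g"
      using \<phi>_mem[OF g'(1)] by (rule N'E)
    define \<psi> where "\<psi> = (\<lambda>u. \<phi> u \<ominus>\<^bsub>M\<^esub> T (s u))"
    have \<psi>: "\<psi> \<in> one_mod_T" unfolding \<psi>_def using diff_one_mod_T[OF \<phi>(1) n(2)] .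
    note \<psi>B = one_mod_T_bicommutant[OF \<psi>]
    have "\<psi> g = T n"
    proof -
      have "\<phi> g = T n \<oplus>\<^bsub>M\<^esub> T (s g)"
        using bicommutant_T[OF \<phi>B g'(1)] linear_mapsD(2)[OF T_linear cl[OF n(1)] bicommutant_closed[OF n(2) g]]
        by (simp add: g'(2)[symmetric] n(3))
      then show ?thesis
        using Tcl[OF cl[OF n(1)]] Tcl[OF bicommutant_closed[OF n(2) g]]
        by (simp add: \<psi>_def M.minus_eq M.a_assoc M.r_neg)
    qed
    then have \<psi>g: "\<psi> g \<in> N" using stable[OF T_bicommutant n(1)] by simp
    \<comment> \<open>\<open>\<phi>\<close> brings \<open>a\<close> into \<open>N'\<close>, and
      \<open>\<psi>\<close> brings \<open>N'\<close> into \<open>N\<close>: it preserves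
      \<open>N\<close> and, commuting with \<open>r\<close>, sends \<open>r g\<close> to
      \<open>r (\<psi> g)\<close>.\<close>
    have "\<psi> (\<phi> a) \<in> N" if a: "a \<in> carrier M" for a
    proof -
      obtain m r where m: "m \<in> N" "r \<in> bicommutant" "\<phi> a = m \<oplus>\<^bsub>M\<^esub> r g"
        using \<phi>_mem[OF a] by (rule N'E)
      then have "\<psi> (\<phi> a) = \<psi> m \<oplus>\<^bsub>M\<^esub> r (\<psi> g)"
        using bicommutant_add[OF \<psi>B cl[OF m(1)] bicommutant_closed[OF m(2) g]]
          bicommutant_commute[OF \<psi>B m(2) g] by simp
      then show ?thesis
        using sub(5) stable[OF \<psi>B m(1)] stable[OF m(2) \<psi>g] by simp
    qed
    then show ?case by (intro bexI[OF _ comp_one_mod_T[OF \<psi> \<phi>(1)]]) (simp add: image_subset_iff)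
  qed
  obtain G where G: "finite G" "\<And>N. generates N G"
    using finitely_generated_generates[OF fg] by blast
  have zero: "submodule {\<zero>\<^bsub>M\<^esub>} R M" by (rule submoduleI) simp_all
  have "\<forall>r\<in>bicommutant. r ` {\<zero>\<^bsub>M\<^esub>} \<subseteq> {\<zero>\<^bsub>M\<^esub>}"
    by (simp add: linear_maps_zero[OF module_axioms module_axioms bicommutant_linear])
  from key[OF G(1) zero this G(2)]
  obtain \<phi> where \<phi>: "\<phi> \<in> one_mod_T" "\<phi> ` carrier M \<subseteq> {\<zero>\<^bsub>M\<^esub>}"
    by blast
  obtain r where r: "r \<in> bicommutant" "\<And>a. a \<in> carrier M \<Longrightarrow> \<phi> a \<oplus>\<^bsub>M\<^esub> T (r a) = a"
    using \<phi>(1) by (rule one_mod_TE) blast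
  \<comment> \<open>With \<open>N = 0\<close> the operator \<open>\<phi>\<close> vanishes on
    \<open>M\<close>, so \<open>T r = 1\<close>; as \<open>r\<close> commutes with \<open>T\<close>,
    it is a left inverse.\<close>
  have "r (T a) = a" if a: "a \<in> carrier M" for a
  proof -
    have "\<phi> a = \<zero>\<^bsub>M\<^esub>" using \<phi>(2) a by blast
    then show ?thesis
      using r(2)[OF a] bicommutant_T[OF r(1) a] Tcl[OF bicommutant_closed[OF r(1) a]] by simp
  qed
  then show ?thesis by (rule inj_on_inverseI)
qed

section \<open>Fitting's lemma modulo a set of scalars\<close>

lemma T_power_closed: "a \<in> carrier M \<Longrightarrow> (T ^^ n) a \<in> carrier M"
  using bicommutant_closed[OF T_power_bicommutant] .

text \<open>Modulo a submodule one generator larger, two distinct powers of \<open>T\<close>, times operators in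
  \<open>1 + T R\<close>, map \<open>g\<close> to multiples of the new generator \<open>x\<close>; unless the coefficient for the higher
  power lies in \<open>I\<close>, a multiple of it cancels the one for the lower power.\<close>

lemma one_mod_T_power_mem:
  assumes I: "I \<subseteq> carrier R"
    and inv: "\<And>s. s \<in> carrier R \<Longrightarrow> s \<notin> I \<Longrightarrow> \<exists>c\<in>carrier R. \<one> \<ominus> c \<otimes> s \<in> I"
    and g: "g \<in> carrier M"
    and "finite G" "submodule N R M" "ideal_mult I M \<subseteq> N" "generates N G"
  shows "\<exists>j\<ge>i. \<exists>\<phi>\<in>one_mod_T. (T ^^ j) (\<phi> g) \<in> N"
  using assms(4-)
proof (induction G arbitrary: N i)
  case empty
  have "N = carrier M" using empty.prems(1,3) unfolding generates_def by blast
  then have "(T ^^ i) g \<in> N" using T_power_closed[OF g] by simp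
  then show ?case using id_one_mod_T by (intro exI[of _ i] conjI bexI[of _ "\<lambda>u. u"]) simp_all
next
  case (insert x G)
  note N = insert.prems(1)
  note sub = submoduleE[OF N]
  have cl: "n \<in> carrier M" if "n \<in> N" for n using that sub(1) by blast
  have x: "x \<in> carrier M" using insert.prems(3) by (simp add: generates_def)
  note adj = submodule_adjoin[OF N x]
  have gen: "generates (adjoin N x) G"
    unfolding generates_def
  proof (intro conjI allI impI)
    show "G \<subseteq> carrier M" using insert.prems(3) by (simp add: generates_def)
    fix L assume L: "submodule L R M" "adjoin N x \<subseteq> L" "G \<subseteq> L"
    then have "N \<subseteq> L" "insert x G \<subseteq> L" using adj(2,3) by blast+
    then show "L = carrier M" using insert.prems(3) L(1) unfolding generates_def by blast
  qed
  note IH = insert.IH[OF adj(1) order.trans[OF insert.prems(2) adj(2)] gen]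
  obtain j \<phi> where j: "j \<ge> i" and \<phi>: "\<phi> \<in> one_mod_T" and "(T ^^ j) (\<phi> g) \<in> adjoin N x"
    using IH[of i] by blast
  from \<open>(T ^^ j) (\<phi> g) \<in> adjoin N x\<close>
  obtain n s where n: "n \<in> N" "s \<in> carrier R" "(T ^^ j) (\<phi> g) = n \<oplus>\<^bsub>M\<^esub> s \<odot>\<^bsub>M\<^esub> x"
    by (rule adjoinE)
  \<comment> \<open>The lower bound \<open>i\<close> in the claim exists for this second call:
    started at \<open>Suc j\<close>, it guarantees a strictly higher power of
    \<open>T\<close>.\<close>
  obtain j' \<phi>' where j': "j' \<ge> Suc j" and \<phi>': "\<phi>' \<in> one_mod_T" and "(T ^^ j') (\<phi>' g) \<in> adjoin N x"
    using IH[of "Suc j"] by blast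
  from \<open>(T ^^ j') (\<phi>' g) \<in> adjoin N x\<close>
  obtain n' s' where n': "n' \<in> N" "s' \<in> carrier R" "(T ^^ j') (\<phi>' g) = n' \<oplus>\<^bsub>M\<^esub> s' \<odot>\<^bsub>M\<^esub> x"
    by (rule adjoinE)
  show ?case
  proof (cases "s' \<in> I")
    case True
    then have "s' \<odot>\<^bsub>M\<^esub> x \<in> N" using ideal_mult_mem[OF I _ x] insert.prems(2) by blast
    then have "(T ^^ j') (\<phi>' g) \<in> N" using n' sub(5) by simp
    then show ?thesis using \<phi>' j j' by (meson Suc_leD order.trans)
  next
    case False
    then obtain c where c: "c \<in> carrier R" "\<one> \<ominus> c \<otimes> s' \<in> I" using inv n'(2) by blast
    \<comment> \<open>Chosen so that \<open>T\<^sup>j (T (\<sigma> g))\<close> is \<open>s c\<close>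
      times the second relation. The exponent \<open>j' - Suc j\<close> leaves one factor
      \<open>T\<close> in front, which keeps \<open>\<phi> - T \<sigma>\<close> in
      \<open>one_mod_T\<close>.\<close>
    define \<sigma> where "\<sigma> = (\<lambda>u. (s \<otimes> c) \<odot>\<^bsub>M\<^esub> (T ^^ (j' - Suc j)) (\<phi>' u))"
    note \<phi>B = one_mod_T_bicommutant[OF \<phi>] one_mod_T_bicommutant[OF \<phi>']
    have \<sigma>: "\<sigma> \<in> bicommutant"
      unfolding \<sigma>_def
      using smult_bicommutant[OF R.m_closed[OF n(2) c(1)] comp_bicommutant[OF T_power_bicommutant \<phi>B(2)]] .
    note clg = bicommutant_closed[OF \<phi>B(1) g] bicommutant_closed[OF \<phi>B(2) g]
    have sc: "s \<otimes> c \<in> carrier R" using n(2) c(1) by simp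
    have "(T ^^ j) (T (\<sigma> g)) = (T ^^ Suc j) (\<sigma> g)" by (simp add: funpow_swap1)
    also have "\<dots> = (s \<otimes> c) \<odot>\<^bsub>M\<^esub> (T ^^ Suc j) ((T ^^ (j' - Suc j)) (\<phi>' g))"
      unfolding \<sigma>_def by (rule bicommutant_smult[OF T_power_bicommutant sc T_power_closed[OF clg(2)]])
    also have "(T ^^ Suc j) ((T ^^ (j' - Suc j)) (\<phi>' g)) = (T ^^ j') (\<phi>' g)"
      using j' by (metis add_diff_inverse_nat comp_apply funpow_add not_less)
    finally have T\<sigma>: "(T ^^ j) (T (\<sigma> g)) = (s \<otimes> c) \<odot>\<^bsub>M\<^esub> n' \<oplus>\<^bsub>M\<^esub> ((s \<otimes> c) \<otimes> s') \<odot>\<^bsub>M\<^esub> x"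
      using n' cl x sc by (simp add: smult_r_distr smult_assoc1)
    have clT: "T (\<sigma> g) \<in> carrier M"
      using linear_mapsD(1)[OF T_linear bicommutant_closed[OF \<sigma> g]] .
    have "(T ^^ j) (\<phi> g \<ominus>\<^bsub>M\<^esub> T (\<sigma> g)) \<oplus>\<^bsub>M\<^esub> (T ^^ j) (T (\<sigma> g)) = (T ^^ j) (\<phi> g)"
    proof -
      have "(T ^^ j) (\<phi> g \<ominus>\<^bsub>M\<^esub> T (\<sigma> g)) \<oplus>\<^bsub>M\<^esub> (T ^^ j) (T (\<sigma> g))
          = (T ^^ j) (\<phi> g \<ominus>\<^bsub>M\<^esub> T (\<sigma> g) \<oplus>\<^bsub>M\<^esub> T (\<sigma> g))"
        by (rule bicommutant_add[OF T_power_bicommutant M.minus_closed[OF clg(1) clT] clT, symmetric])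
      also have "\<phi> g \<ominus>\<^bsub>M\<^esub> T (\<sigma> g) \<oplus>\<^bsub>M\<^esub> T (\<sigma> g) = \<phi> g"
        using clg(1) clT by (simp add: M.minus_eq M.a_assoc M.l_neg)
      finally show ?thesis .
    qed
    then have "(T ^^ j) (\<phi> g \<ominus>\<^bsub>M\<^esub> T (\<sigma> g)) = (T ^^ j) (\<phi> g) \<ominus>\<^bsub>M\<^esub> (T ^^ j) (T (\<sigma> g))"
      using T_power_closed[OF M.minus_closed[OF clg(1) clT]] T_power_closed[OF clT]
      by (metis M.add.inv_solve_right' M.minus_eq T_power_closed clg(1))
    \<comment> \<open>After the subtraction the coefficient of \<open>x\<close> is
      \<open>s - s c s' = s (1 - c s')\<close>, and \<open>1 - c s'\<close> lies in
      \<open>I\<close>.\<close>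
    also have "\<dots> = (n \<ominus>\<^bsub>M\<^esub> (s \<otimes> c) \<odot>\<^bsub>M\<^esub> n') \<oplus>\<^bsub>M\<^esub> s \<odot>\<^bsub>M\<^esub> ((\<one> \<ominus> c \<otimes> s') \<odot>\<^bsub>M\<^esub> x)"
    proof -
      have "s \<odot>\<^bsub>M\<^esub> ((\<one> \<ominus> c \<otimes> s') \<odot>\<^bsub>M\<^esub> x) = s \<odot>\<^bsub>M\<^esub> x \<oplus>\<^bsub>M\<^esub> \<ominus>\<^bsub>M\<^esub> (((s \<otimes> c) \<otimes> s') \<odot>\<^bsub>M\<^esub> x)"
        using n(2) n'(2) c(1) x
        by (simp add: R.minus_eq smult_l_distr smult_r_distr smult_l_minus smult_r_minus smult_assoc1)
      moreover have "s \<odot>\<^bsub>M\<^esub> x \<in> carrier M" "(s \<otimes> c) \<odot>\<^bsub>M\<^esub> n' \<in> carrier M"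
        "((s \<otimes> c) \<otimes> s') \<odot>\<^bsub>M\<^esub> x \<in> carrier M" "n \<in> carrier M"
        using n n'(1,2) c(1) x cl by simp_all
      ultimately show ?thesis
        by (simp add: n(3) T\<sigma> M.minus_eq M.minus_add M.add.m_ac)
    qed
    also have "\<dots> \<in> N"
    proof -
      have "(\<one> \<ominus> c \<otimes> s') \<odot>\<^bsub>M\<^esub> x \<in> N" using ideal_mult_mem[OF I c(2) x] insert.prems(2) by blast
      then show ?thesis
        using submodule_minus[OF N n(1) sub(4)[OF sc n'(1)]] sub(4)[OF n(2)] sub(5) by simp
    qed
    finally show ?thesis using j by (intro exI[of _ j] conjI bexI[OF _ diff_one_mod_T[OF \<phi> \<sigma>]])
  qed
qed

text \<open>Each generator is brought into \<open>I M\<close> by some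
  \<open>T\<^sup>j \<phi>\<close> with \<open>\<phi> = 1 - T r\<close>; as these operators commute,
  one such operator serves for all of \<open>M\<close>. Then \<open>T\<^sup>j\<close> is congruent
  to \<open>T\<^sup>j\<^sup>+\<^sup>1 r\<close>, and iterating this relation produces
  \<open>q\<close> as a power of \<open>r\<close>.\<close>

lemma fitting_mod:
  assumes fg: "finitely_generated R M" and I: "I \<subseteq> carrier R"
    and inv: "\<And>s. s \<in> carrier R \<Longrightarrow> s \<notin> I \<Longrightarrow> \<exists>c\<in>carrier R. \<one> \<ominus> c \<otimes> s \<in> I"
  obtains n q where "q \<in> bicommutant"
    "\<And>a. a \<in> carrier M \<Longrightarrow> mcong I M ((T ^^ Suc n) ((T ^^ Suc n) (q a))) ((T ^^ Suc n) a)"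
proof -
  let ?N = "ideal_mult I M"
  note N = submodule_ideal_mult[OF I]
  note sub = submoduleE[OF N]
  have stable: "r a \<in> ?N" if "r \<in> bicommutant" "a \<in> ?N" for r a
    using linear_maps_ideal_mult[OF module_axioms module_axioms I bicommutant_linear[OF that(1)] that(2)] .
  obtain G where G: "finite G" "\<And>N. generates N G"
    using finitely_generated_generates[OF fg] by blast
  have "\<exists>j. \<exists>\<phi>\<in>one_mod_T. \<forall>g\<in>F. (T ^^ j) (\<phi> g) \<in> ?N" if "finite F" "F \<subseteq> carrier M" for F
    using that
  proof (induction F)
    case empty
    then show ?case using id_one_mod_T by blast
  next
    case (insert x F)
    then obtain j \<phi> where \<phi>: "\<phi> \<in> one_mod_T" "\<forall>g\<in>F. (T ^^ j) (\<phi> g) \<in> ?N" by auto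
    have x: "x \<in> carrier M" using insert by simp
    obtain j' \<phi>' where \<phi>': "\<phi>' \<in> one_mod_T" "(T ^^ j') (\<phi>' x) \<in> ?N"
      using one_mod_T_power_mem[OF I inv x G(1) N order.refl G(2), of 0] by blast
    note B = one_mod_T_bicommutant[OF \<phi>(1)] one_mod_T_bicommutant[OF \<phi>'(1)]
    note TB = comp_bicommutant[OF T_power_bicommutant[of j] B(1)] comp_bicommutant[OF T_power_bicommutant[of j'] B(2)]
    \<comment> \<open>The composite factors into the two given operators, which commute. Whichever
      of them brings \<open>u\<close> into \<open>I M\<close> can be applied first, since the other
      one preserves \<open>I M\<close>.\<close>
    have eq: "(T ^^ (j + j')) (\<phi> (\<phi>' u)) = (T ^^ j) (\<phi> ((T ^^ j') (\<phi>' u)))" if "u \<in> carrier M" for u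
      using bicommutant_commute[OF B(1) T_power_bicommutant bicommutant_closed[OF B(2) that]]
      by (simp add: funpow_add)
    have "(T ^^ (j + j')) (\<phi> (\<phi>' u)) \<in> ?N" if u: "u \<in> insert x F" for u
    proof (cases "u = x")
      case True
      then show ?thesis using eq[OF x] stable[OF TB(1) \<phi>'(2)] by simp
    next
      case False
      then have "u \<in> F" "u \<in> carrier M" using u insert.prems by auto
      then show ?thesis
        using eq[of u] bicommutant_commute[OF TB, of u] stable[OF TB(2)] \<phi>(2) by simp
    qed
    then show ?case using comp_one_mod_T[OF \<phi>(1) \<phi>'(1)]
      by (intro exI[of _ "j + j'"] bexI[of _ "\<lambda>u. \<phi> (\<phi>' u)"]) simp_all
  qed
  from this[OF G(1)] obtain j \<phi> where \<phi>: "\<phi> \<in> one_mod_T" and G\<phi>: "\<forall>g\<in>G. (T ^^ j) (\<phi> g) \<in> ?N"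
    using G(2)[of "{}"] by (auto simp: generates_def)
  note TB = comp_bicommutant[OF T_power_bicommutant[of j] one_mod_T_bicommutant[OF \<phi>]]
  have "submodule {a \<in> carrier M. (T ^^ j) (\<phi> a) \<in> ?N} R M"
  proof (rule submoduleI)
    show smult: "r \<odot>\<^bsub>M\<^esub> a \<in> {a \<in> carrier M. (T ^^ j) (\<phi> a) \<in> ?N}"
      if "r \<in> carrier R" "a \<in> {a \<in> carrier M. (T ^^ j) (\<phi> a) \<in> ?N}" for r a
      using that bicommutant_smult[OF TB] sub(4) by simp
    show "\<ominus>\<^bsub>M\<^esub> a \<in> {a \<in> carrier M. (T ^^ j) (\<phi> a) \<in> ?N}"
      if "a \<in> {a \<in> carrier M. (T ^^ j) (\<phi> a) \<in> ?N}" for a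
      using smult[OF R.a_inv_closed[OF R.one_closed] that] that by (simp add: smult_l_minus)
    show "a \<oplus>\<^bsub>M\<^esub> b \<in> {a \<in> carrier M. (T ^^ j) (\<phi> a) \<in> ?N}"
      if "a \<in> {a \<in> carrier M. (T ^^ j) (\<phi> a) \<in> ?N}" "b \<in> {a \<in> carrier M. (T ^^ j) (\<phi> a) \<in> ?N}" for a b
      using that bicommutant_add[OF TB] sub(5) by simp
  qed (use linear_maps_zero[OF module_axioms module_axioms bicommutant_linear[OF TB]] submodule_zero[OF N] in auto)
  moreover have "G \<subseteq> {a \<in> carrier M. (T ^^ j) (\<phi> a) \<in> ?N}"
    using G\<phi> G(2)[of "{}"] by (auto simp: generates_def)
  ultimately have "{a \<in> carrier M. (T ^^ j) (\<phi> a) \<in> ?N} = carrier M"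
    using G(2)[of "{}"] unfolding generates_def by blast
  then have mem: "(T ^^ j) (\<phi> a) \<in> ?N" if "a \<in> carrier M" for a using that by blast
  obtain r where r: "r \<in> bicommutant" "\<And>a. a \<in> carrier M \<Longrightarrow> \<phi> a \<oplus>\<^bsub>M\<^esub> T (r a) = a"
    using \<phi> by (rule one_mod_TE) blast
  have one: "mcong I M ((T ^^ j) a) ((T ^^ Suc j) (r a))" if a: "a \<in> carrier M" for a
  proof -
    note cl = bicommutant_closed[OF one_mod_T_bicommutant[OF \<phi>] a]
      linear_mapsD(1)[OF T_linear bicommutant_closed[OF r(1) a]]
    have "(T ^^ j) a = (T ^^ j) (\<phi> a) \<oplus>\<^bsub>M\<^esub> (T ^^ j) (T (r a))"
      using bicommutant_add[OF T_power_bicommutant[of j] cl] r(2)[OF a] by simp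
    also have "\<dots> = (T ^^ Suc j) (r a) \<oplus>\<^bsub>M\<^esub> (T ^^ j) (\<phi> a)"
      using T_power_closed[OF cl(1)] T_power_closed[OF cl(2), of j]
      by (simp add: M.a_comm funpow_swap1)
    finally show ?thesis
      using mem[OF a] T_power_closed[OF a] T_power_closed[OF bicommutant_closed[OF r(1) a]]
      unfolding mcong_def by blast
  qed
  have many: "mcong I M ((T ^^ j) a) ((T ^^ (i + j)) ((r ^^ i) a))" if a: "a \<in> carrier M" for a i
  proof (induction i)
    case 0
    show ?case using mcong_refl[OF T_power_closed[OF a]] by simp
  next
    case (Suc i)
    note cl = bicommutant_closed[OF funpow_bicommutant[OF r(1)] a, of i]
    have "mcong I M ((T ^^ i) ((T ^^ j) ((r ^^ i) a))) ((T ^^ i) ((T ^^ Suc j) (r ((r ^^ i) a))))"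
      using mcong_linear[OF module_axioms module_axioms I bicommutant_linear[OF T_power_bicommutant] one[OF cl]] .
    moreover have "(T ^^ i) ((T ^^ j) ((r ^^ i) a)) = (T ^^ (i + j)) ((r ^^ i) a)"
      by (simp add: funpow_add)
    moreover have "(T ^^ i) ((T ^^ Suc j) (r ((r ^^ i) a))) = (T ^^ (Suc i + j)) ((r ^^ Suc i) a)"
      by (simp add: funpow_add funpow_swap1)
    ultimately show ?case using mcong_trans[OF I Suc] by simp
  qed
  \<comment> \<open>Taking \<open>i = Suc j\<close> in \<open>many\<close> and applying
    \<open>T\<close> once more gives exponent \<open>2 (j + 1)\<close> against \<open>j + 1\<close>.
    The additional \<open>T\<close> makes the exponent positive even when \<open>j = 0\<close>, so
    the projection factors through \<open>T\<close>.\<close>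
  have "mcong I M ((T ^^ Suc j) ((T ^^ Suc j) ((r ^^ Suc j) a))) ((T ^^ Suc j) a)"
    if a: "a \<in> carrier M" for a
  proof -
    have "mcong I M (T ((T ^^ j) a)) (T ((T ^^ (Suc j + j)) ((r ^^ Suc j) a)))"
      by (rule mcong_linear[OF module_axioms module_axioms I T_linear many[OF a]])
    moreover have "T ((T ^^ (Suc j + j)) u) = (T ^^ Suc j) ((T ^^ Suc j) u)" for u
      by (simp add: funpow_add funpow_swap1)
    ultimately show ?thesis using mcong_sym[OF module_axioms I] by simp
  qed
  then show thesis by (rule that[OF funpow_bicommutant[OF r(1)]])
qed

end

section \<open>The square of the antipode\<close>

text \<open>Modulo \<open>I\<close> the convolution of \<open>f p\<close> and \<open>g\<close>
  equals that of \<open>f p\<close> and \<open>g p\<close>, which is \<open>f * g\<close>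
  precomposed with \<open>p\<close>, hence trivial. So \<open>f p\<close> is a left inverse of
  \<open>g\<close>, and uniqueness identifies it with \<open>f\<close>. Compatibility of
  \<open>p\<close> with the comultiplication is asked for after bilinear maps into \<open>R\<close>,
  where the product of \<open>f\<close> and \<open>g\<close> takes its values.\<close>

lemma (in coalgebra) convolution_inverse_cancel:
  assumes mods: "module k P" "module k Q" "module k R" "module k R'" and I: "I \<subseteq> carrier k"
    and f: "f \<in> linear_maps k C P" and g: "g \<in> linear_maps k C Q" and p: "p \<in> linear_maps k C C"
    and pq: "pq \<in> bilinear_maps k P Q R" and rp: "rp \<in> bilinear_maps k R P P"
    and qp: "qp \<in> bilinear_maps k Q P R'" and pr: "pr \<in> bilinear_maps k P R' P"
    and assoc: "\<And>p q p'. p \<in> carrier P \<Longrightarrow> q \<in> carrier Q \<Longrightarrow> p' \<in> carrier P \<Longrightarrow>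
      rp (pq p q) p' = pr p (qp q p')"
    and e: "e \<in> carrier R" "\<And>p. p \<in> carrier P \<Longrightarrow> rp e p = p"
    and e': "e' \<in> carrier R'" "\<And>p. p \<in> carrier P \<Longrightarrow> pr p e' = p"
    and fg: "\<And>h. h \<in> carrier C \<Longrightarrow>
      tensor_lift R (\<lambda>u v. pq (f u) (g v)) (comult C h) = counit C h \<odot>\<^bsub>R\<^esub> e"
    and gf: "\<And>h. h \<in> carrier C \<Longrightarrow>
      tensor_lift R' (\<lambda>u v. qp (g u) (f v)) (comult C h) = counit C h \<odot>\<^bsub>R'\<^esub> e'"
    and comult_p: "\<And>b h. b \<in> bilinear_maps k C C R \<Longrightarrow> h \<in> carrier C \<Longrightarrow>
      mcong I R (tensor_lift R b (comult C (p h))) (tensor_lift R (\<lambda>u v. b (p u) (p v)) (comult C h))"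
    and counit_p: "\<And>h. h \<in> carrier C \<Longrightarrow> mcong I (base_module k) (counit C (p h)) (counit C h)"
    and gp: "\<And>h. h \<in> carrier C \<Longrightarrow> mcong I Q (g (p h)) (g h)"
    and h: "h \<in> carrier C"
  shows "mcong I P (f (p h)) (f h)"
proof -
  interpret Q: module k Q by fact
  interpret R: module k R by fact
  interpret R': module k R' by fact
  note fp = linear_maps_comp[OF f p] and gp_lin = linear_maps_comp[OF g p]
  have fg': "mcong I R (tensor_lift R (\<lambda>u v. pq (f (p u)) (g v)) (comult C h)) (counit C h \<odot>\<^bsub>R\<^esub> e)"
    if h: "h \<in> carrier C" for h
  proof -
    have "mcong I R (tensor_lift R (\<lambda>u v. pq (f (p u)) (g v)) (comult C h))
        (tensor_lift R (\<lambda>u v. pq (f (p u)) (g (p v))) (comult C h))"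
      using mods(3) I bilinear_maps_comp[OF pq fp g] bilinear_maps_comp[OF pq fp gp_lin] h
    proof (rule sweedler_mcong)
      fix u v assume uv: "u \<in> carrier C" "v \<in> carrier C"
      show "mcong I R (pq (f (p u)) (g v)) (pq (f (p u)) (g (p v)))"
        by (rule mcong_linear[OF mods(2,3) I bilinear_maps_linear(1)[OF pq linear_mapsD(1)[OF fp uv(1)]]
              mcong_sym[OF mods(2) I gp[OF uv(2)]]])
    qed
    moreover have "mcong I R (tensor_lift R (\<lambda>u v. pq (f (p u)) (g (p v))) (comult C h))
        (counit C (p h) \<odot>\<^bsub>R\<^esub> e)"
      using mcong_sym[OF mods(3) I comult_p[OF bilinear_maps_comp[OF pq f g] h]]
      by (simp add: fg[OF linear_mapsD(1)[OF p h]])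
    moreover have "mcong I R (counit C (p h) \<odot>\<^bsub>R\<^esub> e) (counit C h \<odot>\<^bsub>R\<^esub> e)"
      by (rule mcong_linear[OF base_module_module[OF R.is_cring] mods(3) I
            bilinear_maps_linear(2)[OF smult_bilinear[OF mods(3)] e(1)] counit_p[OF h]])
    ultimately show ?thesis using R.mcong_trans[OF I] by blast
  qed
  have gf': "mcong I R' (tensor_lift R' (\<lambda>u v. qp (g u) (f v)) (comult C h)) (counit C h \<odot>\<^bsub>R'\<^esub> e')"
    if "h \<in> carrier C" for h
    using that e'(1) by (simp add: gf R'.mcong_refl counit_closed)
  show ?thesis
    using mods I fp g f pq rp qp pr assoc e e' fg' gf' h by (rule convolution_inverse_unique)
qed

section \<open>Even and odd powers of the antipode\<close>

context hopf_category
begin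

abbreviation antipode_sq :: "'x \<Rightarrow> 'x \<Rightarrow> 'a \<Rightarrow> 'a"
  where "antipode_sq x y \<equiv> \<lambda>h. S y x (S x y h)"

lemma antipode_sq_linear:
  "x \<in> X \<Longrightarrow> y \<in> X \<Longrightarrow> antipode_sq x y \<in> linear_maps k (A x y) (A x y)"
  using linear_maps_comp antipode_linear by blast

lemma antipode_sq_power_linear:
  assumes "x \<in> X" "y \<in> X"
  shows "antipode_sq x y ^^ n \<in> linear_maps k (A x y) (A x y)"
proof (induction n)
  case 0
  show ?case using linear_maps_id by (simp add: id_def)
next
  case (Suc n)
  show ?case using linear_maps_comp[OF antipode_sq_linear[OF assms] Suc] by (simp add: comp_def)
qed

lemma counit_antipode_sq_power:
  assumes "x \<in> X" "y \<in> X" "h \<in> carrier (A x y)"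
  shows "counit (A x y) ((antipode_sq x y ^^ n) h) = counit (A x y) h"
proof (induction n)
  case (Suc n)
  have cl: "(antipode_sq x y ^^ n) h \<in> carrier (A x y)"
    using linear_mapsD(1)[OF antipode_sq_power_linear[OF assms(1,2)] assms(3)] .
  then have "S x y ((antipode_sq x y ^^ n) h) \<in> carrier (A y x)"
    using linear_mapsD(1)[OF antipode_linear[OF assms(1,2)]] by blast
  then show ?case using Suc cl assms(1,2) by (simp add: counit_antipode)
qed simp

text \<open>Each antipode reverses the two legs and \<open>antipode_sq\<close> applies two of them,
  so the legs return to their order.\<close>

lemma sweedler_antipode_sq_power:
  assumes x: "x \<in> X" and y: "y \<in> X" and h: "h \<in> carrier (A x y)"
    and P: "module k P" and b: "b \<in> bilinear_maps k (A x y) (A x y) P"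
  shows "sweedler x y P b ((antipode_sq x y ^^ n) h)
    = sweedler x y P (\<lambda>u v. b ((antipode_sq x y ^^ n) u) ((antipode_sq x y ^^ n) v)) h"
  using b
proof (induction n arbitrary: b)
  case (Suc n)
  note S = antipode_linear[OF x y] antipode_linear[OF y x]
  let ?h = "(antipode_sq x y ^^ n) h"
  have cl: "?h \<in> carrier (A x y)"
    using linear_mapsD(1)[OF antipode_sq_power_linear[OF x y] h] .
  have "sweedler x y P b (S y x (S x y ?h)) = sweedler y x P (\<lambda>u v. b (S y x v) (S y x u)) (S x y ?h)"
    by (rule sweedler_antipode[OF y x linear_mapsD(1)[OF S(1) cl] P Suc.prems])
  also have "\<dots> = sweedler x y P (\<lambda>u v. b (S y x (S x y u)) (S y x (S x y v))) ?h"
    by (rule sweedler_antipode[OF x y cl P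
          bilinear_maps_swap[OF bilinear_maps_comp[OF Suc.prems S(2) S(2)]]])
  also have "\<dots> = sweedler x y P (\<lambda>u v. b ((antipode_sq x y ^^ Suc n) u) ((antipode_sq x y ^^ Suc n) v)) h"
    using Suc.IH[OF bilinear_maps_comp[OF Suc.prems antipode_sq_linear[OF x y] antipode_sq_linear[OF x y]]]
    by simp
  finally show ?case by simp
qed simp

text \<open>The first two identities are the antipode axioms of \<open>A x y\<close> at
  \<open>E h\<close>, the last two those of \<open>A y x\<close> at \<open>S(E h)\<close>. In the
  latter the single \<open>S\<close> has reversed the comultiplication, whence the interchange of
  \<open>u\<close> and \<open>v\<close>.\<close>

lemma antipode_sq_power_convolution:
  fixes n :: nat
  assumes x: "x \<in> X" and y: "y \<in> X" and h: "h \<in> carrier (A x y)"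
  defines "E \<equiv> antipode_sq x y ^^ n"
  shows "sweedler x y (A x x) (\<lambda>u v. mul x y x (E u) (S x y (E v))) h
      = counit (A x y) h \<odot>\<^bsub>A x x\<^esub> \<eta> x \<one>"
    and "sweedler x y (A y y) (\<lambda>u v. mul y x y (S x y (E u)) (E v)) h
      = counit (A x y) h \<odot>\<^bsub>A y y\<^esub> \<eta> y \<one>"
    and "sweedler x y (A x x) (\<lambda>u v. mul x y x (antipode_sq x y (E v)) (S x y (E u))) h
      = counit (A x y) h \<odot>\<^bsub>A x x\<^esub> \<eta> x \<one>"
    and "sweedler x y (A y y) (\<lambda>u v. mul y x y (S x y (E v)) (antipode_sq x y (E u))) h
      = counit (A x y) h \<odot>\<^bsub>A y y\<^esub> \<eta> y \<one>"
proof -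
  note S = antipode_linear[OF x y] and S' = antipode_linear[OF y x]
  note mxx = mul_bilinear[OF x y x] and myy = mul_bilinear[OF y x y]
  note XX = hom_module[OF x x] and YY = hom_module[OF y y]
  have cl: "E h \<in> carrier (A x y)"
    unfolding E_def using linear_mapsD(1)[OF antipode_sq_power_linear[OF x y] h] .
  note clS = linear_mapsD(1)[OF S cl]
  have counit: "counit (A x y) (E h) = counit (A x y) h"
    unfolding E_def by (rule counit_antipode_sq_power[OF x y h])
  note sw = sweedler_antipode_sq_power[OF x y h, where n = n, folded E_def]
  have b1: "(\<lambda>u v. mul x y x u (S x y v)) \<in> bilinear_maps k (A x y) (A x y) (A x x)"
    using bilinear_maps_comp[OF mxx linear_maps_id S] .
  have b2: "(\<lambda>u v. mul y x y (S x y u) v) \<in> bilinear_maps k (A x y) (A x y) (A y y)"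
    using bilinear_maps_comp[OF myy S linear_maps_id] .
  have b3: "(\<lambda>u v. mul x y x (S y x u) v) \<in> bilinear_maps k (A y x) (A y x) (A x x)"
    using bilinear_maps_comp[OF mxx S' linear_maps_id] .
  have b4: "(\<lambda>u v. mul y x y u (S y x v)) \<in> bilinear_maps k (A y x) (A y x) (A y y)"
    using bilinear_maps_comp[OF myy linear_maps_id S'] .
  have b3': "(\<lambda>u v. mul x y x (antipode_sq x y v) (S x y u)) \<in> bilinear_maps k (A x y) (A x y) (A x x)"
    using bilinear_maps_swap[OF bilinear_maps_comp[OF b3 S S]] .
  have b4': "(\<lambda>u v. mul y x y (S x y v) (antipode_sq x y u)) \<in> bilinear_maps k (A x y) (A x y) (A y y)"
    using bilinear_maps_swap[OF bilinear_maps_comp[OF b4 S S]] .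
  show "sweedler x y (A x x) (\<lambda>u v. mul x y x (E u) (S x y (E v))) h
      = counit (A x y) h \<odot>\<^bsub>A x x\<^esub> \<eta> x \<one>"
    using sw[OF XX b1] antipode_right[OF x y cl] counit by simp
  show "sweedler x y (A y y) (\<lambda>u v. mul y x y (S x y (E u)) (E v)) h
      = counit (A x y) h \<odot>\<^bsub>A y y\<^esub> \<eta> y \<one>"
    using sw[OF YY b2] antipode_left[OF x y cl] counit by simp
  show "sweedler x y (A x x) (\<lambda>u v. mul x y x (antipode_sq x y (E v)) (S x y (E u))) h
      = counit (A x y) h \<odot>\<^bsub>A x x\<^esub> \<eta> x \<one>"
    using sw[OF XX b3'] sweedler_antipode[OF x y cl XX b3] antipode_left[OF y x clS]
      counit_antipode[OF x y cl] counit by simp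
  show "sweedler x y (A y y) (\<lambda>u v. mul y x y (S x y (E v)) (antipode_sq x y (E u))) h
      = counit (A x y) h \<odot>\<^bsub>A y y\<^esub> \<eta> y \<one>"
    using sw[OF YY b4'] sweedler_antipode[OF x y cl YY b4] antipode_right[OF y x clS]
      counit_antipode[OF x y cl] counit by simp
qed

text \<open>The powers \<open>S\<^sup>j\<close> and \<open>S\<^sup>j\<^sup>+\<^sup>1\<close> of the antipode are mutually inverse for the convolution, which is that of
  the opposite coalgebra for odd \<open>j\<close>, so a congruence between \<open>S\<^sup>j\<^sup>+\<^sup>1 p\<close> and \<open>S\<^sup>j\<^sup>+\<^sup>1\<close> descends to
  \<open>S\<^sup>j p\<close> and \<open>S\<^sup>j\<close>.\<close>

lemma antipode_sq_descent:
  assumes x: "x \<in> X" and y: "y \<in> X" and I: "I \<subseteq> carrier k"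
    and p: "p \<in> linear_maps k (A x y) (A x y)"
    and comult_p: "\<And>z b h. z \<in> X \<Longrightarrow> b \<in> bilinear_maps k (A x y) (A x y) (A z z) \<Longrightarrow>
      h \<in> carrier (A x y) \<Longrightarrow>
      mcong I (A z z) (sweedler x y (A z z) b (p h)) (sweedler x y (A z z) (\<lambda>u v. b (p u) (p v)) h)"
    and counit_p: "\<And>h. h \<in> carrier (A x y) \<Longrightarrow>
      mcong I (base_module k) (counit (A x y) (p h)) (counit (A x y) h)"
    and "\<And>h. h \<in> carrier (A x y) \<Longrightarrow>
      mcong I (A x y) ((antipode_sq x y ^^ n) (p h)) ((antipode_sq x y ^^ n) h)"
    and h: "h \<in> carrier (A x y)"
  shows "mcong I (A x y) (p h) h"
  using assms(7,8)
proof (induction n arbitrary: h)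
  case 0
  then show ?case by simp
next
  case (Suc n)
  interpret C: coalgebra k "A x y" by (rule hom_coalgebra[OF x y])
  note mods = hom_module[OF x y] hom_module[OF y x] hom_module[OF x x] hom_module[OF y y]
  let ?E = "antipode_sq x y ^^ n"
  note E = antipode_sq_power_linear[OF x y, of n]
  note SE = linear_maps_comp[OF antipode_linear[OF x y] E]
  note SSE = linear_maps_comp[OF antipode_linear[OF y x] SE]
  note conv = antipode_sq_power_convolution[OF x y, where n = n]
  \<comment> \<open>One stage of the induction lowers the power of \<open>S\<close> by two. This is
    the first half, from \<open>2 n + 2\<close> to \<open>2 n + 1\<close>, with values in
    \<open>A y x\<close>; the second half returns to \<open>A x y\<close>.\<close>
  have odd: "mcong I (A y x) (S x y (?E (p h))) (S x y (?E h))" if h: "h \<in> carrier (A x y)" for h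
  proof -
    \<comment> \<open>Reversing the products has the same effect as passing to the opposite
      coalgebra, so the cancellation lemma still applies over \<open>A x y\<close> itself.\<close>
    note maps = bilinear_maps_swap[OF mul_bilinear[OF x y x]]
      bilinear_maps_swap[OF mul_bilinear[OF y x x]]
      bilinear_maps_swap[OF mul_bilinear[OF y x y]]
      bilinear_maps_swap[OF mul_bilinear[OF y y x]]
    have Suc_prems: "mcong I (A x y) (antipode_sq x y (?E (p h))) (antipode_sq x y (?E h))"
      if "h \<in> carrier (A x y)" for h
      using Suc.prems(1)[OF that] by simp
    show ?thesis
      using mods(2,1,3,4) I SE SSE p maps mult_assoc[OF y x y x, symmetric]
        unit_closed[OF x] mult_unit_right[OF y x] unit_closed[OF y] mult_unit_left[OF y x]
        conv(3,4) comult_p[OF x] counit_p Suc_prems h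
      by (rule C.convolution_inverse_cancel)
  qed
  have "mcong I (A x y) (?E (p h)) (?E h)" if h: "h \<in> carrier (A x y)" for h
    using mods(1,2,3,4) I E SE p mul_bilinear[OF x y x] mul_bilinear[OF x x y] mul_bilinear[OF y x y]
      mul_bilinear[OF x y y] mult_assoc[OF x y x y]
      unit_closed[OF x] mult_unit_left[OF x y] unit_closed[OF y] mult_unit_right[OF x y]
      conv(1,2) comult_p[OF x] counit_p odd h
    by (rule C.convolution_inverse_cancel)
  then show ?case using Suc.IH Suc.prems(2) by blast
qed

text \<open>The projection \<open>p\<close> turns out to be congruent to the identity. Since it is a
  positive power of \<open>antipode_sq\<close> after \<open>q\<close>, every \<open>h\<close> is
  then congruent to a value of \<open>antipode_sq\<close>.\<close>

lemma antipode_sq_fitting: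
  assumes x: "x \<in> X" and y: "y \<in> X" and I: "I \<subseteq> carrier k"
    and inv: "\<And>s. s \<in> carrier k \<Longrightarrow> s \<notin> I \<Longrightarrow> \<exists>c\<in>carrier k. \<one> \<ominus> c \<otimes> s \<in> I"
    and h: "h \<in> carrier (A x y)"
  shows "\<exists>u\<in>carrier (A x y). mcong I (A x y) (antipode_sq x y u) h"
proof -
  interpret C: coalgebra k "A x y" by (rule hom_coalgebra[OF x y])
  interpret T: linear_operator k "A x y" "antipode_sq x y"
    by (intro linear_operator.intro linear_operator_axioms.intro C.module_axioms antipode_sq_linear x y)
  obtain n q where q: "q \<in> T.bicommutant" and fitting: "\<And>a. a \<in> carrier (A x y) \<Longrightarrow>
      mcong I (A x y) ((antipode_sq x y ^^ Suc n) ((antipode_sq x y ^^ Suc n) (q a)))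
        ((antipode_sq x y ^^ Suc n) a)"
    using T.fitting_mod[OF hom_finitely_generated[OF x y] I inv] by metis
  define E where "E = antipode_sq x y ^^ Suc n"
  note fitting = fitting[folded E_def]
  note C = C.module_axioms
  note EB = T.T_power_bicommutant[of "Suc n", folded E_def]
  note q_lin = T.bicommutant_linear[OF q] and E_lin = T.bicommutant_linear[OF EB]
  note qE = T.bicommutant_commute[OF q EB]
  have cl: "q u \<in> carrier (A x y)" "E u \<in> carrier (A x y)" if "u \<in> carrier (A x y)" for u
    using that linear_mapsD(1)[OF q_lin] linear_mapsD(1)[OF E_lin] by blast+
  define p where "p = (\<lambda>u. E (q u))"
  have p_lin: "p \<in> linear_maps k (A x y) (A x y)"
    unfolding p_def using linear_maps_comp[OF E_lin q_lin] .
  have p_cl: "p u \<in> carrier (A x y)" if "u \<in> carrier (A x y)" for u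
    using linear_mapsD(1)[OF p_lin that] .
  have Ep: "mcong I (A x y) (E (p u)) (E u)" if "u \<in> carrier (A x y)" for u
    unfolding p_def using fitting[OF that] .
  have pE: "mcong I (A x y) (p (E u)) (E u)" if "u \<in> carrier (A x y)" for u
    unfolding p_def using fitting[OF that] by (simp add: qE[OF that])
  have counit_E: "counit (A x y) (E u) = counit (A x y) u" if "u \<in> carrier (A x y)" for u
    unfolding E_def by (rule counit_antipode_sq_power[OF x y that])
  have comult_E: "sweedler x y P b (E u) = sweedler x y P (\<lambda>v w. b (E v) (E w)) u"
    if "u \<in> carrier (A x y)" "module k P" "b \<in> bilinear_maps k (A x y) (A x y) P"
    for u b and P :: "('c, 'a) coalgebra"
    unfolding E_def by (rule sweedler_antipode_sq_power[OF x y that])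
  have counit_p: "mcong I (base_module k) (counit (A x y) (p u)) (counit (A x y) u)"
    if "u \<in> carrier (A x y)" for u
    using mcong_linear[OF C base_module_module[OF is_cring] I C.counit_linear Ep[OF that]]
    by (simp add: counit_E p_cl that)
  have comult_p: "mcong I (A z z) (sweedler x y (A z z) b (p u))
      (sweedler x y (A z z) (\<lambda>v w. b (p v) (p w)) u)"
    if z: "z \<in> X" and b: "b \<in> bilinear_maps k (A x y) (A x y) (A z z)" and u: "u \<in> carrier (A x y)"
    for z b u
  proof -
    note P = hom_module[OF z z]
    interpret P: module k "A z z" by (rule P)
    note bq = bilinear_maps_comp[OF b q_lin q_lin] and bp = bilinear_maps_comp[OF b p_lin p_lin]
    \<comment> \<open>As \<open>q\<close> commutes with \<open>E\<close>, the sum with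
      \<open>p\<close> on both legs depends on \<open>u'\<close> only through \<open>E u'\<close>.
      Hence, by \<open>Ep\<close>, it changes only by a congruence when \<open>u\<close> is replaced
      by \<open>p u\<close>.\<close>
    have "sweedler x y (A z z) (\<lambda>v w. b (p v) (p w)) u'
        = sweedler x y (A z z) (\<lambda>v w. b (q v) (q w)) (E u')" if "u' \<in> carrier (A x y)" for u'
      unfolding comult_E[OF that P bq] p_def
      by (rule C.sweedler_cong[OF that]) (simp add: qE)
    then have "mcong I (A z z) (sweedler x y (A z z) (\<lambda>v w. b (p v) (p w)) (p u))
        (sweedler x y (A z z) (\<lambda>v w. b (p v) (p w)) u)"
      using mcong_linear[OF C P I C.sweedler_linear[OF P bq] Ep[OF u]] u p_cl by simp
    \<comment> \<open>From the other side, \<open>p u = E (q u)\<close> puts \<open>E\<close> on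
      both legs, where \<open>pE\<close> allows \<open>p\<close> to be dropped. The two congruences
      meet at the sum taken at \<open>p u\<close> with \<open>p\<close> on both legs.\<close>
    moreover have "mcong I (A z z) (sweedler x y (A z z) (\<lambda>v w. b (p v) (p w)) (p u))
        (sweedler x y (A z z) b (p u))"
    proof -
      have "mcong I (A z z) (sweedler x y (A z z) (\<lambda>v w. b (p (E v)) (p (E w))) (q u))
          (sweedler x y (A z z) (\<lambda>v w. b (E v) (E w)) (q u))"
        using P I bilinear_maps_comp[OF bp E_lin E_lin] bilinear_maps_comp[OF b E_lin E_lin] cl(1)[OF u]
      proof (rule C.sweedler_mcong)
        fix v w assume "v \<in> carrier (A x y)" "w \<in> carrier (A x y)"
        then show "mcong I (A z z) (b (p (E v)) (p (E w))) (b (E v) (E w))"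
          by (intro mcong_bilinear[OF C C P I b] pE)
      qed
      then show ?thesis
        using comult_E[OF cl(1)[OF u] P bp] comult_E[OF cl(1)[OF u] P b] by (simp add: p_def)
    qed
    ultimately show ?thesis using mcong_sym[OF P I] P.mcong_trans[OF I] by blast
  qed
  have "mcong I (A x y) (p h) h"
    using x y I p_lin comult_p counit_p Ep[unfolded E_def] h by (rule antipode_sq_descent)
  moreover have "p h = antipode_sq x y ((antipode_sq x y ^^ n) (q h))"
    by (simp add: p_def E_def)
  ultimately show ?thesis
    using T.T_power_closed[OF cl(1)[OF h]] by metis
qed

lemma antipode_surjective:
  assumes x: "x \<in> X" and y: "y \<in> X"
  shows "S y x ` carrier (A y x) = carrier (A x y)"
proof (rule ccontr)
  interpret C: module k "A x y" by (rule hom_module[OF x y])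
  let ?N = "S y x ` carrier (A y x)"
  assume "?N \<noteq> carrier (A x y)"
  obtain K where K: "submodule K k (A x y)" "?N \<subseteq> K" "K \<noteq> carrier (A x y)"
    and max: "\<forall>K'. submodule K' k (A x y) \<longrightarrow> K \<subseteq> K' \<longrightarrow> K' \<noteq> carrier (A x y) \<longrightarrow> K' = K"
    using hom_finitely_generated[OF x y]
      C.submodule_image[OF hom_module[OF y x] antipode_linear[OF y x]] \<open>?N \<noteq> _\<close>
    by (rule C.maximal_submodule)
  note sub = C.submoduleE[OF K(1)]
  define I where "I = {s \<in> carrier k. \<forall>a\<in>carrier (A x y). s \<odot>\<^bsub>A x y\<^esub> a \<in> K}"
  have I: "I \<subseteq> carrier k" by (auto simp: I_def)
  have inv: "\<exists>c\<in>carrier k. \<one> \<ominus> c \<otimes> s \<in> I" if s: "s \<in> carrier k" "s \<notin> I" for s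
  proof -
    obtain a where a: "a \<in> carrier (A x y)" "s \<odot>\<^bsub>A x y\<^esub> a \<notin> K" using s by (auto simp: I_def)
    obtain c where "c \<in> carrier k" "\<forall>b\<in>carrier (A x y). (\<one> \<ominus> c \<otimes> s) \<odot>\<^bsub>A x y\<^esub> b \<in> K"
      using K(1,3) max s(1) a by (rule C.maximal_submodule_scalars)
    then show ?thesis using s(1) by (intro bexI[of _ c]) (simp_all add: I_def)
  qed
  have mod_I: "a \<in> K" if "a \<in> ideal_mult I (A x y)" for a
    using that
  proof induction
    case zero
    show ?case by (rule C.submodule_zero[OF K(1)])
  next
    case (step r a b)
    then show ?case using sub(5) by (simp add: I_def)
  qed
  have "h \<in> K" if h: "h \<in> carrier (A x y)" for h
  proof -
    obtain u where u: "u \<in> carrier (A x y)" "mcong I (A x y) (antipode_sq x y u) h"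
      using antipode_sq_fitting[OF x y I inv h] by blast
    obtain c where "c \<in> ideal_mult I (A x y)" "h = antipode_sq x y u \<oplus>\<^bsub>A x y\<^esub> c"
      using mcong_sym[OF hom_module[OF x y] I u(2)] unfolding mcong_def by blast
    moreover have "antipode_sq x y u \<in> K"
      using K(2) linear_mapsD(1)[OF antipode_linear[OF x y] u(1)] by blast
    ultimately show ?thesis using sub(5) mod_I by simp
  qed
  then show False using K(3) sub(1) by blast
qed

lemma antipode_bij_betw:
  assumes x: "x \<in> X" and y: "y \<in> X"
  shows "bij_betw (S x y) (carrier (A x y)) (carrier (A y x))"
proof -
  interpret T: linear_operator k "A x y" "antipode_sq x y"
    by (intro linear_operator.intro linear_operator_axioms.intro hom_module antipode_sq_linear x y)
  have "antipode_sq x y ` carrier (A x y) = S y x ` S x y ` carrier (A x y)"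
    by (simp add: image_image)
  also have "\<dots> = carrier (A x y)"
    by (simp add: antipode_surjective x y)
  finally have "inj_on (antipode_sq x y) (carrier (A x y))"
    by (rule T.surjective_imp_injective[OF hom_finitely_generated[OF x y]])
  then have "inj_on (S x y) (carrier (A x y))"
    by (rule inj_on_imageI2[of "S y x" "S x y", unfolded comp_def])
  then show ?thesis by (simp add: bij_betw_def antipode_surjective x y)
qed

end

theorem proposition9p6:
  fixes k :: "('c, 'r) ring_scheme"
    and X :: "'x set"
    and A :: "'x \<Rightarrow> 'x \<Rightarrow> ('c, 'a) coalgebra"
    and \<mu> :: "'x \<Rightarrow> 'x \<Rightarrow> 'x \<Rightarrow> ('a \<times> 'a) list set \<Rightarrow> 'a"
    and \<eta> :: "'x \<Rightarrow> 'c \<Rightarrow> 'a"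
    and S :: "'x \<Rightarrow> 'x \<Rightarrow> 'a \<Rightarrow> 'a"
  assumes "hopf_category k X A \<mu> \<eta> S"
  shows "\<forall>x\<in>X. \<forall>y\<in>X. bij_betw (S x y) (carrier (A x y)) (carrier (A y x))"
  using hopf_category.antipode_bij_betw[OF assms] by blast

end
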